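(* Let $\lambda_0\in\mathbb{R}$. Assume that system (S$_\lambda$) of the context satisfies: (i) it is disconjugate on $\mathcal{I}$ with respect to $\lambda=\lambda_0$; (ii) it is identically normal on $\mathcal{I}$; (iii) the definiteness condition holds on $\mathcal{I}$. Let $\lambda<\lambda_0$. Then $H_0-\lambda I$ is bounded from below with lower bound $\gamma>0$. Consequently, $d_+(H_0)=d_-(H_0)=:d$, and therefore $H_0$ has a unique self-adjoint extension (the Friedrichs extension) with the lower bound $\gamma+\lambda$.
   Context: Setting. $\mathcal{I}=\{0,1,2,\dots\}$, $\Delta u(t)=u(t+1)-u(t)$, $M^*$ is the conjugate transpose. For $t\in\mathcal{I}$, $A(t)$ is an $n\times n$ complex matrix with $I_n-A(t)$ invertible, and $B(t),C(t),W(t)$ are $n\times n$ Hermitian matrices with $B(t)\ge 0$, $W(t)\ge 0$. For $\lambda\in\mathbb{C}$, (S$_\lambda$) is $$\Delta u(t)=A(t)u(t+1)+B(t)v(t),\qquad \Delta v(t)=(C(t)-\lambda W(t))u(t+1)-A^*(t)v(t),\quad t\in\mathcal{I}.$$ Solutions are written $y=(u;v)$, $u(t),v(t)\in\mathbb{C}^n$. Put $\tilde A(t)=(I_n-A(t))^{-1}$. Hypotheses. $B^\dagger$ is the Moore–Penrose inverse of $B$. A solution $y=(u;v)$ has a generalized zero at $t=0$ if $u(0)=0$, and at $t\ge 1$ if $u(t-1)\ne 0$, $u(t)\in\mathrm{Ran}(\tilde A(t-1)B(t-1))$ and $u^*(t-1)B^\dagger(t-1)(I_n-A(t-1))u(t)\le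 0$. (S$_\lambda$) is disconjugate on $\mathcal{I}$ with respect to $\lambda=\lambda_0$ if every solution with $\lambda=\lambda_0$ has at most one generalized zero on $\mathcal{I}$. It is identically normal on $\mathcal{I}$ if on every subinterval $\mathcal{I}_1$ of $\mathcal{I}$ the only $\mathbb{C}^n$-valued $v$ with $\Delta v(t)=-A^*(t)v(t)$ and $B(t)v(t)=0$ on $\mathcal{I}_1$ is $v=0$. The definiteness condition holds on $\mathcal{I}$ if there is a finite subinterval $\mathcal{I}_0=[t_0,s_0]\cap\mathbb{Z}\subset\mathcal{I}$ such that for any $\lambda\in\mathbb{C}$ every non-trivial solution $y=(u;v)$ of (S$_\lambda$) satisfies $\sum_{t\in\mathcal{I}_0}u^*(t+1)W(t)u(t+1)>0$. Spaces and relations. $l^2_W(\mathcal{I})$ is the set of sequences $y=\{y(t)\}_{t\in\mathcal{I}}$, $y(t)=(u(t);v(t))\in\mathbb{C}^{2n}$, with $\sum_{t\in\mathcal{I}}u^*(t+1)W(t)u(t+1)<\infty$; $\langle y_1,y_2\rangle_W=\sum_{t\in\mathcal{I}}u_2^*(t+1)W(t)u_1(t+1)$; $\|y\|_W=\langle y,y\rangle_W^{1/2}$; $L^2_W(\mathcal{I})=l^2_W(\mathcal{I})/\{\|y\|_W=0\}$, a Hilbert space, with $[y]$ the class of $y$. $l^2_{W,0}(\mathcal{I})$ is the set of $y\in l^2_W(\mathcal{I})$ for which there is $s\in\mathcal{I}$ with $y(0)=0$ and $y(t)=0$ for $t\ge s$. The maximal relation $H$ is the set of $([y],[y'])\in (L^2_W(\mathcal{I}))^2$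 such that for some representative $y=(u;v)\in[y]$ (and $y'=(u';v')$) $$\Delta u(t)=A(t)u(t+1)+B(t)v(t),\quad \Delta v(t)=C(t)u(t+1)-A^*(t)v(t)-W(t)u'(t+1),\quad t\in\mathcal{I}.$$ The pre-minimal relation $H_{00}$ is the set of $([y],[y'])\in H$ for which such a representative can be chosen in $l^2_{W,0}(\mathcal{I})$; the minimal relation is $H_0=\overline{H_{00}}$. Under the definiteness condition the representative $y$ is unique, and one writes $(y,[y'])$ for $([y],[y'])$. Linear relations. For a linear relation $T$ (a linear subspace of $\mathcal{X}\times\mathcal{X}$, $\mathcal{X}$ a Hilbert space), $T-\lambda I=\{(x,x'-\lambda x):(x,x')\in T\}$, $T^*=\{(y,y'):\langle x,y'\rangle=\langle x',y\rangle\ \forall (x,x')\in T\}$; $T$ is Hermitian if $T\subset T^*$ and self-adjoint if $T=T^*$. $d_\pm(T)=\dim \mathcal{R}(T\mp iI)^{\perp}$, where $\mathcal{R}(T)=\{x':(x,x')\in T\}$. $T$ is bounded from below if there is $\gamma\in\mathbb{R}$ with $\langle x',x\rangle\ge\gamma\|x\|^2$ for all $(x,x')\in T$; the largest such $\gamma$ is its lower bound. Friedrichs extension. The paper describes it as the particular self-adjoint extension which preserves the lower bound, and obtains it from the closure of the Hermitian closable form $\mathbf{t}_\lambda$ with domain $\mathcal{R}(H_{00}-\lambda I)$ given, for $(y,[y'])\in H_{00}$, by $\mathbf{t}_\lambda[y'-\lambda y]=\langle y',y\rangle_W-\lambda\langle y,y\rangle_W$, using that a closed Hermitian form $\mathbf{t}$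 with positive lower bound has a unique associated self-adjoint relation $T_{\mathbf t}$ with the same lower bound such that $\mathcal{D}(T_{\mathbf t})\subset\mathcal{D}(\mathbf{t})$ and $\mathbf{t}[x,y]=\langle x',y\rangle$ for all $(x,x')\in T_{\mathbf t}$, $y\in\mathcal{D}(\mathbf{t})$ (here $\mathcal{D}(T)=\{x:(x,x')\in T\}$).
   Formalization: Several self-adjoint extensions can share the lower bound γ+λ, so the Friedrichs extension is proved to exist with that bound and to be unique among self-adjoint extensions with domain in that of the closure of t_λ; t_λ is taken on D(H_00), not R(H_00−λI). *)

theory Defs
  imports "HOL-Analysis.Analysis" "HOL-Library.Complex_Order"
begin

text \<open>
  Inequalities between complex numbers are those of \<^theory>\<open>HOL-Library.Complex_Order\<close>:
  \<open>x \<le> y\<close> includes the assertion that \<open>x\<close> and \<open>y\<close> have the same imaginary part.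
  In particular \<open>x \<le> 0\<close> says that \<open>x\<close> is real and nonpositive.
\<close>

section \<open>Matrices\<close>

definition ctranspose :: "complex^'n^'m \<Rightarrow> complex^'m^'n" where
  "ctranspose M = (\<chi> i j. cnj (M $ j $ i))"

text \<open>\<open>cdot x y\<close> is \<open>x\<^sup>* y\<close>, hence conjugate linear in the first argument.\<close>

definition cdot :: "complex^'n \<Rightarrow> complex^'n \<Rightarrow> complex" where
  "cdot x y = (\<Sum>i\<in>UNIV. cnj (x $ i) * y $ i)"

definition hermitian_mat :: "complex^'n^'n \<Rightarrow> bool" where
  "hermitian_mat M \<longleftrightarrow> ctranspose M = M"

definition psd_mat :: "complex^'n^'n \<Rightarrow> bool" where
  "psd_mat M \<longleftrightarrow> hermitian_mat M \<and> (\<forall>x. 0 \<le> cdot x (M *v x))"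

definition moore_penrose :: "complex^'n^'m \<Rightarrow> complex^'m^'n" where
  "moore_penrose M = (THE X. M ** X ** M = M \<and> X ** M ** X = X \<and>
     hermitian_mat (M ** X) \<and> hermitian_mat (X ** M))"

section \<open>The discrete Hamiltonian system\<close>

text \<open>A sequence \<open>y\<close> is a function on the naturals with values \<open>y t = (u t, v t)\<close>.\<close>

type_synonym 'n cseq = "nat \<Rightarrow> (complex^'n) \<times> (complex^'n)"
type_synonym 'n coeff = "nat \<Rightarrow> complex^'n^'n"

abbreviation upart :: "'n cseq \<Rightarrow> nat \<Rightarrow> complex^'n" where
  "upart y t \<equiv> fst (y t)"

abbreviation vpart :: "'n cseq \<Rightarrow> nat \<Rightarrow> complex^'n" where
  "vpart y t \<equiv> snd (y t)"

definition hamiltonian_coeffs ::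
  "'n::finite coeff \<Rightarrow> 'n coeff \<Rightarrow> 'n coeff \<Rightarrow> 'n coeff \<Rightarrow> bool" where
  "hamiltonian_coeffs A B C W \<longleftrightarrow> (\<forall>t. invertible (mat 1 - A t) \<and>
     psd_mat (B t) \<and> hermitian_mat (C t) \<and> psd_mat (W t))"

definition A_tilde :: "'n::finite coeff \<Rightarrow> 'n coeff" where
  "A_tilde A t = matrix_inv (mat 1 - A t)"

definition is_solution ::
  "'n::finite coeff \<Rightarrow> 'n coeff \<Rightarrow> 'n coeff \<Rightarrow> 'n coeff \<Rightarrow> complex \<Rightarrow> 'n cseq \<Rightarrow> bool" where
  "is_solution A B C W lam y \<longleftrightarrow> (\<forall>t.
     upart y (t + 1) - upart y t = A t *v upart y (t + 1) + B t *v vpart y t \<and>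
     vpart y (t + 1) - vpart y t =
       (C t *v upart y (t + 1) - lam *s (W t *v upart y (t + 1)))
         - ctranspose (A t) *v vpart y t)"

fun generalized_zero :: "'n::finite coeff \<Rightarrow> 'n coeff \<Rightarrow> 'n cseq \<Rightarrow> nat \<Rightarrow> bool" where
  "generalized_zero A B y 0 \<longleftrightarrow> upart y 0 = 0"
| "generalized_zero A B y (Suc t) \<longleftrightarrow>
     upart y t \<noteq> 0 \<and>
     upart y (Suc t) \<in> range (\<lambda>x. (A_tilde A t ** B t) *v x) \<and>
     cdot (upart y t)
       ((moore_penrose (B t) ** (mat 1 - A t)) *v upart y (Suc t)) \<le> 0"

definition disconjugate ::
  "'n::finite coeff \<Rightarrow> 'n coeff \<Rightarrow> 'n coeff \<Rightarrow> 'n coeff \<Rightarrow> complex \<Rightarrow> bool" where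
  "disconjugate A B C W lam \<longleftrightarrow>
     (\<forall>y. is_solution A B C W lam y \<longrightarrow>
        (\<forall>s t. generalized_zero A B y s \<and> generalized_zero A B y t \<longrightarrow> s = t))"

text \<open>
  The subintervals are nondegenerate, i.e. have at least two points: a one-point subinterval
  would force every \<open>B t\<close> to be invertible.  Unbounded subintervals are covered, since they are
  unions of the bounded ones.
\<close>

definition identically_normal :: "'n::finite coeff \<Rightarrow> 'n coeff \<Rightarrow> bool" where
  "identically_normal A B \<longleftrightarrow> (\<forall>a b. a < b \<longrightarrow> (\<forall>v :: nat \<Rightarrow> complex^'n.
     (\<forall>t\<in>{a..b}. v (t + 1) - v t = - (ctranspose (A t) *v v t) \<and> B t *v v t = 0) \<longrightarrow>
     (\<forall>t\<in>{a..b}. v t = 0)))"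

definition definiteness_condition ::
  "'n::finite coeff \<Rightarrow> 'n coeff \<Rightarrow> 'n coeff \<Rightarrow> 'n coeff \<Rightarrow> bool" where
  "definiteness_condition A B C W \<longleftrightarrow> (\<exists>t0 s0. t0 \<le> s0 \<and>
     (\<forall>lam y. is_solution A B C W lam y \<and> y \<noteq> (\<lambda>t. (0, 0)) \<longrightarrow>
        0 < (\<Sum>t\<in>{t0..s0}. cdot (upart y (t + 1)) (W t *v upart y (t + 1)))))"

section \<open>Complex inner product spaces and linear relations\<close>

text \<open>
  The space \<open>L\<^sup>2\<^sub>W\<close> depends on the sequence \<open>W\<close>, so spaces are given by an explicit carrier and
  explicit operations.  The inner product is linear in the first argument.
\<close>

record 'x ips =
  hcarrier :: "'x set"
  hzero :: 'x
  hadd :: "'x \<Rightarrow> 'x \<Rightarrow> 'x"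
  hscale :: "complex \<Rightarrow> 'x \<Rightarrow> 'x"
  hinner :: "'x \<Rightarrow> 'x \<Rightarrow> complex"

definition hdiff :: "'x ips \<Rightarrow> 'x \<Rightarrow> 'x \<Rightarrow> 'x" where
  "hdiff X x y = hadd X x (hscale X (-1) y)"

definition hnorm :: "'x ips \<Rightarrow> 'x \<Rightarrow> real" where
  "hnorm X x = sqrt (Re (hinner X x x))"

fun hlincomb :: "'x ips \<Rightarrow> complex list \<Rightarrow> 'x list \<Rightarrow> 'x" where
  "hlincomb X (c # cs) (x # xs) = hadd X (hscale X c x) (hlincomb X cs xs)"
| "hlincomb X _ _ = hzero X"

definition hindependent :: "'x ips \<Rightarrow> 'x list \<Rightarrow> bool" where
  "hindependent X xs \<longleftrightarrow> (\<forall>cs. length cs = length xs \<and> hlincomb X cs xs = hzero X \<longrightarrow>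
     (\<forall>c\<in>set cs. c = 0))"

definition hdim :: "'x ips \<Rightarrow> 'x set \<Rightarrow> enat" where
  "hdim X V = Sup {enat (length xs) | xs. set xs \<subseteq> V \<and> hindependent X xs}"

definition orth_complement :: "'x ips \<Rightarrow> 'x set \<Rightarrow> 'x set" where
  "orth_complement X V = {z \<in> hcarrier X. \<forall>x\<in>V. hinner X x z = 0}"

definition rel_shift :: "'x ips \<Rightarrow> ('x \<times> 'x) set \<Rightarrow> complex \<Rightarrow> ('x \<times> 'x) set" where
  "rel_shift X T lam = {(x, hdiff X x' (hscale X lam x)) | x x'. (x, x') \<in> T}"

definition rel_adjoint :: "'x ips \<Rightarrow> ('x \<times> 'x) set \<Rightarrow> ('x \<times> 'x) set" where
  "rel_adjoint X T = {(y, y') \<in> hcarrier X \<times> hcarrier X.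
     \<forall>(x, x')\<in>T. hinner X x y' = hinner X x' y}"

definition self_adjoint :: "'x ips \<Rightarrow> ('x \<times> 'x) set \<Rightarrow> bool" where
  "self_adjoint X T \<longleftrightarrow> T = rel_adjoint X T"

definition rel_closure :: "'x ips \<Rightarrow> ('x \<times> 'x) set \<Rightarrow> ('x \<times> 'x) set" where
  "rel_closure X T = {(x, x') \<in> hcarrier X \<times> hcarrier X.
     \<forall>e>0. \<exists>(z, z')\<in>T. hnorm X (hdiff X x z) < e \<and> hnorm X (hdiff X x' z') < e}"

definition deficiency_plus :: "'x ips \<Rightarrow> ('x \<times> 'x) set \<Rightarrow> enat" where
  "deficiency_plus X T = hdim X (orth_complement X (Range (rel_shift X T \<i>)))"

definition deficiency_minus :: "'x ips \<Rightarrow> ('x \<times> 'x) set \<Rightarrow> enat" where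
  "deficiency_minus X T = hdim X (orth_complement X (Range (rel_shift X T (- \<i>))))"

definition bounded_below_by :: "'x ips \<Rightarrow> ('x \<times> 'x) set \<Rightarrow> real \<Rightarrow> bool" where
  "bounded_below_by X T g \<longleftrightarrow>
     (\<forall>(x, x')\<in>T. complex_of_real (g * (hnorm X x)\<^sup>2) \<le> hinner X x' x)"

definition bounded_from_below :: "'x ips \<Rightarrow> ('x \<times> 'x) set \<Rightarrow> bool" where
  "bounded_from_below X T \<longleftrightarrow> (\<exists>g. bounded_below_by X T g)"

text \<open>
  For a relation that is bounded from below and has a nonzero element in its domain, the supremum
  is a real number and is attained, so it is the largest lower bound in the usual sense.  It is
  infinite if the domain is \<open>{0}\<close>; this does occur for \<open>H\<^sub>0\<close> when \<open>L\<^sup>2\<^sub>W\<close> is finite-dimensional.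
\<close>

definition lower_bound :: "'x ips \<Rightarrow> ('x \<times> 'x) set \<Rightarrow> ereal" where
  "lower_bound X T = Sup {ereal g | g. bounded_below_by X T g}"

section \<open>Sesquilinear forms and the Friedrichs extension\<close>

text \<open>A form is a pair of its domain and its values \<open>t[x, y]\<close>, linear in \<open>x\<close>.\<close>

type_synonym 'x form = "'x set \<times> ('x \<Rightarrow> 'x \<Rightarrow> complex)"

text \<open>
  The form \<open>t\<^sub>\<lambda>[x, y] = \<langle>x', y\<rangle> - \<lambda>\<langle>x, y\<rangle>\<close>, for \<open>(x, x') \<in> S\<close> and \<open>y\<close> in the domain of \<open>S\<close>.
  If \<open>S\<close> is Hermitian the value does not depend on the choice of \<open>x'\<close>.
\<close>

definition relation_form :: "'x ips \<Rightarrow> ('x \<times> 'x) set \<Rightarrow> real \<Rightarrow> 'x form" where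
  "relation_form X S lam = (Domain S, \<lambda>x y.
     hinner X (SOME x'. (x, x') \<in> S) y - complex_of_real lam * hinner X x y)"

definition form_converges :: "'x ips \<Rightarrow> 'x form \<Rightarrow> (nat \<Rightarrow> 'x) \<Rightarrow> 'x \<Rightarrow> bool" where
  "form_converges X t xs x \<longleftrightarrow> range xs \<subseteq> fst t \<and> x \<in> hcarrier X \<and>
     (\<lambda>k. hnorm X (hdiff X (xs k) x)) \<longlonglongrightarrow> 0 \<and>
     (\<forall>e>0. \<exists>N. \<forall>k\<ge>N. \<forall>m\<ge>N.
        cmod (snd t (hdiff X (xs k) (xs m)) (hdiff X (xs k) (xs m))) < e)"

definition form_closable :: "'x ips \<Rightarrow> 'x form \<Rightarrow> bool" where
  "form_closable X t \<longleftrightarrow> (\<forall>xs. form_converges X t xs (hzero X) \<longrightarrow>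
     (\<lambda>k. snd t (xs k) (xs k)) \<longlonglongrightarrow> 0)"

definition form_closure :: "'x ips \<Rightarrow> 'x form \<Rightarrow> 'x form" where
  "form_closure X t = ({x. \<exists>xs. form_converges X t xs x}, \<lambda>x y.
     THE l. \<forall>xs ys. form_converges X t xs x \<and> form_converges X t ys y \<longrightarrow>
       (\<lambda>k. snd t (xs k) (ys k)) \<longlonglongrightarrow> l)"

definition associated_relation :: "'x ips \<Rightarrow> 'x form \<Rightarrow> ('x \<times> 'x) set \<Rightarrow> bool" where
  "associated_relation X t T \<longleftrightarrow> self_adjoint X T \<and> Domain T \<subseteq> fst t \<and>
     (\<forall>(x, x')\<in>T. \<forall>y\<in>fst t. snd t x y = hinner X x' y)"

text \<open>
  \<open>F\<close> is the Friedrichs extension of \<open>S\<close>, obtained from the form \<open>t\<^sub>\<lambda>\<close> of \<open>S - \<lambda>I\<close>, where \<open>\<lambda>\<close> is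
  chosen such that \<open>S - \<lambda>I\<close> has a positive lower bound.
  Other self-adjoint extensions of \<open>S\<close> may have the same lower bound; the Friedrichs extension is
  singled out among all of them by having its domain contained in that of the closed form.
\<close>

definition friedrichs_extension ::
  "'x ips \<Rightarrow> ('x \<times> 'x) set \<Rightarrow> real \<Rightarrow> ('x \<times> 'x) set \<Rightarrow> bool" where
  "friedrichs_extension X S lam F \<longleftrightarrow>
     self_adjoint X F \<and> S \<subseteq> F \<and> form_closable X (relation_form X S lam) \<and>
     associated_relation X (form_closure X (relation_form X S lam))
       (rel_shift X F (complex_of_real lam))"

section \<open>The weighted sequence space and the minimal relation\<close>

definition l2W :: "'n::finite coeff \<Rightarrow> 'n cseq set" where
  "l2W W = {y. summable (\<lambda>t. cdot (upart y (t + 1)) (W t *v upart y (t + 1)))}"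

definition innerW :: "'n::finite coeff \<Rightarrow> 'n cseq \<Rightarrow> 'n cseq \<Rightarrow> complex" where
  "innerW W y1 y2 = (\<Sum>t. cdot (upart y2 (t + 1)) (W t *v upart y1 (t + 1)))"

definition l2W_equiv :: "'n::finite coeff \<Rightarrow> ('n cseq \<times> 'n cseq) set" where
  "l2W_equiv W = {(y, z). y \<in> l2W W \<and> z \<in> l2W W \<and>
     innerW W (\<lambda>t. y t - z t) (\<lambda>t. y t - z t) = 0}"

definition clsW :: "'n::finite coeff \<Rightarrow> 'n cseq \<Rightarrow> 'n cseq set" where
  "clsW W y = l2W_equiv W `` {y}"

definition repr :: "'n cseq set \<Rightarrow> 'n cseq" where
  "repr Y = (SOME y. y \<in> Y)"

definition L2W :: "'n::finite coeff \<Rightarrow> 'n cseq set ips" where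
  "L2W W = \<lparr> hcarrier = l2W W // l2W_equiv W,
     hzero = clsW W (\<lambda>t. (0, 0)),
     hadd = (\<lambda>Y Z. clsW W (\<lambda>t. repr Y t + repr Z t)),
     hscale = (\<lambda>c Y. clsW W (\<lambda>t. (c *s upart (repr Y) t, c *s vpart (repr Y) t))),
     hinner = (\<lambda>Y Z. innerW W (repr Y) (repr Z)) \<rparr>"

definition l2W0 :: "'n::finite coeff \<Rightarrow> 'n cseq set" where
  "l2W0 W = {y \<in> l2W W. y 0 = (0, 0) \<and> (\<exists>s. \<forall>t\<ge>s. y t = (0, 0))}"

definition inhom_system ::
  "'n::finite coeff \<Rightarrow> 'n coeff \<Rightarrow> 'n coeff \<Rightarrow> 'n coeff \<Rightarrow> 'n cseq \<Rightarrow> 'n cseq \<Rightarrow> bool" where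
  "inhom_system A B C W y y' \<longleftrightarrow> (\<forall>t.
     upart y (t + 1) - upart y t = A t *v upart y (t + 1) + B t *v vpart y t \<and>
     vpart y (t + 1) - vpart y t =
       C t *v upart y (t + 1) - ctranspose (A t) *v vpart y t - W t *v upart y' (t + 1))"

definition maximal_relation ::
  "'n::finite coeff \<Rightarrow> 'n coeff \<Rightarrow> 'n coeff \<Rightarrow> 'n coeff \<Rightarrow> ('n cseq set \<times> 'n cseq set) set" where
  "maximal_relation A B C W = {(clsW W y, clsW W y') | y y'.
     y \<in> l2W W \<and> y' \<in> l2W W \<and> inhom_system A B C W y y'}"

definition preminimal_relation ::
  "'n::finite coeff \<Rightarrow> 'n coeff \<Rightarrow> 'n coeff \<Rightarrow> 'n coeff \<Rightarrow> ('n cseq set \<times> 'n cseq set) set" where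
  "preminimal_relation A B C W = {(clsW W y, clsW W y') | y y'.
     y \<in> l2W0 W \<and> y' \<in> l2W W \<and> inhom_system A B C W y y'}"

definition minimal_relation ::
  "'n::finite coeff \<Rightarrow> 'n coeff \<Rightarrow> 'n coeff \<Rightarrow> 'n coeff \<Rightarrow> ('n cseq set \<times> 'n cseq set) set" where
  "minimal_relation A B C W = rel_closure (L2W W) (preminimal_relation A B C W)"

end

theory Submission
  imports Defs
begin

text \<open>
  Positivity of the quadratic form of the system at \<open>\<lambda>\<^sub>0\<close> is proved by induction on the length of
  the support.  A sequence vanishing at \<open>0\<close> and \<open>N + 1\<close> is compared with the solution that vanishes
  at \<open>0\<close> and agrees with it at \<open>N\<close>; such a solution exists because positivity up to \<open>N\<close> together with
  identical normality makes the map from \<open>v 0\<close> to \<open>u N\<close> injective, hence surjective.  A failure of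
  positivity at \<open>N + 1\<close> would be a second generalized zero of this solution.  Summation by parts
  then gives \<open>H\<^sub>0\<^sub>0 - \<lambda> \<ge> \<lambda>\<^sub>0 - \<lambda>\<close>.

  For a semibounded linear relation \<open>S\<close> in a Hilbert space, the Friedrichs extension is the
  restriction of \<open>S\<^sup>*\<close> to the domain of the closed form.  That \<open>F - \<lambda>\<close> is onto comes from
  minimizing \<open>t[y] - 2 Re \<langle>y, f\<rangle>\<close> over the domain of \<open>S\<close>, and self-adjointness follows from this and
  symmetry.  The Cayley transform of \<open>F\<close> identifies the two deficiency spaces.
\<close>

section \<open>Semi-inner product spaces\<close>

text \<open>Two degeneracies shape the proof. \<open>W\<close> may be singular, so sequences have
  null vectors before classes are formed; and the pre-minimal relation may be multivalued, so its
  form lives naturally on pairs \<open>(x, x')\<close> and vanishes on pairs \<open>(0, x')\<close>.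
  Both are met by semi-inner products without any abstract completion: Riesz representation then
  yields a Cauchy sequence instead of a vector, and the limit is taken afterwards in the Hilbert
  space. The induction for positivity has to carry strictness too (form value zero forces
  \<open>h = 0\<close>), because strictness up to \<open>N\<close> is what makes the solutions
  vanishing at \<open>0\<close> fill all values at \<open>N\<close>. One positive bound, here
  \<open>lam0 - lam\<close>, is enough to construct the extension \<open>F\<close>. That the lower
  bound of \<open>F\<close> is exactly \<gamma> + \<lambda> comes from elsewhere: every lower bound
  of \<open>S - \<lambda>\<close>, not only that one, survives form limits, and the closure of
  \<open>S\<close> lies between \<open>S\<close> and \<open>F\<close>.\<close>

lemma tendsto_0_dominated:
  fixes f :: "nat \<Rightarrow> 'a::real_normed_vector"
  assumes "\<And>k. norm (f k) \<le> g k" and "g \<longlonglongrightarrow> 0"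
  shows "f \<longlonglongrightarrow> 0"
  by (rule Lim_null_comparison[OF _ assms(2)]) (simp add: assms(1))

text \<open>No vector space laws are assumed: the operations are known only through their inner
  products, and nonzero vectors may have norm zero. Algebraic identities are therefore verified
  inside \<open>hnorm\<close>, by expanding the inner product.\<close>

locale semi_inner_space =
  fixes X :: "'x ips"
  assumes zero_closed [simp]: "hzero X \<in> hcarrier X"
    and add_closed [simp]: "\<lbrakk>x \<in> hcarrier X; y \<in> hcarrier X\<rbrakk> \<Longrightarrow> hadd X x y \<in> hcarrier X"
    and scale_closed [simp]: "x \<in> hcarrier X \<Longrightarrow> hscale X c x \<in> hcarrier X"
    and inner_zero_left [simp]: "x \<in> hcarrier X \<Longrightarrow> hinner X (hzero X) x = 0"
    and inner_add_left [simp]: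
      "\<lbrakk>x \<in> hcarrier X; y \<in> hcarrier X; z \<in> hcarrier X\<rbrakk>
        \<Longrightarrow> hinner X (hadd X x y) z = hinner X x z + hinner X y z"
    and inner_scale_left [simp]:
      "\<lbrakk>x \<in> hcarrier X; z \<in> hcarrier X\<rbrakk> \<Longrightarrow> hinner X (hscale X c x) z = c * hinner X x z"
    and inner_commute:
      "\<lbrakk>x \<in> hcarrier X; y \<in> hcarrier X\<rbrakk> \<Longrightarrow> hinner X y x = cnj (hinner X x y)"
    and inner_nonneg: "x \<in> hcarrier X \<Longrightarrow> 0 \<le> Re (hinner X x x)"
begin

lemma inner_zero_right [simp]: "x \<in> hcarrier X \<Longrightarrow> hinner X x (hzero X) = 0"
  using inner_commute[of "hzero X" x] by simp

lemma inner_add_right [simp]: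
  "\<lbrakk>x \<in> hcarrier X; y \<in> hcarrier X; z \<in> hcarrier X\<rbrakk>
    \<Longrightarrow> hinner X z (hadd X x y) = hinner X z x + hinner X z y"
  using inner_commute[of "hadd X x y" z] inner_commute[of x z] inner_commute[of y z] by simp

lemma inner_scale_right [simp]:
  "\<lbrakk>x \<in> hcarrier X; z \<in> hcarrier X\<rbrakk> \<Longrightarrow> hinner X z (hscale X c x) = cnj c * hinner X z x"
  using inner_commute[of "hscale X c x" z] inner_commute[of x z] by simp

lemma diff_closed [simp]: "\<lbrakk>x \<in> hcarrier X; y \<in> hcarrier X\<rbrakk> \<Longrightarrow> hdiff X x y \<in> hcarrier X"
  by (simp add: hdiff_def)

lemma inner_diff_left [simp]:
  "\<lbrakk>x \<in> hcarrier X; y \<in> hcarrier X; z \<in> hcarrier X\<rbrakk>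
    \<Longrightarrow> hinner X (hdiff X x y) z = hinner X x z - hinner X y z"
  by (simp add: hdiff_def)

lemma inner_diff_right [simp]:
  "\<lbrakk>x \<in> hcarrier X; y \<in> hcarrier X; z \<in> hcarrier X\<rbrakk>
    \<Longrightarrow> hinner X z (hdiff X x y) = hinner X z x - hinner X z y"
  by (simp add: hdiff_def)

lemma inner_self_Im: "x \<in> hcarrier X \<Longrightarrow> Im (hinner X x x) = 0"
  using inner_commute[of x x] by (simp add: complex_eq_iff)

lemma hnorm_ge_0 [simp]: "x \<in> hcarrier X \<Longrightarrow> 0 \<le> hnorm X x"
  by (simp add: hnorm_def inner_nonneg)

lemma hnorm_power2: "x \<in> hcarrier X \<Longrightarrow> (hnorm X x)\<^sup>2 = Re (hinner X x x)"
  by (simp add: hnorm_def inner_nonneg)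

lemma inner_self: "x \<in> hcarrier X \<Longrightarrow> hinner X x x = complex_of_real ((hnorm X x)\<^sup>2)"
  by (simp add: hnorm_power2 complex_eq_iff inner_self_Im)

lemma Re_inner_commute:
  "\<lbrakk>x \<in> hcarrier X; y \<in> hcarrier X\<rbrakk> \<Longrightarrow> Re (hinner X y x) = Re (hinner X x y)"
  using inner_commute[of x y] by simp

lemma cauchy_schwarz:
  assumes x [simp]: "x \<in> hcarrier X" and y [simp]: "y \<in> hcarrier X"
  shows "cmod (hinner X x y) \<le> hnorm X x * hnorm X y"
proof -
  define a b m where "a = Re (hinner X x x)" and "b = Re (hinner X y y)"
    and "m = (cmod (hinner X x y))\<^sup>2"
  have ab: "0 \<le> a" "0 \<le> b" "0 \<le> m"
    by (simp_all add: a_def b_def m_def inner_nonneg)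
  \<comment> \<open>This is the squared norm of \<open>x - s <x,y> y\<close>, a real quadratic in
    \<open>s\<close>. If \<open>b\<close> is positive, \<open>s = 1 / b\<close> gives the
    claim.\<close>
  have key: "0 \<le> a - 2 * s * m + s\<^sup>2 * m * b" for s :: real
  proof -
    define w where "w = hinner X x y"
    have m: "m = Re w * Re w + Im w * Im w"
      unfolding m_def w_def cmod_power2 by (simp add: power2_eq_square)
    define c where "c = - complex_of_real s * w"
    have yx: "hinner X y x = cnj w" using inner_commute[of x y] by (simp add: w_def)
    have "0 \<le> Re (hinner X (hadd X x (hscale X c y)) (hadd X x (hscale X c y)))"
      by (rule inner_nonneg) simp
    also have "\<dots> = a + Re (cnj c * w + c * cnj w + c * cnj c * hinner X y y)"
      by (simp add: a_def w_def[symmetric] yx algebra_simps)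
    also have "c * cnj c * hinner X y y = complex_of_real (s\<^sup>2 * m * b)"
      using inner_self_Im[OF y]
      by (simp add: c_def complex_eq_iff b_def m power2_eq_square algebra_simps)
    also have "cnj c * w + c * cnj w = complex_of_real (- 2 * s * m)"
      by (simp add: c_def complex_eq_iff m power2_eq_square algebra_simps)
    finally show ?thesis by simp
  qed
  have "m \<le> a * b"
  proof (cases "b = 0")
    case True
    have "m = 0"
    proof (rule ccontr)
      assume "m \<noteq> 0"
      then have "m > 0" using ab by simp
      \<comment> \<open>With \<open>b = 0\<close> the expression is affine in \<open>s\<close>, and
        this choice makes it equal to -1.\<close>
      then show False using key[of "(a + 1) / (2 * m)"] True by simp
    qed
    then show ?thesis using True by simp
  next
    case False
    then have "b > 0" using ab by simp
    then show ?thesis using key[of "1 / b"] by (simp add: field_simps power2_eq_square)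
  qed
  then have "sqrt m \<le> sqrt (a * b)" by simp
  then show ?thesis by (simp add: m_def a_def b_def hnorm_def real_sqrt_mult)
qed

lemma hnorm_triangle:
  assumes [simp]: "x \<in> hcarrier X" "y \<in> hcarrier X"
  shows "hnorm X (hadd X x y) \<le> hnorm X x + hnorm X y"
proof (rule power2_le_imp_le)
  have "Re (hinner X x y) \<le> hnorm X x * hnorm X y"
    using cauchy_schwarz[of x y] complex_Re_le_cmod order_trans by fastforce
  moreover have "(hnorm X (hadd X x y))\<^sup>2 = (hnorm X x)\<^sup>2 + 2 * Re (hinner X x y) + (hnorm X y)\<^sup>2"
    by (simp add: hnorm_power2 Re_inner_commute[of x y])
  ultimately show "(hnorm X (hadd X x y))\<^sup>2 \<le> (hnorm X x + hnorm X y)\<^sup>2"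
    by (simp add: power2_sum)
qed simp

lemma hnorm_add_scale:
  assumes [simp]: "x \<in> hcarrier X" "y \<in> hcarrier X"
  shows "(hnorm X (hadd X x (hscale X c y)))\<^sup>2 =
    (hnorm X x)\<^sup>2 + (cmod c)\<^sup>2 * (hnorm X y)\<^sup>2 + 2 * Re (c * hinner X y x)"
proof -
  have "hinner X x y = cnj (hinner X y x)" by (rule inner_commute) auto
  then have "hinner X (hadd X x (hscale X c y)) (hadd X x (hscale X c y)) =
      hinner X x x + c * cnj c * hinner X y y + (c * hinner X y x + cnj (c * hinner X y x))"
    by (simp add: algebra_simps)
  then show ?thesis
    by (simp add: hnorm_power2 complex_norm_square[symmetric] inner_self_Im)
qed

lemma hnorm_diff_commute:
  "\<lbrakk>x \<in> hcarrier X; y \<in> hcarrier X\<rbrakk> \<Longrightarrow> hnorm X (hdiff X x y) = hnorm X (hdiff X y x)"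
  by (simp add: hnorm_def)

lemma hnorm_diff_triangle:
  assumes [simp]: "x \<in> hcarrier X" "y \<in> hcarrier X" "z \<in> hcarrier X"
  shows "hnorm X (hdiff X x z) \<le> hnorm X (hdiff X x y) + hnorm X (hdiff X y z)"
proof -
  have "hnorm X (hdiff X x z) = hnorm X (hadd X (hdiff X x y) (hdiff X y z))"
    by (simp add: hnorm_def algebra_simps)
  then show ?thesis using hnorm_triangle[of "hdiff X x y" "hdiff X y z"] by simp
qed

lemma hnorm_le_diff:
  assumes [simp]: "x \<in> hcarrier X" "y \<in> hcarrier X"
  shows "hnorm X x \<le> hnorm X (hdiff X x y) + hnorm X y"
proof -
  have "hnorm X x = hnorm X (hadd X (hdiff X x y) y)"
    by (simp add: hnorm_def algebra_simps)
  then show ?thesis using hnorm_triangle[of "hdiff X x y" y] by simp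
qed

end

section \<open>Cauchy sequences, limits of inner products and Riesz representation\<close>

definition hcauchy :: "'x ips \<Rightarrow> (nat \<Rightarrow> 'x) \<Rightarrow> bool" where
  "hcauchy X xs \<longleftrightarrow> range xs \<subseteq> hcarrier X \<and>
     (\<forall>e>0. \<exists>N. \<forall>k\<ge>N. \<forall>m\<ge>N. hnorm X (hdiff X (xs k) (xs m)) < e)"

definition hconverges :: "'x ips \<Rightarrow> (nat \<Rightarrow> 'x) \<Rightarrow> 'x \<Rightarrow> bool" where
  "hconverges X xs x \<longleftrightarrow> range xs \<subseteq> hcarrier X \<and> x \<in> hcarrier X \<and>
     (\<lambda>k. hnorm X (hdiff X (xs k) x)) \<longlonglongrightarrow> 0"

context semi_inner_space
begin

lemma hcauchy_closed: "hcauchy X xs \<Longrightarrow> xs k \<in> hcarrier X"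
  by (auto simp: hcauchy_def)

lemma hcauchyD:
  "\<lbrakk>hcauchy X xs; 0 < e\<rbrakk> \<Longrightarrow> \<exists>N. \<forall>k\<ge>N. \<forall>m\<ge>N. hnorm X (hdiff X (xs k) (xs m)) < e"
  by (simp add: hcauchy_def)

lemma hconverges_closed: "hconverges X xs x \<Longrightarrow> xs k \<in> hcarrier X" "hconverges X xs x \<Longrightarrow> x \<in> hcarrier X"
  by (auto simp: hconverges_def)

lemma hcauchy_bounded:
  assumes "hcauchy X xs"
  obtains M where "0 < M" "\<And>k. hnorm X (xs k) \<le> M"
proof -
  note [simp] = hcauchy_closed[OF assms]
  obtain N where N: "\<And>k m. k \<ge> N \<Longrightarrow> m \<ge> N \<Longrightarrow> hnorm X (hdiff X (xs k) (xs m)) < 1"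
    using hcauchyD[OF assms zero_less_one] by auto
  define M where "M = 1 + (\<Sum>k\<le>N. hnorm X (xs k))"
  have le: "hnorm X (xs k) \<le> (\<Sum>k\<le>N. hnorm X (xs k))" if "k \<le> N" for k
    using that by (intro member_le_sum) auto
  have "hnorm X (xs k) \<le> M" for k
  proof (cases "k \<le> N")
    case True
    then show ?thesis using le[of k] by (simp add: M_def)
  next
    case False
    then have "hnorm X (xs k) \<le> 1 + hnorm X (xs N)"
      using N[of k N] hnorm_le_diff[of "xs k" "xs N"] by simp
    then show ?thesis using le[of N] by (simp add: M_def)
  qed
  moreover have "0 < M" unfolding M_def
    by (intro add_pos_nonneg sum_nonneg) auto
  ultimately show ?thesis using that by blast
qed

text \<open>An interchange of limits: \<open>ps\<close> is bounded and \<open>qs\<close> is Cauchy,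
  so \<open>qs k\<close> may be replaced by one fixed late \<open>qs m\<close> uniformly in
  \<open>k\<close>. Neither sequence needs a limit in the space, which matters for the form space,
  where none may exist.\<close>

lemma inner_tendsto_diagonal:
  assumes ps: "hcauchy X ps" and qs: "hcauchy X qs"
    and L: "\<And>m. (\<lambda>k. hinner X (ps k) (qs m)) \<longlonglongrightarrow> L m" and l: "L \<longlonglongrightarrow> l"
  shows "(\<lambda>k. hinner X (ps k) (qs k)) \<longlonglongrightarrow> l"
proof (rule LIMSEQ_I)
  fix e :: real assume "0 < e"
  note [simp] = hcauchy_closed[OF ps] hcauchy_closed[OF qs]
  obtain M where M: "0 < M" "\<And>k. hnorm X (ps k) \<le> M" using hcauchy_bounded[OF ps] by blast
  obtain N1 where N1: "\<And>k m. k \<ge> N1 \<Longrightarrow> m \<ge> N1 \<Longrightarrow> hnorm X (hdiff X (qs k) (qs m)) < e / (3 * M)"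
    using hcauchyD[OF qs, of "e / (3 * M)"] \<open>0 < e\<close> M(1) by auto
  obtain N2 where N2: "\<And>m. m \<ge> N2 \<Longrightarrow> norm (L m - l) < e / 3"
    using LIMSEQ_D[OF l, of "e / 3"] \<open>0 < e\<close> by auto
  define m where "m = max N1 N2"
  obtain N3 where N3: "\<And>k. k \<ge> N3 \<Longrightarrow> norm (hinner X (ps k) (qs m) - L m) < e / 3"
    using LIMSEQ_D[OF L[of m], of "e / 3"] \<open>0 < e\<close> by auto
  have "norm (hinner X (ps k) (qs k) - l) < e" if k: "k \<ge> max N1 N3" for k
  proof -
    have "norm (hinner X (ps k) (hdiff X (qs k) (qs m))) \<le> hnorm X (ps k) * hnorm X (hdiff X (qs k) (qs m))"
      by (rule cauchy_schwarz) auto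
    also have "\<dots> \<le> M * hnorm X (hdiff X (qs k) (qs m))"
      by (rule mult_right_mono) (auto simp: M)
    also have "\<dots> < M * (e / (3 * M))"
      using N1[of k m] k M(1) by (intro mult_strict_left_mono) (auto simp: m_def)
    also have "\<dots> = e / 3" using M(1) by simp
    finally have 1: "norm (hinner X (ps k) (qs k) - hinner X (ps k) (qs m)) < e / 3" by simp
    have 2: "norm (hinner X (ps k) (qs m) - L m) < e / 3" using N3 k by simp
    have 3: "norm (L m - l) < e / 3" using N2 by (simp add: m_def)
    have "hinner X (ps k) (qs k) - l = (hinner X (ps k) (qs k) - hinner X (ps k) (qs m)) +
        (hinner X (ps k) (qs m) - L m) + (L m - l)" by simp
    also have "norm \<dots> \<le> norm (hinner X (ps k) (qs k) - hinner X (ps k) (qs m)) +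
        norm (hinner X (ps k) (qs m) - L m) + norm (L m - l)"
      by (meson norm_triangle_ineq norm_triangle_mono order_refl)
    finally show ?thesis using 1 2 3 by linarith
  qed
  then show "\<exists>no. \<forall>k\<ge>no. norm (hinner X (ps k) (qs k) - l) < e" by blast
qed

lemma hnorm_tendsto_0_iff:
  assumes "\<And>k. xs k \<in> hcarrier X"
  shows "(\<lambda>k. hnorm X (xs k)) \<longlonglongrightarrow> 0 \<longleftrightarrow> (\<lambda>k. hinner X (xs k) (xs k)) \<longlonglongrightarrow> 0"
proof -
  have "(\<lambda>k. hnorm X (xs k)) \<longlonglongrightarrow> 0 \<longleftrightarrow> (\<lambda>k. (hnorm X (xs k))\<^sup>2) \<longlonglongrightarrow> 0"
    by (simp add: power_tendsto_0_iff)
  also have "\<dots> \<longleftrightarrow> (\<lambda>k. complex_of_real ((hnorm X (xs k))\<^sup>2)) \<longlonglongrightarrow> complex_of_real 0"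
    by (rule tendsto_of_real_iff[symmetric])
  also have "\<dots> \<longleftrightarrow> (\<lambda>k. hinner X (xs k) (xs k)) \<longlonglongrightarrow> 0"
    by (simp only: inner_self[OF assms] of_real_0)
  finally show ?thesis .
qed

text \<open>Testing against the members of the sequence itself is enough, because the diagonal limit
  is then the limit of the squared norms. Closability of the form and completeness of the
  finite-dimensional seminorms both rest on this.\<close>

lemma hcauchy_weakly_null:
  assumes "hcauchy X xs" and "\<And>m. (\<lambda>k. hinner X (xs k) (xs m)) \<longlonglongrightarrow> 0"
  shows "(\<lambda>k. hnorm X (xs k)) \<longlonglongrightarrow> 0"
  unfolding hnorm_tendsto_0_iff[OF hcauchy_closed[OF assms(1)]]
  by (rule inner_tendsto_diagonal[OF assms(1,1,2)]) simp

lemma inner_tendsto_left: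
  assumes xs: "hconverges X xs x" and [simp]: "y \<in> hcarrier X"
  shows "(\<lambda>k. hinner X (xs k) y) \<longlonglongrightarrow> hinner X x y"
proof -
  note [simp] = hconverges_closed[OF xs]
  have "(\<lambda>k. hnorm X (hdiff X (xs k) x) * hnorm X y) \<longlonglongrightarrow> 0 * hnorm X y"
    using xs unfolding hconverges_def by (intro tendsto_mult tendsto_const) auto
  then have "(\<lambda>k. hnorm X (hdiff X (xs k) x) * hnorm X y) \<longlonglongrightarrow> 0" by simp
  moreover have "cmod (hinner X (hdiff X (xs k) x) y) \<le> hnorm X (hdiff X (xs k) x) * hnorm X y" for k
    by (rule cauchy_schwarz) simp_all
  ultimately have "(\<lambda>k. hinner X (hdiff X (xs k) x) y) \<longlonglongrightarrow> 0"
    by (rule tendsto_0_dominated[rotated])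
  then show ?thesis by (simp add: LIM_zero_iff)
qed

lemma inner_tendsto_right:
  assumes "hconverges X xs x" and "y \<in> hcarrier X"
  shows "(\<lambda>k. hinner X y (xs k)) \<longlonglongrightarrow> hinner X y x"
  using tendsto_cnj[OF inner_tendsto_left[OF assms]] hconverges_closed[OF assms(1)] assms(2)
  by (simp add: inner_commute[symmetric])

lemma hcauchy_diff:
  assumes x: "hcauchy X xs" and y: "hcauchy X ys"
  shows "hcauchy X (\<lambda>k. hdiff X (xs k) (ys k))"
  unfolding hcauchy_def
proof (intro conjI allI impI)
  note [simp] = hcauchy_closed[OF x] hcauchy_closed[OF y]
  show "range (\<lambda>k. hdiff X (xs k) (ys k)) \<subseteq> hcarrier X" by auto
  fix e :: real assume "0 < e"
  then have e2: "0 < e / 2" by simp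
  obtain N1 where N1: "\<And>k m. k \<ge> N1 \<Longrightarrow> m \<ge> N1 \<Longrightarrow> hnorm X (hdiff X (xs k) (xs m)) < e / 2"
    using hcauchyD[OF x e2] by auto
  obtain N2 where N2: "\<And>k m. k \<ge> N2 \<Longrightarrow> m \<ge> N2 \<Longrightarrow> hnorm X (hdiff X (ys k) (ys m)) < e / 2"
    using hcauchyD[OF y e2] by auto
  have "hnorm X (hdiff X (hdiff X (xs k) (ys k)) (hdiff X (xs m) (ys m))) < e"
    if "k \<ge> max N1 N2" "m \<ge> max N1 N2" for k m
  proof -
    have "hnorm X (hdiff X (hdiff X (xs k) (ys k)) (hdiff X (xs m) (ys m))) =
        hnorm X (hadd X (hdiff X (xs k) (xs m)) (hdiff X (ys m) (ys k)))"
      by (simp add: hnorm_def algebra_simps)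
    also have "\<dots> \<le> hnorm X (hdiff X (xs k) (xs m)) + hnorm X (hdiff X (ys m) (ys k))"
      by (rule hnorm_triangle) auto
    also have "\<dots> < e" using N1[of k m] N2[of m k] that by simp
    finally show ?thesis .
  qed
  then show "\<exists>N. \<forall>k\<ge>N. \<forall>m\<ge>N.
      hnorm X (hdiff X (hdiff X (xs k) (ys k)) (hdiff X (xs m) (ys m))) < e" by blast
qed

lemma hconverges_cauchy:
  assumes x: "hconverges X xs x"
  shows "hcauchy X xs"
  unfolding hcauchy_def
proof (intro conjI allI impI)
  note [simp] = hconverges_closed[OF x]
  show "range xs \<subseteq> hcarrier X" by auto
  fix e :: real assume "0 < e"
  then obtain N where N: "\<And>k. k \<ge> N \<Longrightarrow> hnorm X (hdiff X (xs k) x) < e / 2"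
    using x LIMSEQ_D[of "\<lambda>k. hnorm X (hdiff X (xs k) x)" 0 "e / 2"]
    unfolding hconverges_def by auto
  have "hnorm X (hdiff X (xs k) (xs m)) < e" if "k \<ge> N" "m \<ge> N" for k m
    using hnorm_diff_triangle[of "xs k" x "xs m"] hnorm_diff_commute[of x "xs m"] N[of k] N[of m] that
    by simp
  then show "\<exists>N. \<forall>k\<ge>N. \<forall>m\<ge>N. hnorm X (hdiff X (xs k) (xs m)) < e" by blast
qed

text \<open>
  The Riesz representation theorem without completeness: a minimizing sequence of
  \<open>\<parallel>x\<parallel>\<^sup>2 - 2 Re (\<phi> x)\<close> is a Cauchy sequence by the parallelogram law.
\<close>

lemma riesz_sequence:
  assumes phi_add: "\<And>x y. \<lbrakk>x \<in> hcarrier X; y \<in> hcarrier X\<rbrakk> \<Longrightarrow> \<phi> (hadd X x y) = \<phi> x + \<phi> y"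
    and phi_scale: "\<And>c x. x \<in> hcarrier X \<Longrightarrow> \<phi> (hscale X c x) = c * \<phi> x"
    and phi_bound: "\<And>x. x \<in> hcarrier X \<Longrightarrow> cmod (\<phi> x) \<le> K * hnorm X x"
  obtains xs where "hcauchy X xs" "\<And>y. y \<in> hcarrier X \<Longrightarrow> (\<lambda>k. hinner X y (xs k)) \<longlonglongrightarrow> \<phi> y"
proof -
  define J where "J x = (hnorm X x)\<^sup>2 - 2 * Re (\<phi> x)" for x
  define d where "d = Inf (J ` hcarrier X)"
  have bdd: "bdd_below (J ` hcarrier X)"
  proof (rule bdd_belowI2)
    fix x assume x: "x \<in> hcarrier X"
    have "Re (\<phi> x) \<le> K * hnorm X x"
      using phi_bound[OF x] complex_Re_le_cmod order_trans by blast
    moreover have "0 \<le> (hnorm X x - K)\<^sup>2" by simp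
    ultimately show "- K\<^sup>2 \<le> J x" by (simp add: J_def power2_diff algebra_simps)
  qed
  have dle: "d \<le> J x" if "x \<in> hcarrier X" for x
    unfolding d_def using bdd that by (simp add: cINF_lower)
  have ne: "J ` hcarrier X \<noteq> {}" using zero_closed by blast
  have "\<exists>x\<in>hcarrier X. J x < d + 1 / real (Suc k)" for k
    using cInf_lessD[OF ne, of "d + 1 / real (Suc k)"] unfolding d_def by auto
  then obtain xs where xs [simp]: "\<And>k. xs k \<in> hcarrier X"
    and J: "\<And>k. J (xs k) < d + 1 / real (Suc k)" by metis
  \<comment> \<open>The value of \<open>J\<close> at the midpoint is at least \<open>d\<close>,
    which turns near-minimality of both points into closeness.\<close>
  have par: "(hnorm X (hdiff X x y))\<^sup>2 \<le> 2 * (J x - d) + 2 * (J y - d)"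
    if [simp]: "x \<in> hcarrier X" "y \<in> hcarrier X" for x y
  proof -
    have "(hnorm X (hdiff X x y))\<^sup>2 = 2 * J x + 2 * J y - 4 * J (hscale X (1/2) (hadd X x y))"
      by (simp add: J_def hnorm_power2 phi_scale phi_add Re_inner_commute[of x y] algebra_simps
          flip: cmod_power2)
    then show ?thesis using dle[of "hscale X (1/2) (hadd X x y)"] by simp
  qed
  have "hcauchy X xs" unfolding hcauchy_def
  proof (intro conjI allI impI)
    show "range xs \<subseteq> hcarrier X" by auto
    fix e :: real assume "0 < e"
    then obtain N where N: "1 / real (Suc N) < e\<^sup>2 / 4"
      using nat_approx_posE[of "e\<^sup>2 / 4"] by auto
    define q where "q = 1 / real (Suc N)"
    have Jq: "J (xs k) < d + q" if "k \<ge> N" for k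
    proof -
      have "1 / real (Suc k) \<le> q" using that by (simp add: q_def field_simps)
      then show ?thesis using J[of k] by linarith
    qed
    have "hnorm X (hdiff X (xs k) (xs m)) < e" if "k \<ge> N" "m \<ge> N" for k m
    proof (rule power2_less_imp_less)
      have "(hnorm X (hdiff X (xs k) (xs m)))\<^sup>2 \<le> 2 * (J (xs k) - d) + 2 * (J (xs m) - d)"
        by (rule par) simp_all
      also have "\<dots> < 2 * q + 2 * q"
        using Jq[OF that(1)] Jq[OF that(2)] by simp
      also have "\<dots> < e\<^sup>2" using N by (simp add: q_def)
      finally show "(hnorm X (hdiff X (xs k) (xs m)))\<^sup>2 < e\<^sup>2" .
    qed (use \<open>0 < e\<close> in simp)
    then show "\<exists>N. \<forall>k\<ge>N. \<forall>m\<ge>N. hnorm X (hdiff X (xs k) (xs m)) < e" by blast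
  qed
  moreover have "(\<lambda>k. hinner X y (xs k)) \<longlonglongrightarrow> \<phi> y" if [simp]: "y \<in> hcarrier X" for y
  proof -
    define b where "b = (hnorm X y)\<^sup>2"
    \<comment> \<open>Moving \<open>x\<close> by \<open>c y\<close> in the direction of descent
      lowers \<open>J\<close> by at least \<open>s\<close> times the squared defect, but
      \<open>J\<close> cannot fall below \<open>d\<close>. The step \<open>1 / (1 + b)\<close>
      instead of \<open>1 / b\<close> also covers \<open>y\<close> of norm zero.\<close>
    have var: "(cmod (hinner X y x - \<phi> y))\<^sup>2 \<le> (1 + b) * (J x - d)" if [simp]: "x \<in> hcarrier X" for x
    proof -
      define w where "w = hinner X y x - \<phi> y"
      define s where "s = 1 / (1 + b)"
      define c where "c = - complex_of_real s * cnj w"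
      have b0: "0 \<le> b" by (simp add: b_def)
      have "J (hadd X x (hscale X c y)) = J x + (cmod c)\<^sup>2 * b + 2 * Re (c * w)"
        by (simp add: J_def b_def hnorm_add_scale phi_add phi_scale w_def algebra_simps)
      moreover have "(cmod c)\<^sup>2 = s\<^sup>2 * (cmod w)\<^sup>2"
        by (simp add: c_def norm_mult power_mult_distrib)
      moreover have "Re (c * w) = - s * (cmod w)\<^sup>2"
        unfolding cmod_power2 by (simp add: c_def power2_eq_square algebra_simps)
      ultimately have "d \<le> J x + s\<^sup>2 * (cmod w)\<^sup>2 * b - 2 * s * (cmod w)\<^sup>2"
        using dle[of "hadd X x (hscale X c y)"] by simp
      then have 1: "(cmod w)\<^sup>2 * (2 * s - s\<^sup>2 * b) \<le> J x - d" by (simp add: algebra_simps)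
      have "s * (s * b) \<le> s * 1"
        using b0 by (intro mult_left_mono) (auto simp: s_def field_simps)
      then have "s \<le> 2 * s - s\<^sup>2 * b" by (simp add: power2_eq_square)
      then have "(cmod w)\<^sup>2 * s \<le> (cmod w)\<^sup>2 * (2 * s - s\<^sup>2 * b)"
        by (intro mult_left_mono) auto
      with 1 have "(cmod w)\<^sup>2 * s \<le> J x - d" by linarith
      then show ?thesis using b0 by (simp add: s_def w_def[symmetric] field_simps)
    qed
    have "(\<lambda>k. (1 + b) * (1 / real (Suc k))) \<longlonglongrightarrow> (1 + b) * 0"
      using LIMSEQ_Suc[OF lim_inverse_n'] by (intro tendsto_mult tendsto_const) auto
    then have "(\<lambda>k. (1 + b) * (1 / real (Suc k))) \<longlonglongrightarrow> 0" by simp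
    then have "(\<lambda>k. (cmod (hinner X y (xs k) - \<phi> y))\<^sup>2) \<longlonglongrightarrow> 0"
    proof (rule tendsto_0_dominated[rotated])
      fix k
      have "0 \<le> 1 + b" by (simp add: b_def)
      then have "(1 + b) * (J (xs k) - d) \<le> (1 + b) * (1 / real (Suc k))"
        using J[of k] by (intro mult_left_mono) linarith+
      then show "norm ((cmod (hinner X y (xs k) - \<phi> y))\<^sup>2) \<le> (1 + b) * (1 / real (Suc k))"
        using var[OF xs, of k] by simp
    qed
    then have "(\<lambda>k. cmod (hinner X y (xs k) - \<phi> y)) \<longlonglongrightarrow> 0"
      by (simp add: power_tendsto_0_iff)
    then show ?thesis
      by (simp add: LIM_zero_iff tendsto_norm_zero_iff)
  qed
  ultimately show ?thesis using that by blast
qed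

end

section \<open>Linear relations in Hilbert space\<close>

definition linear_relation :: "'x ips \<Rightarrow> ('x \<times> 'x) set \<Rightarrow> bool" where
  "linear_relation X T \<longleftrightarrow> T \<subseteq> hcarrier X \<times> hcarrier X \<and> (hzero X, hzero X) \<in> T \<and>
     (\<forall>(x, x')\<in>T. \<forall>(y, y')\<in>T. (hadd X x y, hadd X x' y') \<in> T) \<and>
     (\<forall>c. \<forall>(x, x')\<in>T. (hscale X c x, hscale X c x') \<in> T)"

text \<open>The inner product \<open>b\<close> is left open because a graph is used with two of
  them: the one pulled back from the shifted relation, which is the graph norm, and the
  form.\<close>

definition pair_ips :: "'x ips \<Rightarrow> ('x \<times> 'x) set \<Rightarrow> ('x \<times> 'x \<Rightarrow> 'x \<times> 'x \<Rightarrow> complex) \<Rightarrow> ('x \<times> 'x) ips" where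
  "pair_ips X T b = \<lparr> hcarrier = T, hzero = (hzero X, hzero X),
     hadd = (\<lambda>p q. (hadd X (fst p) (fst q), hadd X (snd p) (snd q))),
     hscale = (\<lambda>c p. (hscale X c (fst p), hscale X c (snd p))),
     hinner = b \<rparr>"

lemma pair_ips_sel [simp]:
  "hcarrier (pair_ips X T b) = T" "hzero (pair_ips X T b) = (hzero X, hzero X)"
  "hadd (pair_ips X T b) p q = (hadd X (fst p) (fst q), hadd X (snd p) (snd q))"
  "hscale (pair_ips X T b) c p = (hscale X c (fst p), hscale X c (snd p))"
  "hinner (pair_ips X T b) = b"
  by (simp_all add: pair_ips_def)

lemma pair_ips_diff [simp]:
  "hdiff (pair_ips X T b) p q = (hdiff X (fst p) (fst q), hdiff X (snd p) (snd q))"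
  by (simp add: hdiff_def)

lemma linear_relation_closed:
  assumes "linear_relation X T" "p \<in> T"
  shows "fst p \<in> hcarrier X" "snd p \<in> hcarrier X"
  using assms by (auto simp: linear_relation_def)

lemma linear_relation_add:
  "\<lbrakk>linear_relation X T; (x, x') \<in> T; (y, y') \<in> T\<rbrakk> \<Longrightarrow> (hadd X x y, hadd X x' y') \<in> T"
  by (auto simp: linear_relation_def)

lemma linear_relation_scale:
  "\<lbrakk>linear_relation X T; (x, x') \<in> T\<rbrakk> \<Longrightarrow> (hscale X c x, hscale X c x') \<in> T"
  by (auto simp: linear_relation_def)

lemma rel_shift_iff:
  "(x, w) \<in> rel_shift X T z \<longleftrightarrow> (\<exists>x'. (x, x') \<in> T \<and> w = hdiff X x' (hscale X z x))"
  by (auto simp: rel_shift_def)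

lemma Range_rel_shift: "Range (rel_shift X T z) = {hdiff X x' (hscale X z x) | x x'. (x, x') \<in> T}"
  by (auto simp: rel_shift_def)

lemma rel_adjoint_iff:
  "(y, y') \<in> rel_adjoint X T \<longleftrightarrow> y \<in> hcarrier X \<and> y' \<in> hcarrier X \<and>
     (\<forall>x x'. (x, x') \<in> T \<longrightarrow> hinner X x y' = hinner X x' y)"
  by (auto simp: rel_adjoint_def)

lemma rel_adjoint_subset: "rel_adjoint X T \<subseteq> hcarrier X \<times> hcarrier X"
  by (auto simp: rel_adjoint_def)

lemma self_adjoint_mem: "self_adjoint X F \<Longrightarrow> p \<in> rel_adjoint X F \<Longrightarrow> p \<in> F"
  unfolding self_adjoint_def by metis

lemma self_adjoint_mem_adjoint: "self_adjoint X F \<Longrightarrow> p \<in> F \<Longrightarrow> p \<in> rel_adjoint X F"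
  unfolding self_adjoint_def by metis

lemma self_adjoint_subset: "self_adjoint X F \<Longrightarrow> F \<subseteq> hcarrier X \<times> hcarrier X"
  using self_adjoint_mem_adjoint rel_adjoint_subset by blast

lemma rel_closure_iff:
  "(x, x') \<in> rel_closure X T \<longleftrightarrow> x \<in> hcarrier X \<and> x' \<in> hcarrier X \<and>
     (\<forall>e>0. \<exists>z z'. (z, z') \<in> T \<and> hnorm X (hdiff X x z) < e \<and> hnorm X (hdiff X x' z') < e)"
  by (auto simp: rel_closure_def Bex_def)

lemma rel_adjoint_antimono: "T \<subseteq> U \<Longrightarrow> rel_adjoint X U \<subseteq> rel_adjoint X T"
  by (auto simp: rel_adjoint_def)

lemma hcauchy_dominated:
  assumes "hcauchy Y ps" and "\<And>k. xs k \<in> hcarrier X"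
    and "\<And>k m. hnorm X (hdiff X (xs k) (xs m)) \<le> hnorm Y (hdiff Y (ps k) (ps m))"
  shows "hcauchy X xs"
proof -
  have "\<exists>N. \<forall>k\<ge>N. \<forall>m\<ge>N. hnorm X (hdiff X (xs k) (xs m)) < e" if "0 < e" for e
  proof -
    have "\<exists>N. \<forall>k\<ge>N. \<forall>m\<ge>N. hnorm Y (hdiff Y (ps k) (ps m)) < e"
      using assms(1) that by (simp add: hcauchy_def)
    then obtain N where "\<forall>k\<ge>N. \<forall>m\<ge>N. hnorm Y (hdiff Y (ps k) (ps m)) < e" ..
    then show ?thesis using assms(3) by (meson le_less_trans)
  qed
  then show ?thesis using assms(2) unfolding hcauchy_def by auto
qed

context semi_inner_space
begin

section \<open>Adjoints and closures of relations\<close>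

lemma linear_relation_adjoint:
  assumes "T \<subseteq> hcarrier X \<times> hcarrier X"
  shows "linear_relation X (rel_adjoint X T)"
  using assms unfolding linear_relation_def by (fastforce simp: rel_adjoint_def)

lemma rel_adjoint_seq_closed:
  assumes T: "T \<subseteq> hcarrier X \<times> hcarrier X" and mem: "\<And>k. (xs k, xs' k) \<in> rel_adjoint X T"
    and x: "hconverges X xs x" and x': "hconverges X xs' x'"
  shows "(x, x') \<in> rel_adjoint X T"
proof -
  have "hinner X y x' = hinner X y' x" if y: "(y, y') \<in> T" for y y'
  proof -
    have "y \<in> hcarrier X" "y' \<in> hcarrier X" using T y by auto
    then have "(\<lambda>k. hinner X y (xs' k)) \<longlonglongrightarrow> hinner X y x'" "(\<lambda>k. hinner X y' (xs k)) \<longlonglongrightarrow> hinner X y' x"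
      using inner_tendsto_right[OF x'] inner_tendsto_right[OF x] by auto
    moreover have "hinner X y (xs' k) = hinner X y' (xs k)" for k
      using mem[of k] y by (simp add: rel_adjoint_iff)
    ultimately show ?thesis using LIMSEQ_unique by simp
  qed
  then show ?thesis using hconverges_closed(2)[OF x] hconverges_closed(2)[OF x']
    by (simp add: rel_adjoint_iff)
qed

lemma rel_closure_sequence:
  assumes T: "T \<subseteq> hcarrier X \<times> hcarrier X" and x: "(x, x') \<in> rel_closure X T"
  obtains xs xs' where "\<And>k. (xs k, xs' k) \<in> T" "hconverges X xs x" "hconverges X xs' x'"
proof -
  have c: "x \<in> hcarrier X" "x' \<in> hcarrier X" using x by (auto simp: rel_closure_iff)
  have "\<exists>z z'. (z, z') \<in> T \<and> hnorm X (hdiff X x z) < 1 / real (Suc k) \<and>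
      hnorm X (hdiff X x' z') < 1 / real (Suc k)" for k
    using x unfolding rel_closure_iff by (metis of_nat_0_less_iff zero_less_Suc zero_less_divide_1_iff)
  then obtain xs xs' where s: "\<And>k. (xs k, xs' k) \<in> T"
    and n: "\<And>k. hnorm X (hdiff X x (xs k)) < 1 / real (Suc k)"
      "\<And>k. hnorm X (hdiff X x' (xs' k)) < 1 / real (Suc k)" by metis
  have sc: "xs k \<in> hcarrier X" "xs' k \<in> hcarrier X" for k using s T by auto
  have lim: "(\<lambda>k. 1 / real (Suc k)) \<longlonglongrightarrow> 0" using LIMSEQ_Suc[OF lim_inverse_n'] by simp
  have "(\<lambda>k. hnorm X (hdiff X (xs k) x)) \<longlonglongrightarrow> 0"
    by (rule tendsto_0_dominated[OF _ lim])
       (use n(1) sc c hnorm_diff_commute[OF c(1) sc(1)] in \<open>simp add: less_imp_le\<close>)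
  moreover have "(\<lambda>k. hnorm X (hdiff X (xs' k) x')) \<longlonglongrightarrow> 0"
    by (rule tendsto_0_dominated[OF _ lim])
       (use n(2) sc c hnorm_diff_commute[OF c(2) sc(2)] in \<open>simp add: less_imp_le\<close>)
  ultimately show ?thesis using that[of xs xs'] s sc c by (auto simp: hconverges_def)
qed

text \<open>Adjoints are closed under sequential limits. For self-adjoint \<open>F\<close> this
  places the closure of every restriction of \<open>F\<close> inside \<open>F\<close>.\<close>

lemma rel_closure_subset_adjoint:
  assumes "T \<subseteq> rel_adjoint X F" "F \<subseteq> hcarrier X \<times> hcarrier X"
  shows "rel_closure X T \<subseteq> rel_adjoint X F"
proof (rule subrelI)
  fix x x' assume x: "(x, x') \<in> rel_closure X T"
  have "T \<subseteq> hcarrier X \<times> hcarrier X" using assms(1) by (auto simp: rel_adjoint_def)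
  then obtain xs xs' where "\<And>k. (xs k, xs' k) \<in> T" "hconverges X xs x" "hconverges X xs' x'"
    using rel_closure_sequence[OF _ x] by blast
  then show "(x, x') \<in> rel_adjoint X F"
    using rel_adjoint_seq_closed[OF assms(2), of xs xs'] assms(1) by blast
qed

end

locale hilbert_space = semi_inner_space +
  assumes definite: "\<lbrakk>x \<in> hcarrier X; y \<in> hcarrier X; hnorm X (hdiff X x y) = 0\<rbrakk> \<Longrightarrow> x = y"
    and complete: "hcauchy X xs \<Longrightarrow> \<exists>x. hconverges X xs x"
begin

text \<open>The source of all equations between vectors: since no vector space laws are available,
  both sides are tested against every \<open>z\<close>.\<close>

lemma eqI:
  assumes "x \<in> hcarrier X" "y \<in> hcarrier X"
    and "\<And>z. z \<in> hcarrier X \<Longrightarrow> hinner X x z = hinner X y z"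
  shows "x = y"
  by (rule definite) (use assms in \<open>simp_all add: hnorm_def\<close>)

lemma hnorm_diff_self [simp]: "x \<in> hcarrier X \<Longrightarrow> hnorm X (hdiff X x x) = 0"
  by (simp add: hnorm_def)

lemma subset_rel_closure:
  assumes "T \<subseteq> hcarrier X \<times> hcarrier X"
  shows "T \<subseteq> rel_closure X T"
proof (rule subrelI)
  fix x x' assume x: "(x, x') \<in> T"
  then have "x \<in> hcarrier X" "x' \<in> hcarrier X" using assms by auto
  then show "(x, x') \<in> rel_closure X T"
    unfolding rel_closure_iff using x hnorm_diff_self by metis
qed

lemma self_adjoint_linear: "self_adjoint X F \<Longrightarrow> linear_relation X F"
proof -
  assume F: "self_adjoint X F"
  then have "linear_relation X (rel_adjoint X F)"
    using linear_relation_adjoint self_adjoint_subset by blast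
  then show ?thesis using F by (metis self_adjoint_def)
qed

lemma self_adjoint_sym:
  "\<lbrakk>self_adjoint X F; (x, x') \<in> F; (y, y') \<in> F\<rbrakk> \<Longrightarrow> hinner X x y' = hinner X x' y"
  using self_adjoint_mem_adjoint[of X F "(y, y')"] by (simp add: rel_adjoint_iff)

lemma self_adjoint_rel_shift:
  assumes F: "self_adjoint X F"
  shows "self_adjoint X (rel_shift X F (complex_of_real r))"
  unfolding self_adjoint_def
proof (intro equalityI subrelI)
  have cl: "x \<in> hcarrier X" "x' \<in> hcarrier X" if "(x, x') \<in> F" for x x'
    using that self_adjoint_subset[OF F] by auto
  fix x w assume "(x, w) \<in> rel_shift X F (complex_of_real r)"
  then obtain x' where x: "(x, x') \<in> F" and w: "w = hdiff X x' (hscale X (complex_of_real r) x)"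
    by (auto simp: rel_shift_iff)
  show "(x, w) \<in> rel_adjoint X (rel_shift X F (complex_of_real r))"
    unfolding rel_adjoint_iff rel_shift_iff
    using cl[OF x] cl self_adjoint_sym[OF F _ x] by (auto simp: w)
next
  have cl: "x \<in> hcarrier X" "x' \<in> hcarrier X" if "(x, x') \<in> F" for x x'
    using that self_adjoint_subset[OF F] by auto
  fix y g assume "(y, g) \<in> rel_adjoint X (rel_shift X F (complex_of_real r))"
  then have c [simp]: "y \<in> hcarrier X" "g \<in> hcarrier X"
    and adj: "\<And>x x'. (x, x') \<in> F \<Longrightarrow> hinner X x g = hinner X (hdiff X x' (hscale X (complex_of_real r) x)) y"
    by (auto simp: rel_adjoint_iff rel_shift_iff)
  have "(y, hadd X g (hscale X (complex_of_real r) y)) \<in> rel_adjoint X F"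
    unfolding rel_adjoint_iff using adj cl by simp
  then have "(y, hadd X g (hscale X (complex_of_real r) y)) \<in> F"
    by (rule self_adjoint_mem[OF F])
  moreover have "g = hdiff X (hadd X g (hscale X (complex_of_real r) y)) (hscale X (complex_of_real r) y)"
    by (rule eqI) auto
  ultimately show "(y, g) \<in> rel_shift X F (complex_of_real r)"
    unfolding rel_shift_iff by blast
qed

text \<open>The shifted graph carries the graph norm, so the Riesz sequence for \<open>f\<close>
  converges in both components, and its limit stays in the closed relation \<open>F\<close>. The
  residual \<open>w\<close> is orthogonal to the range of \<open>F - z\<close>; hence
  \<open>(w, cnj z w)\<close> lies in the adjoint, that is in \<open>F\<close>, and a symmetric
  relation has no nonreal eigenvalue.\<close>

lemma self_adjoint_range:
  assumes F: "self_adjoint X F" and z: "z = \<i> \<or> z = - \<i>" and f [simp]: "f \<in> hcarrier X"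
  shows "\<exists>x x'. (x, x') \<in> F \<and> f = hdiff X x' (hscale X z x)"
proof -
  note lin = self_adjoint_linear[OF F]
  note cl [simp] = linear_relation_closed[OF lin]
  define sh where "sh p = hdiff X (snd p) (hscale X z (fst p))" for p
  define G where "G = pair_ips X F (\<lambda>p q. hinner X (sh p) (sh q))"
  have G_sel [simp]: "hcarrier G = F" "hinner G p q = hinner X (sh p) (sh q)"
    "hdiff G p q = (hdiff X (fst p) (fst q), hdiff X (snd p) (snd q))" for p q
    by (simp_all add: G_def)
  have sh [simp]: "sh p \<in> hcarrier X" if "p \<in> F" for p
    using that by (simp add: sh_def)
  interpret G: semi_inner_space G
  proof
    show "hzero G \<in> hcarrier G" using lin by (simp add: G_def linear_relation_def)
    show "hadd G p q \<in> hcarrier G" if "p \<in> hcarrier G" "q \<in> hcarrier G" for p q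
      using that linear_relation_add[OF lin, of "fst p" "snd p" "fst q" "snd q"] by (simp add: G_def)
    show "hscale G c p \<in> hcarrier G" if "p \<in> hcarrier G" for p c
      using that linear_relation_scale[OF lin, of "fst p" "snd p"] by (simp add: G_def)
    show "hinner G (hzero G) p = 0" if "p \<in> hcarrier G" for p
      using that by (simp add: G_def) (simp add: sh_def[of "(_, _)"])
    show "hinner G (hadd G p q) r = hinner G p r + hinner G q r"
      if "p \<in> hcarrier G" "q \<in> hcarrier G" "r \<in> hcarrier G" for p q r
      using that by (simp add: G_def) (simp add: sh_def[of "(_, _)"] sh_def[of p] sh_def[of q] algebra_simps)
    show "hinner G (hscale G c p) r = c * hinner G p r"
      if "p \<in> hcarrier G" "r \<in> hcarrier G" for p r c
      using that by (simp add: G_def) (simp add: sh_def[of "(_, _)"] sh_def[of p] algebra_simps)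
    show "hinner G q p = cnj (hinner G p q)" if "p \<in> hcarrier G" "q \<in> hcarrier G" for p q
      using that inner_commute[of "sh p" "sh q"] by simp
    show "0 \<le> Re (hinner G p p)" if "p \<in> hcarrier G" for p
      using that by (simp add: inner_nonneg)
  qed
  \<comment> \<open>The cross terms cancel because \<open><x', x>\<close> is real and
    \<open>z\<close> is purely imaginary of modulus 1.\<close>
  have G_norm: "(hnorm G p)\<^sup>2 = (hnorm X (snd p))\<^sup>2 + (hnorm X (fst p))\<^sup>2" if p: "p \<in> F" for p
  proof -
    have s: "hinner X (fst p) (snd p) = hinner X (snd p) (fst p)"
      using self_adjoint_sym[OF F, of "fst p" "snd p" "fst p" "snd p"] p by simp
    show ?thesis using p z unfolding G.hnorm_power2[of p, simplified, OF p]
      by (auto simp: sh_def s hnorm_power2 algebra_simps)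
  qed
  obtain ps where ps: "hcauchy G ps"
    and lim: "\<And>q. q \<in> F \<Longrightarrow> (\<lambda>k. hinner X (sh q) (sh (ps k))) \<longlonglongrightarrow> hinner X (sh q) f"
  proof (rule G.riesz_sequence[of "\<lambda>q. hinner X (sh q) f" "hnorm X f"])
    show "cmod (hinner X (sh q) f) \<le> hnorm X f * hnorm G q" if "q \<in> hcarrier G" for q
      using cauchy_schwarz[of "sh q" f] that by (simp add: hnorm_def mult.commute)
  qed (auto simp: G_def sh_def algebra_simps)
  have psF [simp]: "ps k \<in> F" for k using G.hcauchy_closed[OF ps, of k] by simp
  have d: "(hdiff X (fst (ps k)) (fst (ps m)), hdiff X (snd (ps k)) (snd (ps m))) \<in> F" for k m
    using G.diff_closed[of "ps k" "ps m"] by simp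
  have le: "hnorm X (hdiff X (fst (ps k)) (fst (ps m))) \<le> hnorm G (hdiff G (ps k) (ps m)) \<and>
    hnorm X (hdiff X (snd (ps k)) (snd (ps m))) \<le> hnorm G (hdiff G (ps k) (ps m))" for k m
  proof -
    have "0 \<le> hnorm G (hdiff G (ps k) (ps m))" by (rule G.hnorm_ge_0) (simp add: d)
    moreover have "(hnorm G (hdiff G (ps k) (ps m)))\<^sup>2 =
        (hnorm X (hdiff X (snd (ps k)) (snd (ps m))))\<^sup>2 + (hnorm X (hdiff X (fst (ps k)) (fst (ps m))))\<^sup>2"
      using G_norm[OF d, of k m] by simp
    ultimately show ?thesis by (auto intro: power2_le_imp_le)
  qed
  have "hcauchy X (\<lambda>k. fst (ps k))"
    by (rule hcauchy_dominated[OF ps]) (simp, use le in blast)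
  moreover have "hcauchy X (\<lambda>k. snd (ps k))"
    by (rule hcauchy_dominated[OF ps]) (simp, use le in blast)
  ultimately obtain x x' where x: "hconverges X (\<lambda>k. fst (ps k)) x" and x': "hconverges X (\<lambda>k. snd (ps k)) x'"
    using complete by blast
  note [simp] = hconverges_closed(2)[OF x] hconverges_closed(2)[OF x']
  have xF: "(x, x') \<in> F"
  proof -
    have "(x, x') \<in> rel_adjoint X F"
      by (rule rel_adjoint_seq_closed[OF _ _ x x'])
         (use self_adjoint_subset[OF F] self_adjoint_mem_adjoint[OF F psF] in simp_all)
    then show ?thesis by (rule self_adjoint_mem[OF F])
  qed
  define w where "w = hdiff X f (sh (x, x'))"
  have w [simp]: "w \<in> hcarrier X" using xF by (simp add: w_def)
  have orth: "hinner X (sh q) w = 0" if q: "q \<in> F" for q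
  proof -
    have "(\<lambda>k. hinner X (sh q) (snd (ps k)) - cnj z * hinner X (sh q) (fst (ps k)))
        \<longlonglongrightarrow> hinner X (sh q) x' - cnj z * hinner X (sh q) x"
      by (intro tendsto_intros inner_tendsto_right x x') (use q in auto)
    moreover have "hinner X (sh q) (snd (ps k)) - cnj z * hinner X (sh q) (fst (ps k)) =
        hinner X (sh q) (sh (ps k))" for k
      using q by (simp add: sh_def[of "ps k"])
    ultimately have "hinner X (sh q) f = hinner X (sh q) x' - cnj z * hinner X (sh q) x"
      using LIMSEQ_unique lim[OF q] by simp
    then show ?thesis using q xF by (simp add: w_def) (simp add: sh_def[of "(x, x')"])
  qed
  have "(w, hscale X (cnj z) w) \<in> rel_adjoint X F"
    unfolding rel_adjoint_iff
    using orth cl by (fastforce simp: sh_def)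
  then have wF: "(w, hscale X (cnj z) w) \<in> F" by (rule self_adjoint_mem[OF F])
  \<comment> \<open>Symmetry of \<open>F\<close> on this pair says
    \<open>z <w, w> = cnj z <w, w>\<close>.\<close>
  have "hinner X w w = 0"
    using self_adjoint_sym[OF F wF wF] z by auto
  then have "hnorm X w = 0" by (simp add: hnorm_def)
  then have "f = sh (x, x')" unfolding w_def using xF by (intro definite) auto
  then show ?thesis using xF by (auto simp: sh_def)
qed

text \<open>
  The Cayley transform \<open>x' - z x \<mapsto> x' - cnj z x\<close> of a self-adjoint extension is an isometry of the
  whole space, so it carries one deficiency space onto the other.
\<close>

lemma deficiency_space_le:
  assumes F: "self_adjoint X F" and TF: "T \<subseteq> F" and z: "z = \<i> \<or> z = - \<i>"
  shows "hdim X (orth_complement X (Range (rel_shift X T z)))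
    \<le> hdim X (orth_complement X (Range (rel_shift X T (cnj z))))"
proof -
  note lin = self_adjoint_linear[OF F]
  have cl: "x \<in> hcarrier X" "x' \<in> hcarrier X" if "(x, x') \<in> F" for x x'
    using that self_adjoint_subset[OF F] by auto
  \<comment> \<open>The Cayley transform is kept as a relation. \<open>P_inner\<close> replaces
    well-definedness and injectivity: whatever is related to a null vector has norm zero, so a
    chosen value \<open>U\<close> preserves linear independence.\<close>
  define P where "P g h \<longleftrightarrow> (\<exists>x x'. (x, x') \<in> F \<and> g = hdiff X x' (hscale X z x) \<and>
    h = hdiff X x' (hscale X (cnj z) x))" for g h
  have P_closed: "g \<in> hcarrier X" "h \<in> hcarrier X" if "P g h" for g h
    using that cl by (auto simp: P_def)
  have P_total: "\<exists>h. P g h" if "g \<in> hcarrier X" for g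
    using self_adjoint_range[OF F z that] by (auto simp: P_def)
  have P_inner: "hinner X g g2 = hinner X h h2" if P1: "P g h" and P2: "P g2 h2" for g h g2 h2
  proof -
    obtain x x' y y' where F1: "(x, x') \<in> F" and F2: "(y, y') \<in> F" and
      e: "g = hdiff X x' (hscale X z x)" "h = hdiff X x' (hscale X (cnj z) x)"
      "g2 = hdiff X y' (hscale X z y)" "h2 = hdiff X y' (hscale X (cnj z) y)"
      using P1 P2 unfolding P_def by blast
    have "hinner X x y' = hinner X x' y" by (rule self_adjoint_sym[OF F F1 F2])
    moreover have "x \<in> hcarrier X" "x' \<in> hcarrier X" "y \<in> hcarrier X" "y' \<in> hcarrier X"
      using cl F1 F2 by auto
    ultimately show ?thesis unfolding e by (simp add: algebra_simps)
  qed
  have P_zero: "P (hzero X) (hzero X)"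
  proof -
    have "hzero X = hdiff X (hzero X) (hscale X c (hzero X))" for c by (rule eqI) auto
    then show ?thesis using lin unfolding P_def linear_relation_def by blast
  qed
  have P_lin: "P (hadd X (hscale X c g) g2) (hadd X (hscale X c h) h2)" if P1: "P g h" and P2: "P g2 h2" for c g h g2 h2
  proof -
    obtain x x' y y' where F1: "(x, x') \<in> F" and F2: "(y, y') \<in> F" and
      e: "g = hdiff X x' (hscale X z x)" "h = hdiff X x' (hscale X (cnj z) x)"
      "g2 = hdiff X y' (hscale X z y)" "h2 = hdiff X y' (hscale X (cnj z) y)"
      using P1 P2 unfolding P_def by blast
    have [simp]: "x \<in> hcarrier X" "x' \<in> hcarrier X" "y \<in> hcarrier X" "y' \<in> hcarrier X"
      using cl F1 F2 by auto
    have "(hadd X (hscale X c x) y, hadd X (hscale X c x') y') \<in> F"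
      using linear_relation_add[OF lin linear_relation_scale[OF lin F1] F2] .
    moreover have "hadd X (hscale X c (hdiff X x' (hscale X a x))) (hdiff X y' (hscale X a y)) =
        hdiff X (hadd X (hscale X c x') y') (hscale X a (hadd X (hscale X c x) y))" for a
      by (rule eqI) (auto simp: algebra_simps)
    ultimately show ?thesis unfolding P_def e by blast
  qed
  define U where "U g = (SOME h. P g h)" for g
  have U: "P g (U g)" if "g \<in> hcarrier X" for g
    unfolding U_def using P_total[OF that] by (rule someI_ex)
  have comb: "P (hlincomb X cs gs) (hlincomb X cs (map U gs))" if "set gs \<subseteq> hcarrier X" for cs gs
    using that
  proof (induction cs arbitrary: gs)
    case (Cons c cs)
    then show ?case by (cases gs) (auto simp: P_zero intro: P_lin U)
  qed (simp add: P_zero)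
  have "\<exists>hs. length hs = length gs \<and> set hs \<subseteq> orth_complement X (Range (rel_shift X T (cnj z))) \<and>
      hindependent X hs"
    if gs: "set gs \<subseteq> orth_complement X (Range (rel_shift X T z))" and ind: "hindependent X gs" for gs
  proof (intro exI conjI)
    have gc: "set gs \<subseteq> hcarrier X" using gs by (auto simp: orth_complement_def)
    show "length (map U gs) = length gs" by simp
    show "set (map U gs) \<subseteq> orth_complement X (Range (rel_shift X T (cnj z)))"
    proof
      fix h assume "h \<in> set (map U gs)"
      then obtain g where g: "g \<in> set gs" "h = U g" by auto
      then have gh: "P g h" using U gc by blast
      have "hinner X (hdiff X x' (hscale X (cnj z) x)) h = 0" if x: "(x, x') \<in> T" for x x'
      proof -
        have "P (hdiff X x' (hscale X z x)) (hdiff X x' (hscale X (cnj z) x))"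
          using x TF unfolding P_def by blast
        then have "hinner X (hdiff X x' (hscale X (cnj z) x)) h = hinner X (hdiff X x' (hscale X z x)) g"
          using P_inner gh by metis
        also have "\<dots> = 0" using gs g(1) x unfolding orth_complement_def Range_rel_shift by blast
        finally show ?thesis .
      qed
      then show "h \<in> orth_complement X (Range (rel_shift X T (cnj z)))"
        using P_closed[OF gh] unfolding orth_complement_def Range_rel_shift by blast
    qed
    show "hindependent X (map U gs)"
      unfolding hindependent_def
    proof (intro allI impI)
      fix cs assume cs: "length cs = length (map U gs) \<and> hlincomb X cs (map U gs) = hzero X"
      have Pc: "P (hlincomb X cs gs) (hzero X)" using comb[OF gc, of cs] cs by simp
      have "hinner X (hlincomb X cs gs) (hlincomb X cs gs) = hinner X (hzero X) (hzero X)"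
        by (rule P_inner[OF Pc Pc])
      then have "hlincomb X cs gs = hzero X"
        by (intro definite) (use P_closed[OF Pc] in \<open>simp_all add: hnorm_def\<close>)
      then show "\<forall>c\<in>set cs. c = 0" using ind cs unfolding hindependent_def by auto
    qed
  qed
  then show ?thesis unfolding hdim_def by (intro Sup_mono) (force simp del: enat_ord_simps)
qed

lemma deficiency_eq:
  assumes "self_adjoint X F" "T \<subseteq> F"
  shows "deficiency_plus X T = deficiency_minus X T"
  using deficiency_space_le[OF assms, of \<i>] deficiency_space_le[OF assms, of "- \<i>"]
  by (simp add: deficiency_plus_def deficiency_minus_def)

end

section \<open>The Friedrichs extension of a semibounded relation\<close>

text \<open>\<open>c\<close> is some positive lower bound of \<open>S - lam\<close>, not the largest
  one. It provides coercivity; the exact lower bound is recovered separately at the end.\<close>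

locale semibounded_relation = hilbert_space +
  fixes S :: "('a \<times> 'a) set" and lam c :: real
  assumes lin: "linear_relation X S"
    and c_pos: "0 < c"
    and bound: "bounded_below_by X (rel_shift X S (complex_of_real lam)) c"
begin

lemma S_closed:
  assumes "(x, x') \<in> S" shows "x \<in> hcarrier X" "x' \<in> hcarrier X"
  using linear_relation_closed[OF lin assms] by simp_all

lemma S_closed_pair [simp]: "p \<in> S \<Longrightarrow> fst p \<in> hcarrier X" "p \<in> S \<Longrightarrow> snd p \<in> hcarrier X"
  using S_closed[of "fst p" "snd p"] by simp_all

lemma S_bound:
  assumes "(x, x') \<in> S"
  shows "complex_of_real (c * (hnorm X x)\<^sup>2) \<le> hinner X x' x - complex_of_real lam * hinner X x x"
proof -
  have "(x, hdiff X x' (hscale X (complex_of_real lam) x)) \<in> rel_shift X S (complex_of_real lam)"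
    using assms by (auto simp: rel_shift_iff)
  then have "complex_of_real (c * (hnorm X x)\<^sup>2) \<le> hinner X (hdiff X x' (hscale X (complex_of_real lam) x)) x"
    using bound unfolding bounded_below_by_def by blast
  then show ?thesis using S_closed[OF assms] by simp
qed

lemma S_real:
  assumes "(x, x') \<in> S" shows "Im (hinner X x' x) = 0"
  using S_bound[OF assms] inner_self_Im[OF S_closed(1)[OF assms]] by (simp add: less_eq_complex_def)

text \<open>Symmetry follows from the quadratic form being real, by polarization.\<close>

lemma S_sym:
  assumes x: "(x, x') \<in> S" and y: "(y, y') \<in> S"
  shows "hinner X x y' = hinner X x' y"
proof -
  note [simp] = S_closed[OF x] S_closed[OF y]
  have "Im (hinner X (hadd X x' y') (hadd X x y)) = 0"
    using linear_relation_add[OF lin x y] by (rule S_real)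
  moreover have "Im (hinner X (hadd X x' (hscale X \<i> y')) (hadd X x (hscale X \<i> y))) = 0"
    using linear_relation_add[OF lin x linear_relation_scale[OF lin y]] by (rule S_real)
  ultimately have "hinner X y' x = cnj (hinner X x' y)"
    using S_real[OF x] S_real[OF y] by (simp add: complex_eq_iff)
  then show ?thesis using inner_commute[of y' x] by simp
qed

text \<open>The form is placed on the graph of \<open>S\<close> rather than on its domain, so that
  no second component has to be chosen. Pairs \<open>(0, x')\<close> in \<open>S\<close> become null
  vectors, hence only a semi-inner product results.\<close>

definition form_space :: "('a \<times> 'a) ips" where
  "form_space = pair_ips X S (\<lambda>p q. hinner X (snd p) (fst q) - complex_of_real lam * hinner X (fst p) (fst q))"

lemma form_space_sel [simp]:
  "hcarrier form_space = S" "hinner form_space p q = hinner X (snd p) (fst q) - complex_of_real lam * hinner X (fst p) (fst q)"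
  "hdiff form_space p q = (hdiff X (fst p) (fst q), hdiff X (snd p) (snd q))"
  by (simp_all add: form_space_def)

sublocale form: semi_inner_space form_space
proof
  show "hzero form_space \<in> hcarrier form_space" using lin by (simp add: form_space_def linear_relation_def)
  show "hadd form_space p q \<in> hcarrier form_space" if "p \<in> hcarrier form_space" "q \<in> hcarrier form_space" for p q
    using that linear_relation_add[OF lin, of "fst p" "snd p" "fst q" "snd q"] by (simp add: form_space_def)
  show "hscale form_space a p \<in> hcarrier form_space" if "p \<in> hcarrier form_space" for p a
    using that linear_relation_scale[OF lin, of "fst p" "snd p"] by (simp add: form_space_def)
  show "hinner form_space (hzero form_space) p = 0" if "p \<in> hcarrier form_space" for p
    using that by (simp add: form_space_def)
  show "hinner form_space (hadd form_space p q) r = hinner form_space p r + hinner form_space q r"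
    if "p \<in> hcarrier form_space" "q \<in> hcarrier form_space" "r \<in> hcarrier form_space" for p q r
    using that by (simp add: form_space_def algebra_simps)
  show "hinner form_space (hscale form_space a p) r = a * hinner form_space p r"
    if "p \<in> hcarrier form_space" "r \<in> hcarrier form_space" for p r a
    using that by (simp add: form_space_def algebra_simps)
  show "hinner form_space q p = cnj (hinner form_space p q)" if "p \<in> hcarrier form_space" "q \<in> hcarrier form_space" for p q
    using that S_sym[of "fst p" "snd p" "fst q" "snd q"] inner_commute[of "fst p" "fst q"]
      inner_commute[of "fst p" "snd q"] by simp
  show "0 \<le> Re (hinner form_space p p)" if "p \<in> hcarrier form_space" for p
  proof -
    have "c * (hnorm X (fst p))\<^sup>2 \<le> Re (hinner form_space p p)"
      using S_bound[of "fst p" "snd p"] that by (simp add: less_eq_complex_def)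
    then show ?thesis using c_pos by (smt (verit) mult_nonneg_nonneg zero_le_power2)
  qed
qed

lemma coercive: "p \<in> S \<Longrightarrow> c * (hnorm X (fst p))\<^sup>2 \<le> (hnorm form_space p)\<^sup>2"
  using S_bound[of "fst p" "snd p"] by (simp add: form.hnorm_power2 less_eq_complex_def)

lemma hnorm_fst_le:
  assumes "p \<in> S" shows "hnorm X (fst p) \<le> 1 / sqrt c * hnorm form_space p"
proof -
  have "sqrt (c * (hnorm X (fst p))\<^sup>2) \<le> sqrt ((hnorm form_space p)\<^sup>2)"
    using coercive[OF assms] by (rule real_sqrt_le_mono)
  then have "sqrt c * hnorm X (fst p) \<le> hnorm form_space p"
    using assms form.hnorm_ge_0[of p] by (simp add: real_sqrt_mult)
  then show ?thesis using c_pos by (simp add: field_simps)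
qed

lemma hcauchy_fst:
  assumes ps: "hcauchy form_space ps" shows "hcauchy X (\<lambda>k. fst (ps k))"
  unfolding hcauchy_def
proof (intro conjI allI impI)
  have psS [simp]: "ps k \<in> S" for k using form.hcauchy_closed[OF ps, of k] by simp
  show "range (\<lambda>k. fst (ps k)) \<subseteq> hcarrier X" by auto
  fix e :: real assume "0 < e"
  then have "0 < sqrt c * e" using c_pos by simp
  then obtain N where N: "\<And>k m. k \<ge> N \<Longrightarrow> m \<ge> N \<Longrightarrow> hnorm form_space (hdiff form_space (ps k) (ps m)) < sqrt c * e"
    using form.hcauchyD[OF ps] by meson
  have "hnorm X (hdiff X (fst (ps k)) (fst (ps m))) < e" if "k \<ge> N" "m \<ge> N" for k m
  proof -
    have "hdiff form_space (ps k) (ps m) \<in> S" using form.diff_closed[of "ps k" "ps m"] by simp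
    then have "hnorm X (hdiff X (fst (ps k)) (fst (ps m))) \<le> 1 / sqrt c * hnorm form_space (hdiff form_space (ps k) (ps m))"
      using hnorm_fst_le[of "hdiff form_space (ps k) (ps m)"] by simp
    also have "\<dots> < 1 / sqrt c * (sqrt c * e)"
      using N[OF that] c_pos by (intro mult_strict_left_mono) simp_all
    also have "\<dots> = e" using c_pos by simp
    finally show ?thesis .
  qed
  then show "\<exists>N. \<forall>k\<ge>N. \<forall>m\<ge>N. hnorm X (hdiff X (fst (ps k)) (fst (ps m))) < e" by blast
qed

section \<open>The closed form, described by form-Cauchy sequences\<close>

definition fconv :: "(nat \<Rightarrow> 'a \<times> 'a) \<Rightarrow> 'a \<Rightarrow> bool" where
  "fconv ps x \<longleftrightarrow> hcauchy form_space ps \<and> hconverges X (\<lambda>k. fst (ps k)) x"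

text \<open>The domain of the closure of the form (see \<open>fst_form_closure\<close>). It sits
  inside the Hilbert space because coercivity makes form-Cauchy sequences converge there.\<close>

definition form_domain :: "'a set" where
  "form_domain = {x. \<exists>ps. fconv ps x}"

lemma fconv_closed: "fconv ps x \<Longrightarrow> ps k \<in> S" "fconv ps x \<Longrightarrow> x \<in> hcarrier X"
  unfolding fconv_def using form.hcauchy_closed[of ps k] hconverges_closed(2) by auto

lemma fconv_const:
  assumes "p \<in> S" shows "fconv (\<lambda>_. p) (fst p)"
proof -
  have "hnorm form_space (hdiff form_space p p) = 0"
    using assms by (simp add: hnorm_def)
  then show ?thesis using assms by (simp add: fconv_def hcauchy_def hconverges_def)
qed

lemma hcauchy_fconv:
  assumes "hcauchy form_space ps" obtains x where "fconv ps x"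
  using complete[OF hcauchy_fst[OF assms]] assms by (auto simp: fconv_def)

text \<open>
  A form-Cauchy sequence is weakly convergent in the form, and the weak limit is determined by
  the limit in the space: this is where closability comes from.
\<close>

lemma fconv_weak_limit:
  assumes ps: "fconv ps x" and q: "q \<in> S"
  shows "(\<lambda>k. hinner form_space (ps k) q) \<longlonglongrightarrow> hinner X x (snd q) - complex_of_real lam * hinner X x (fst q)"
proof -
  have x: "hconverges X (\<lambda>k. fst (ps k)) x" using ps by (simp add: fconv_def)
  have "(\<lambda>k. hinner X (fst (ps k)) (snd q) - complex_of_real lam * hinner X (fst (ps k)) (fst q))
      \<longlonglongrightarrow> hinner X x (snd q) - complex_of_real lam * hinner X x (fst q)"
    by (intro tendsto_intros inner_tendsto_left[OF x]) (use q in simp_all)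
  moreover have "hinner X (fst (ps k)) (snd q) = hinner X (snd (ps k)) (fst q)" for k
    using S_sym[of "fst (ps k)" "snd (ps k)" "fst q" "snd q"] fconv_closed(1)[OF ps] q by simp
  ultimately show ?thesis by simp
qed

text \<open>The representation \<open>t[x, y] = <x', y> - lam <x, y>\<close> of the closed form
  whenever \<open>x\<close> also lies in the domain of the adjoint. For a fixed member of
  \<open>qs\<close> the weak limit is rewritten by the adjoint relation, and then the diagonal limit
  is taken. Symmetry, the form values and the lower bound of the extension are all read off from
  it.\<close>

lemma fconv_pairing:
  assumes ps: "fconv ps x" and x': "(x, x') \<in> rel_adjoint X S" and qs: "fconv qs y"
  shows "(\<lambda>k. hinner form_space (ps k) (qs k)) \<longlonglongrightarrow> hinner X x' y - complex_of_real lam * hinner X x y"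
proof (rule form.inner_tendsto_diagonal)
  have c [simp]: "x \<in> hcarrier X" "x' \<in> hcarrier X" using x' by (auto simp: rel_adjoint_iff)
  show "hcauchy form_space ps" "hcauchy form_space qs" using ps qs by (simp_all add: fconv_def)
  show "(\<lambda>k. hinner form_space (ps k) (qs m)) \<longlonglongrightarrow> hinner X x' (fst (qs m)) - complex_of_real lam * hinner X x (fst (qs m))" for m
  proof -
    have q: "qs m \<in> S" using fconv_closed(1)[OF qs] .
    then have "(fst (qs m), snd (qs m)) \<in> S" by simp
    then have "hinner X (fst (qs m)) x' = hinner X (snd (qs m)) x"
      using x' unfolding rel_adjoint_iff by blast
    then have "hinner X x (snd (qs m)) = hinner X x' (fst (qs m))"
      using q inner_commute[of "fst (qs m)" x'] inner_commute[of "snd (qs m)" x] by simp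
    then show ?thesis using fconv_weak_limit[OF ps q] by simp
  qed
  have y: "hconverges X (\<lambda>k. fst (qs k)) y" using qs by (simp add: fconv_def)
  show "(\<lambda>m. hinner X x' (fst (qs m)) - complex_of_real lam * hinner X x (fst (qs m)))
      \<longlonglongrightarrow> hinner X x' y - complex_of_real lam * hinner X x y"
    by (intro tendsto_intros inner_tendsto_right[OF y]) simp_all
qed

section \<open>The extension and its self-adjointness\<close>

definition friedrichs :: "('a \<times> 'a) set" where
  "friedrichs = {(x, x') \<in> rel_adjoint X S. x \<in> form_domain}"

lemma friedrichs_iff: "(x, x') \<in> friedrichs \<longleftrightarrow> (x, x') \<in> rel_adjoint X S \<and> x \<in> form_domain"
  by (simp add: friedrichs_def)

lemma friedrichs_closed: "(x, x') \<in> friedrichs \<Longrightarrow> x \<in> hcarrier X" "(x, x') \<in> friedrichs \<Longrightarrow> x' \<in> hcarrier X"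
  by (auto simp: friedrichs_iff rel_adjoint_iff)

lemma S_subset_friedrichs: "S \<subseteq> friedrichs"
proof (rule subrelI)
  fix x x' assume x: "(x, x') \<in> S"
  then have "x \<in> form_domain" using fconv_const[OF x] by (auto simp: form_domain_def)
  then show "(x, x') \<in> friedrichs" using x S_sym[OF _ x] S_closed[OF x]
    by (auto simp: friedrichs_iff rel_adjoint_iff)
qed

text \<open>The same form values have a limit that can be computed from either argument by
  \<open>fconv_pairing\<close>; since \<open>lam\<close> is real, the two results differ only by the
  order of the pairing.\<close>

lemma friedrichs_sym:
  assumes x: "(x, x') \<in> friedrichs" and y: "(y, y') \<in> friedrichs"
  shows "hinner X x y' = hinner X x' y"
proof -
  note [simp] = friedrichs_closed[OF x] friedrichs_closed[OF y]
  obtain ps qs where ps: "fconv ps x" and qs: "fconv qs y"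
    using x y by (auto simp: friedrichs_iff form_domain_def)
  have "(\<lambda>k. hinner form_space (ps k) (qs k)) \<longlonglongrightarrow> hinner X x' y - complex_of_real lam * hinner X x y"
    using fconv_pairing[OF ps _ qs] x by (simp add: friedrichs_iff)
  moreover have "(\<lambda>k. cnj (hinner form_space (qs k) (ps k))) \<longlonglongrightarrow> cnj (hinner X y' x - complex_of_real lam * hinner X y x)"
    using fconv_pairing[OF qs _ ps] y by (intro tendsto_cnj) (simp add: friedrichs_iff)
  moreover have "cnj (hinner form_space (qs k) (ps k)) = hinner form_space (ps k) (qs k)" for k
    using form.inner_commute[of "qs k" "ps k"] fconv_closed(1)[OF ps] fconv_closed(1)[OF qs] by simp
  ultimately have "hinner X x' y - complex_of_real lam * hinner X x y =
      cnj (hinner X y' x - complex_of_real lam * hinner X y x)"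
    using LIMSEQ_unique by simp
  then show ?thesis
    using inner_commute[of y' x] inner_commute[of y x] by simp
qed

lemma friedrichs_range:
  assumes f [simp]: "f \<in> hcarrier X"
  obtains r where "(r, hadd X f (hscale X (complex_of_real lam) r)) \<in> friedrichs"
proof -
  obtain ps where ps: "hcauchy form_space ps"
    and lim: "\<And>q. q \<in> S \<Longrightarrow> (\<lambda>k. hinner form_space q (ps k)) \<longlonglongrightarrow> hinner X (fst q) f"
  \<comment> \<open>The functional is bounded for the form norm because coercivity dominates the
    norm by \<open>1 / sqrt c\<close> times the form norm.\<close>
  proof (rule form.riesz_sequence[of "\<lambda>q. hinner X (fst q) f" "hnorm X f / sqrt c"])
    show "cmod (hinner X (fst q) f) \<le> hnorm X f / sqrt c * hnorm form_space q" if "q \<in> hcarrier form_space" for q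
    proof -
      have "cmod (hinner X (fst q) f) \<le> hnorm X (fst q) * hnorm X f"
        using that by (intro cauchy_schwarz) auto
      also have "\<dots> \<le> 1 / sqrt c * hnorm form_space q * hnorm X f"
        using that hnorm_fst_le[of q] by (intro mult_right_mono) auto
      finally show ?thesis by (simp add: mult.commute)
    qed
  qed (auto simp: form_space_def)
  obtain r where r: "fconv ps r" using hcauchy_fconv[OF ps] .
  note [simp] = fconv_closed(2)[OF r]
  \<comment> \<open>In the limit Riesz says \<open>t[q, r] = <q, f>\<close> for all \<open>q\<close>
    in the domain of \<open>S\<close>, which is the weak formulation of
    \<open>(F - lam) r = f\<close>.\<close>
  have "(r, hadd X f (hscale X (complex_of_real lam) r)) \<in> rel_adjoint X S"
    unfolding rel_adjoint_iff
  proof (intro conjI allI impI)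
    fix q q' assume q: "(q, q') \<in> S"
    note [simp] = S_closed[OF q]
    have "(\<lambda>k. cnj (hinner form_space (ps k) (q, q'))) \<longlonglongrightarrow> cnj (hinner X r q' - complex_of_real lam * hinner X r q)"
      using fconv_weak_limit[OF r q] by (intro tendsto_cnj) simp
    moreover have "cnj (hinner form_space (ps k) (q, q')) = hinner form_space (q, q') (ps k)" for k
      using form.inner_commute[of "ps k" "(q, q')"] fconv_closed(1)[OF r] q by simp
    ultimately have "hinner X q f = cnj (hinner X r q' - complex_of_real lam * hinner X r q)"
      using LIMSEQ_unique lim[OF q] by simp
    then show "hinner X q (hadd X f (hscale X (complex_of_real lam) r)) = hinner X q' r"
      using inner_commute[of r q'] inner_commute[of r q] by simp
  qed simp_all
  then show ?thesis using that r by (auto simp: friedrichs_iff form_domain_def)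
qed

lemma friedrichs_self_adjoint: "self_adjoint X friedrichs"
  unfolding self_adjoint_def
proof (intro equalityI subrelI)
  fix x x' assume "(x, x') \<in> friedrichs"
  then show "(x, x') \<in> rel_adjoint X friedrichs"
    using friedrichs_sym friedrichs_closed by (auto simp: rel_adjoint_iff)
next
  fix y y' assume y: "(y, y') \<in> rel_adjoint X friedrichs"
  then have [simp]: "y \<in> hcarrier X" "y' \<in> hcarrier X" by (auto simp: rel_adjoint_iff)
  define f where "f = hdiff X y' (hscale X (complex_of_real lam) y)"
  have [simp]: "f \<in> hcarrier X" by (simp add: f_def)
  obtain r where r: "(r, hadd X f (hscale X (complex_of_real lam) r)) \<in> friedrichs" using friedrichs_range[of f] by auto
  note [simp] = friedrichs_closed(1)[OF r]
  \<comment> \<open>While \<open>r\<close> solves \<open>(F - lam) r = f\<close>, the element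
    \<open>s\<close> is chosen as a test element with \<open>(F - lam) s = y - r\<close>. Pairing it
    with \<open>y\<close> and with \<open>r\<close> gives the same value, so
    \<open><y - r, y - r> = 0\<close>.\<close>
  obtain s where s: "(s, hadd X (hdiff X y r) (hscale X (complex_of_real lam) s)) \<in> friedrichs"
    using friedrichs_range[of "hdiff X y r"] by auto
  note [simp] = friedrichs_closed(1)[OF s]
  have "hinner X s y' = hinner X (hadd X (hdiff X y r) (hscale X (complex_of_real lam) s)) y"
    using y s unfolding rel_adjoint_iff by blast
  moreover have "hinner X s (hadd X f (hscale X (complex_of_real lam) r)) =
      hinner X (hadd X (hdiff X y r) (hscale X (complex_of_real lam) s)) r"
    by (rule friedrichs_sym[OF s r])
  ultimately have "hinner X (hdiff X y r) (hdiff X y r) = 0"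
    by (simp add: f_def algebra_simps) algebra
  then have yr: "y = r" by (intro definite) (simp_all add: hnorm_def)
  moreover have "hadd X f (hscale X (complex_of_real lam) r) = y'"
    by (rule eqI) (simp_all add: f_def yr)
  ultimately show "(y, y') \<in> friedrichs" using r by simp
qed

lemma closure_subset_friedrichs: "rel_closure X S \<subseteq> friedrichs"
proof -
  have "S \<subseteq> rel_adjoint X friedrichs" using S_subset_friedrichs self_adjoint_mem_adjoint[OF friedrichs_self_adjoint] by blast
  then have "rel_closure X S \<subseteq> rel_adjoint X friedrichs"
    using rel_closure_subset_adjoint self_adjoint_subset[OF friedrichs_self_adjoint] by blast
  then show ?thesis using self_adjoint_mem[OF friedrichs_self_adjoint] by blast
qed

text \<open>Any such \<open>G\<close> is a restriction of the adjoint of \<open>S\<close> with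
  domain in the form domain, hence contained in \<open>friedrichs\<close>. Self-adjoint relations
  have no proper self-adjoint restriction, since taking adjoints reverses the inclusion.\<close>

lemma friedrichs_unique:
  assumes G: "self_adjoint X G" and "rel_closure X S \<subseteq> G" and D: "Domain G \<subseteq> form_domain"
  shows "G = friedrichs"
proof -
  have SG: "S \<subseteq> G" using assms(2) subset_rel_closure lin by (auto simp: linear_relation_def)
  have GF: "G \<subseteq> friedrichs"
  proof (rule subrelI)
    fix x x' assume x: "(x, x') \<in> G"
    then have "(x, x') \<in> rel_adjoint X S"
      using self_adjoint_mem_adjoint[OF G] rel_adjoint_antimono[OF SG] by blast
    then show "(x, x') \<in> friedrichs" using D x by (auto simp: friedrichs_iff)
  qed
  moreover have "friedrichs \<subseteq> G"
    using self_adjoint_mem_adjoint[OF friedrichs_self_adjoint] rel_adjoint_antimono[OF GF] self_adjoint_mem[OF G] by blast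
  ultimately show ?thesis by blast
qed

section \<open>Comparison with the closable form and its closure\<close>

lemma relation_form_eq:
  assumes x: "(x, x') \<in> S" and "y \<in> Domain S"
  shows "snd (relation_form X S lam) x y = hinner X x' y - complex_of_real lam * hinner X x y"
proof -
  obtain y' where y: "(y, y') \<in> S" using assms(2) by blast
  have "(x, SOME x'. (x, x') \<in> S) \<in> S" using x by (rule someI[of "\<lambda>x'. (x, x') \<in> S"])
  \<comment> \<open>Both values equal \<open><x, y'>\<close> by symmetry, so the chosen second
    component is immaterial.\<close>
  then have "hinner X (SOME x'. (x, x') \<in> S) y = hinner X x' y"
    using S_sym[OF _ y] x by metis
  then show ?thesis by (simp add: relation_form_def)
qed

lemma relation_form_value:
  "\<lbrakk>p \<in> S; q \<in> S\<rbrakk> \<Longrightarrow> snd (relation_form X S lam) (fst p) (fst q) = hinner form_space p q"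
  using relation_form_eq[of "fst p" "snd p" "fst q"] DomainI[of "fst q" "snd q" S] by simp

lemma cmod_form_diff:
  assumes "p \<in> S" "q \<in> S"
  shows "cmod (snd (relation_form X S lam) (hdiff X (fst p) (fst q)) (hdiff X (fst p) (fst q))) =
    (hnorm form_space (hdiff form_space p q))\<^sup>2"
proof -
  have d: "hdiff form_space p q \<in> S" using form.diff_closed[of p q] assms by simp
  have "cmod (hinner form_space (hdiff form_space p q) (hdiff form_space p q)) = (hnorm form_space (hdiff form_space p q))\<^sup>2"
    by (subst form.inner_self) (use d in \<open>simp_all del: form_space_sel(2,3) add: norm_power\<close>)
  then show ?thesis using relation_form_value[OF d d] by simp
qed

text \<open>A sequence in the domain lifts to the graph with arbitrary second components, because
  the form seminorm of a difference does not see which ones were taken.\<close>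

lemma form_converges_iff:
  "form_converges X (relation_form X S lam) xs x \<longleftrightarrow> (\<exists>ps. fconv ps x \<and> xs = (\<lambda>k. fst (ps k)))"
proof
  assume "form_converges X (relation_form X S lam) xs x"
  then have D: "\<And>k. xs k \<in> Domain S" and x: "x \<in> hcarrier X"
    and l: "(\<lambda>k. hnorm X (hdiff X (xs k) x)) \<longlonglongrightarrow> 0"
    and cau: "\<And>e. 0 < e \<Longrightarrow> \<exists>N. \<forall>k\<ge>N. \<forall>m\<ge>N.
        cmod (snd (relation_form X S lam) (hdiff X (xs k) (xs m)) (hdiff X (xs k) (xs m))) < e"
    by (auto simp: form_converges_def relation_form_def)
  have "\<exists>x'. (xs k, x') \<in> S" for k using D by blast
  then obtain xs' where s: "\<And>k. (xs k, xs' k) \<in> S" by metis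
  define ps where "ps k = (xs k, xs' k)" for k
  have ps: "ps k \<in> S" "xs k = fst (ps k)" for k using s by (simp_all add: ps_def)
  have "hcauchy form_space ps" unfolding hcauchy_def
  proof (intro conjI allI impI)
    show "range ps \<subseteq> hcarrier form_space" using ps by auto
    fix e :: real assume "0 < e"
    then obtain N where "\<forall>k\<ge>N. \<forall>m\<ge>N.
        cmod (snd (relation_form X S lam) (hdiff X (xs k) (xs m)) (hdiff X (xs k) (xs m))) < e\<^sup>2"
      using cau[of "e\<^sup>2"] by auto
    then have "\<forall>k\<ge>N. \<forall>m\<ge>N. (hnorm form_space (hdiff form_space (ps k) (ps m)))\<^sup>2 < e\<^sup>2"
      unfolding ps(2) cmod_form_diff[OF ps(1) ps(1)] .
    then show "\<exists>N. \<forall>k\<ge>N. \<forall>m\<ge>N. hnorm form_space (hdiff form_space (ps k) (ps m)) < e"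
      using \<open>0 < e\<close> power2_less_imp_less less_imp_le by meson
  qed
  moreover have "hconverges X (\<lambda>k. fst (ps k)) x"
    using l x s S_closed unfolding hconverges_def by (auto simp: ps_def)
  ultimately show "\<exists>ps. fconv ps x \<and> xs = (\<lambda>k. fst (ps k))"
    using ps(2) by (auto simp: fconv_def)
next
  assume "\<exists>ps. fconv ps x \<and> xs = (\<lambda>k. fst (ps k))"
  then obtain ps where ps: "fconv ps x" and xs: "\<And>k. xs k = fst (ps k)" by auto
  have psS: "ps k \<in> S" for k using fconv_closed(1)[OF ps] .
  have "xs k \<in> Domain S" for k using psS[of k] xs[of k] by (metis DomainI prod.collapse)
  moreover have "\<exists>N. \<forall>k\<ge>N. \<forall>m\<ge>N.
      cmod (snd (relation_form X S lam) (hdiff X (xs k) (xs m)) (hdiff X (xs k) (xs m))) < e"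
    if "0 < e" for e
  proof -
    have "0 < sqrt e" using that by simp
    then obtain N where N: "\<And>k m. k \<ge> N \<Longrightarrow> m \<ge> N \<Longrightarrow> hnorm form_space (hdiff form_space (ps k) (ps m)) < sqrt e"
      using form.hcauchyD[of ps "sqrt e"] ps unfolding fconv_def by auto
    have "(hnorm form_space (hdiff form_space (ps k) (ps m)))\<^sup>2 < e" if "k \<ge> N" "m \<ge> N" for k m
    proof -
      have "0 \<le> hnorm form_space (hdiff form_space (ps k) (ps m))"
        by (intro form.hnorm_ge_0 form.diff_closed) (simp_all add: psS)
      then have "(hnorm form_space (hdiff form_space (ps k) (ps m)))\<^sup>2 < (sqrt e)\<^sup>2"
        using N[OF that] by (intro power_strict_mono) auto
      then show ?thesis using \<open>0 < e\<close> by simp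
    qed
    then show ?thesis unfolding xs cmod_form_diff[OF psS psS] by blast
  qed
  moreover have "x \<in> hcarrier X" "(\<lambda>k. hnorm X (hdiff X (xs k) x)) \<longlonglongrightarrow> 0"
    using ps by (auto simp: fconv_def hconverges_def xs)
  ultimately show "form_converges X (relation_form X S lam) xs x"
    by (auto simp: form_converges_def relation_form_def)
qed

lemma fst_form_closure: "fst (form_closure X (relation_form X S lam)) = form_domain"
  by (auto simp: form_closure_def form_converges_iff form_domain_def)

lemma closable: "form_closable X (relation_form X S lam)"
  unfolding form_closable_def form_converges_iff
proof (intro allI impI, elim exE conjE)
  fix xs ps assume ps: "fconv ps (hzero X)" and xs: "xs = (\<lambda>k. fst (ps k))"
  have psS: "ps k \<in> S" for k using fconv_closed(1)[OF ps] .
  have "(\<lambda>k. hinner form_space (ps k) (ps m)) \<longlonglongrightarrow> 0" for m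
    using fconv_weak_limit[OF ps psS[of m]] psS[of m] by simp
  moreover have "hcauchy form_space ps" using ps by (simp add: fconv_def)
  ultimately have "(\<lambda>k. hnorm form_space (ps k)) \<longlonglongrightarrow> 0" using form.hcauchy_weakly_null by blast
  then have "(\<lambda>k. hinner form_space (ps k) (ps k)) \<longlonglongrightarrow> 0"
    using form.hnorm_tendsto_0_iff[of ps] psS by simp
  then show "(\<lambda>k. snd (relation_form X S lam) (xs k) (xs k)) \<longlonglongrightarrow> 0"
    unfolding xs relation_form_value[OF psS psS] .
qed

lemma form_closure_value:
  assumes x: "(x, x') \<in> friedrichs" and y: "y \<in> form_domain"
  shows "snd (form_closure X (relation_form X S lam)) x y = hinner X x' y - complex_of_real lam * hinner X x y"
proof -
  let ?l = "hinner X x' y - complex_of_real lam * hinner X x y"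
  have x': "(x, x') \<in> rel_adjoint X S" using x by (simp add: friedrichs_iff)
  have lim: "(\<lambda>k. snd (relation_form X S lam) (fst (ps k)) (fst (qs k))) \<longlonglongrightarrow> ?l"
    if "fconv ps x" "fconv qs y" for ps qs
    unfolding relation_form_value[OF fconv_closed(1)[OF that(1)] fconv_closed(1)[OF that(2)]]
    using fconv_pairing[OF that(1) x' that(2)] .
  \<comment> \<open>Uniqueness of \<open>l\<close> needs at least one pair of approximating
    sequences; without one, the quantified condition would hold for every \<open>l\<close>.\<close>
  obtain ps qs where pq: "fconv ps x" "fconv qs y"
    using x y by (auto simp: friedrichs_iff form_domain_def)
  have "(THE l. \<forall>xs ys. form_converges X (relation_form X S lam) xs x \<and>
      form_converges X (relation_form X S lam) ys y \<longrightarrow>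
      (\<lambda>k. snd (relation_form X S lam) (xs k) (ys k)) \<longlonglongrightarrow> l) = ?l"
  proof (rule the_equality)
    show "\<forall>xs ys. form_converges X (relation_form X S lam) xs x \<and>
      form_converges X (relation_form X S lam) ys y \<longrightarrow>
      (\<lambda>k. snd (relation_form X S lam) (xs k) (ys k)) \<longlonglongrightarrow> ?l"
      unfolding form_converges_iff using lim by blast
    fix l assume "\<forall>xs ys. form_converges X (relation_form X S lam) xs x \<and>
      form_converges X (relation_form X S lam) ys y \<longrightarrow>
      (\<lambda>k. snd (relation_form X S lam) (xs k) (ys k)) \<longlonglongrightarrow> l"
    then have "(\<lambda>k. snd (relation_form X S lam) (fst (ps k)) (fst (qs k))) \<longlonglongrightarrow> l"
      unfolding form_converges_iff using pq by blast
    then show "l = ?l" using lim[OF pq] LIMSEQ_unique by blast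
  qed
  then show ?thesis by (simp add: form_closure_def)
qed

lemma friedrichs_is_extension: "friedrichs_extension X S lam friedrichs"
  unfolding friedrichs_extension_def associated_relation_def fst_form_closure
proof (intro conjI friedrichs_self_adjoint S_subset_friedrichs closable self_adjoint_rel_shift ballI)
  show "Domain (rel_shift X friedrichs (complex_of_real lam)) \<subseteq> form_domain"
    by (auto simp: rel_shift_iff friedrichs_iff)
  fix p assume p: "p \<in> rel_shift X friedrichs (complex_of_real lam)"
  obtain x w where [simp]: "p = (x, w)" by fastforce
  obtain x' where x: "(x, x') \<in> friedrichs" and w: "w = hdiff X x' (hscale X (complex_of_real lam) x)"
    using p by (auto simp: rel_shift_iff)
  have "y \<in> hcarrier X" if "y \<in> form_domain" for y
    using that fconv_closed(2) by (auto simp: form_domain_def)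
  then show "case p of (x, x') \<Rightarrow> \<forall>y\<in>form_domain.
      snd (form_closure X (relation_form X S lam)) x y = hinner X x' y"
    using form_closure_value[OF x] friedrichs_closed[OF x] by (simp add: w)
qed

text \<open>Here \<open>g\<close> is arbitrary, so no lower bound is lost on the way from
  \<open>S\<close> to the extension. Both sides are limits along a form-Cauchy sequence; the order
  on complex numbers makes the real and imaginary parts pass to the limit separately.\<close>

lemma bounded_below_by_friedrichs:
  assumes b: "bounded_below_by X (rel_shift X S (complex_of_real lam)) g"
  shows "bounded_below_by X (rel_shift X friedrichs (complex_of_real lam)) g"
  unfolding bounded_below_by_def
proof (intro ballI)
  fix p assume p: "p \<in> rel_shift X friedrichs (complex_of_real lam)"
  obtain x w where pw [simp]: "p = (x, w)" by fastforce
  obtain x' where x: "(x, x') \<in> friedrichs" and w: "w = hdiff X x' (hscale X (complex_of_real lam) x)"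
    using p by (auto simp: rel_shift_iff)
  note [simp] = friedrichs_closed[OF x]
  obtain ps where ps: "fconv ps x" using x by (auto simp: friedrichs_iff form_domain_def)
  have psS: "ps k \<in> S" for k using fconv_closed(1)[OF ps] .
  have px: "hconverges X (\<lambda>k. fst (ps k)) x" using ps by (simp add: fconv_def)
  have lim: "(\<lambda>k. hinner form_space (ps k) (ps k)) \<longlonglongrightarrow> hinner X w x"
    using fconv_pairing[OF ps _ ps] x by (simp add: friedrichs_iff w)
  have "(\<lambda>k. hinner X (fst (ps k)) (fst (ps k))) \<longlonglongrightarrow> hinner X x x"
    by (rule inner_tendsto_diagonal[of _ _ "\<lambda>m. hinner X x (fst (ps m))"])
       (use psS in \<open>simp_all add: hconverges_cauchy[OF px] inner_tendsto_left[OF px] inner_tendsto_right[OF px]\<close>)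
  then have nlim: "(\<lambda>k. complex_of_real (g * (hnorm X (fst (ps k)))\<^sup>2)) \<longlonglongrightarrow> complex_of_real (g * (hnorm X x)\<^sup>2)"
    using tendsto_mult[OF tendsto_const[of "complex_of_real g"]] psS by (simp add: inner_self)
  have le: "complex_of_real (g * (hnorm X (fst (ps k)))\<^sup>2) \<le> hinner form_space (ps k) (ps k)" for k
  proof -
    have "(fst (ps k), hdiff X (snd (ps k)) (hscale X (complex_of_real lam) (fst (ps k)))) \<in> rel_shift X S (complex_of_real lam)"
      using psS[of k] unfolding rel_shift_iff by (metis prod.collapse)
    then have "complex_of_real (g * (hnorm X (fst (ps k)))\<^sup>2) \<le>
        hinner X (hdiff X (snd (ps k)) (hscale X (complex_of_real lam) (fst (ps k)))) (fst (ps k))"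
      using b unfolding bounded_below_by_def by blast
    then show ?thesis using psS[of k] by simp
  qed
  have "Re (complex_of_real (g * (hnorm X x)\<^sup>2)) \<le> Re (hinner X w x)"
    by (rule LIMSEQ_le[OF tendsto_Re[OF nlim] tendsto_Re[OF lim]]) (use le in \<open>simp add: less_eq_complex_def\<close>)
  moreover have "Im (complex_of_real (g * (hnorm X x)\<^sup>2)) = Im (hinner X w x)"
    by (rule LIMSEQ_unique[OF tendsto_Im[OF nlim]])
       (use tendsto_Im[OF lim] le in \<open>simp add: less_eq_complex_def\<close>)
  ultimately show "case p of (x, x') \<Rightarrow> complex_of_real (g * (hnorm X x)\<^sup>2) \<le> hinner X x' x"
    by (simp add: less_eq_complex_def)
qed

text \<open>A sandwich: bounds pass to smaller relations, the closure lies between \<open>S\<close>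
  and \<open>friedrichs\<close>, and bounds of \<open>S\<close> already pass up to
  \<open>friedrichs\<close>.\<close>

lemma bounded_below_by_closure_iff:
  "bounded_below_by X (rel_shift X (rel_closure X S) (complex_of_real lam)) g \<longleftrightarrow>
   bounded_below_by X friedrichs (g + lam)"
proof -
  have mono: "bounded_below_by X (rel_shift X U (complex_of_real lam)) g"
    if "bounded_below_by X (rel_shift X T (complex_of_real lam)) g" "U \<subseteq> T" for U T
    using that unfolding bounded_below_by_def rel_shift_def by blast
  have "S \<subseteq> rel_closure X S"
    using lin by (intro subset_rel_closure) (auto simp: linear_relation_def)
  then have "bounded_below_by X (rel_shift X (rel_closure X S) (complex_of_real lam)) g \<longleftrightarrow>
      bounded_below_by X (rel_shift X friedrichs (complex_of_real lam)) g"
    using mono closure_subset_friedrichs bounded_below_by_friedrichs by blast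
  also have "\<dots> \<longleftrightarrow> (\<forall>x x'. (x, x') \<in> friedrichs \<longrightarrow>
      complex_of_real (g * (hnorm X x)\<^sup>2) \<le> hinner X (hdiff X x' (hscale X (complex_of_real lam) x)) x)"
    unfolding bounded_below_by_def rel_shift_def by blast
  also have "\<dots> \<longleftrightarrow> (\<forall>x x'. (x, x') \<in> friedrichs \<longrightarrow> complex_of_real ((g + lam) * (hnorm X x)\<^sup>2) \<le> hinner X x' x)"
  proof -
    have "complex_of_real (g * (hnorm X x)\<^sup>2) \<le> hinner X (hdiff X x' (hscale X (complex_of_real lam) x)) x
        \<longleftrightarrow> complex_of_real ((g + lam) * (hnorm X x)\<^sup>2) \<le> hinner X x' x"
      if "(x, x') \<in> friedrichs" for x x'
    proof -
      have "hinner X (hdiff X x' (hscale X (complex_of_real lam) x)) x = hinner X x' x - complex_of_real (lam * (hnorm X x)\<^sup>2)"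
        using friedrichs_closed[OF that] by (simp add: inner_self)
      then show ?thesis by (simp only:) (simp add: less_eq_complex_def algebra_simps)
    qed
    then show ?thesis by blast
  qed
  also have "\<dots> \<longleftrightarrow> bounded_below_by X friedrichs (g + lam)"
    unfolding bounded_below_by_def by blast
  finally show ?thesis .
qed

lemma bounded_below_by_closure:
  "bounded_below_by X (rel_shift X (rel_closure X S) (complex_of_real lam)) c"
  using bounded_below_by_friedrichs[OF bound] closure_subset_friedrichs
  unfolding bounded_below_by_def rel_shift_def by blast

lemma lower_bound_friedrichs:
  "lower_bound X friedrichs = lower_bound X (rel_shift X (rel_closure X S) (complex_of_real lam)) + ereal lam"
proof -
  let ?B = "{g. bounded_below_by X (rel_shift X (rel_closure X S) (complex_of_real lam)) g}"
  have "bounded_below_by X friedrichs h \<longleftrightarrow> h - lam \<in> ?B" for h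
    using bounded_below_by_closure_iff[of "h - lam"] by simp
  then have "{ereal h | h. bounded_below_by X friedrichs h} = (\<lambda>g. ereal g + ereal lam) ` ?B"
    by (force simp: image_iff intro: exI[of _ "_ - lam"])
  then have "lower_bound X friedrichs = (SUP g\<in>?B. ereal g + ereal lam)" by (simp add: lower_bound_def)
  also have "\<dots> = (SUP g\<in>?B. ereal g) + ereal lam"
    \<comment> \<open>The set of bounds contains \<open>c\<close>, and a translation commutes with a
      nonempty supremum in the extended reals, even when that supremum is infinite.\<close>
    by (rule SUP_ereal_add_left) (use bounded_below_by_closure in auto)
  also have "(SUP g\<in>?B. ereal g) = lower_bound X (rel_shift X (rel_closure X S) (complex_of_real lam))"
    unfolding lower_bound_def by (rule arg_cong[of _ _ Sup]) auto
  finally show ?thesis .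
qed

lemma lower_bound_closure_pos:
  "0 < lower_bound X (rel_shift X (rel_closure X S) (complex_of_real lam))"
proof -
  have "0 < ereal c" using c_pos by simp
  also have "\<dots> \<le> lower_bound X (rel_shift X (rel_closure X S) (complex_of_real lam))"
    unfolding lower_bound_def by (rule Sup_upper) (use bounded_below_by_closure in blast)
  finally show ?thesis .
qed

theorem friedrichs_extension_of_closure:
  defines "H0 \<equiv> rel_closure X S"
  shows "bounded_from_below X (rel_shift X H0 (complex_of_real lam))"
    and "0 < lower_bound X (rel_shift X H0 (complex_of_real lam))"
    and "deficiency_plus X H0 = deficiency_minus X H0"
    and "\<exists>F. self_adjoint X F \<and> H0 \<subseteq> F \<and>
           lower_bound X F = lower_bound X (rel_shift X H0 (complex_of_real lam)) + ereal lam \<and>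
           friedrichs_extension X S lam F \<and>
           (\<forall>G. self_adjoint X G \<and> H0 \<subseteq> G \<and>
                Domain G \<subseteq> fst (form_closure X (relation_form X S lam)) \<longrightarrow> G = F)"
  unfolding H0_def fst_form_closure
proof -
  show "bounded_from_below X (rel_shift X (rel_closure X S) (complex_of_real lam))"
    using bounded_below_by_closure unfolding bounded_from_below_def by blast
  show "0 < lower_bound X (rel_shift X (rel_closure X S) (complex_of_real lam))"
    by (rule lower_bound_closure_pos)
  show "deficiency_plus X (rel_closure X S) = deficiency_minus X (rel_closure X S)"
    by (rule deficiency_eq[OF friedrichs_self_adjoint closure_subset_friedrichs])
  show "\<exists>F. self_adjoint X F \<and> rel_closure X S \<subseteq> F \<and>
      lower_bound X F = lower_bound X (rel_shift X (rel_closure X S) (complex_of_real lam)) + ereal lam \<and>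
      friedrichs_extension X S lam F \<and>
      (\<forall>G. self_adjoint X G \<and> rel_closure X S \<subseteq> G \<and> Domain G \<subseteq> form_domain \<longrightarrow> G = F)"
    by (intro exI[of _ friedrichs] conjI friedrichs_self_adjoint closure_subset_friedrichs lower_bound_friedrichs friedrichs_is_extension)
       (metis friedrichs_unique)
qed

end

section \<open>Matrices and the Moore--Penrose inverse\<close>

lemma cdot_add_left: "cdot (x + y) z = cdot x z + cdot y z"
  by (simp add: cdot_def sum.distrib algebra_simps)

lemma cdot_add_right: "cdot z (x + y) = cdot z x + cdot z y"
  by (simp add: cdot_def sum.distrib algebra_simps)

lemma cdot_scale_left: "cdot (c *s x) z = cnj c * cdot x z"
  by (simp add: cdot_def sum_distrib_left algebra_simps)

lemma cdot_scale_right: "cdot z (c *s x) = c * cdot z x"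
  by (simp add: cdot_def sum_distrib_left algebra_simps)

lemma cdot_zero_left [simp]: "cdot 0 z = 0"
  by (simp add: cdot_def)

lemma cdot_zero_right [simp]: "cdot z 0 = 0"
  by (simp add: cdot_def)

lemma cdot_minus_left: "cdot (- x) z = - cdot x z"
  by (simp add: cdot_def sum_negf)

lemma cdot_diff_left: "cdot (x - y) z = cdot x z - cdot y z"
  by (simp add: cdot_def sum_subtractf algebra_simps)

lemma cdot_diff_right: "cdot z (x - y) = cdot z x - cdot z y"
  by (simp add: cdot_def sum_subtractf algebra_simps)

lemmas cdot_linear = cdot_add_left cdot_add_right cdot_diff_left cdot_diff_right

lemma cdot_commute: "cdot y x = cnj (cdot x y)"
  by (simp add: cdot_def mult.commute)

lemma cdot_axis: "cdot (axis i 1) x = x $ i"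
proof -
  have "cdot (axis i 1) x = (\<Sum>j\<in>UNIV. if j = i then x $ j else 0)"
    unfolding cdot_def by (rule sum.cong) (auto simp: axis_def)
  then show ?thesis by simp
qed

lemma cdot_self_eq_0: "cdot x x = 0 \<longleftrightarrow> x = 0"
proof
  assume "cdot x x = 0"
  moreover have "cdot x x = complex_of_real (\<Sum>i\<in>UNIV. (cmod (x $ i))\<^sup>2)"
    unfolding cdot_def of_real_sum by (rule sum.cong) (simp, metis complex_norm_square mult.commute of_real_power)
  ultimately have "(\<Sum>i\<in>UNIV. (cmod (x $ i))\<^sup>2) = 0" by (metis of_real_eq_0_iff)
  then have "\<forall>i\<in>UNIV. (cmod (x $ i))\<^sup>2 = 0"
    by (subst (asm) sum_nonneg_eq_0_iff) auto
  then show "x = 0" by (simp add: vec_eq_iff)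
qed simp

lemma cdot_ctranspose: "cdot x (M *v y) = cdot (ctranspose M *v x) y"
proof -
  have "cdot x (M *v y) = (\<Sum>i\<in>UNIV. \<Sum>j\<in>UNIV. cnj (x $ i) * M $ i $ j * y $ j)"
    by (simp add: cdot_def matrix_vector_mult_def sum_distrib_left mult.assoc)
  also have "\<dots> = (\<Sum>j\<in>UNIV. \<Sum>i\<in>UNIV. cnj (x $ i) * M $ i $ j * y $ j)"
    by (rule sum.swap)
  also have "\<dots> = cdot (ctranspose M *v x) y"
    by (simp add: cdot_def ctranspose_def matrix_vector_mult_def sum_distrib_right) (simp add: mult_ac)
  finally show ?thesis .
qed

lemma cdot_hermitian: "hermitian_mat M \<Longrightarrow> cdot x (M *v y) = cdot (M *v x) y"
  using cdot_ctranspose[of x M y] by (simp add: hermitian_mat_def)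

lemma ctranspose_ctranspose [simp]: "ctranspose (ctranspose M) = M"
  by (simp add: ctranspose_def vec_eq_iff)

lemma ctranspose_mult: "ctranspose (M ** N) = ctranspose N ** ctranspose M"
  by (simp add: ctranspose_def vec_eq_iff matrix_matrix_mult_def mult.commute)

text \<open>A Hermitian matrix is injective on its own range: the squared norm of
  \<open>B M x\<close> is \<open><M x, B B M x>\<close>.\<close>

lemma hermitian_cancel:
  assumes H: "hermitian_mat B" and "B ** (B ** M) = 0"
  shows "B ** M = 0"
proof -
  have "B *v (M *v x) = 0" for x
  proof -
    have "B *v (B *v (M *v x)) = 0"
      using assms(2) by (simp add: matrix_vector_mul_assoc matrix_mul_assoc)
    then have "cdot (B *v (M *v x)) (B *v (M *v x)) = 0"
      using cdot_hermitian[OF H, of "M *v x" "B *v (M *v x)"] by simp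
    then show ?thesis by (simp add: cdot_self_eq_0)
  qed
  then show ?thesis by (simp add: matrix_eq matrix_vector_mul_assoc)
qed

lemma ctranspose_0 [simp]: "ctranspose 0 = 0"
  by (simp add: ctranspose_def vec_eq_iff)

lemma hermitian_cancel_right:
  assumes H: "hermitian_mat B" and "(M ** B) ** B = 0"
  shows "M ** B = 0"
proof -
  have "ctranspose B = B" using H by (simp add: hermitian_mat_def)
  then have "B ** (B ** ctranspose M) = 0"
    using arg_cong[OF assms(2), of ctranspose] by (simp add: ctranspose_mult)
  then have "B ** ctranspose M = 0" by (rule hermitian_cancel[OF H])
  then show ?thesis using \<open>ctranspose B = B\<close> ctranspose_mult[of B "ctranspose M"] by simp
qed

lemma matrix_diff_mult: "(M - N) ** (L :: complex^'n^'m) = M ** L - N ** L"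
  by (simp add: vec_eq_iff matrix_matrix_mult_def left_diff_distrib sum_subtractf)

lemma matrix_mult_diff: "(L :: complex^'n^'m) ** (M - N) = L ** M - L ** N"
  by (simp add: vec_eq_iff matrix_matrix_mult_def right_diff_distrib sum_subtractf)

lemma inner_inverse_exists: "\<exists>G. M ** G ** M = (M :: complex^'n^'m)"
proof -
  obtain g where g: "Vector_Spaces.linear (*s) (*s) g" "\<And>v. v \<in> range ((*v) M) \<Longrightarrow> M *v g v = v"
    using vec.linear_exists_right_inverse_on[OF matrix_vector_mul_linear_gen vec.subspace_UNIV, of M] by auto
  have "M ** matrix g ** M = M"
    unfolding matrix_eq
    using g(2) by (simp add: matrix_vector_mul_assoc[symmetric] matrix_works[OF g(1)])
  then show ?thesis ..
qed

definition penrose :: "complex^'n^'m \<Rightarrow> complex^'m^'n \<Rightarrow> bool" where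
  "penrose M X \<longleftrightarrow> M ** X ** M = M \<and> X ** M ** X = X \<and>
     hermitian_mat (M ** X) \<and> hermitian_mat (X ** M)"

lemma penrose_unique:
  assumes "penrose M X" "penrose M Y"
  shows "X = Y"
proof -
  have X: "M ** X ** M = M" "X ** M ** X = X" "ctranspose (M ** X) = M ** X" "ctranspose (X ** M) = X ** M"
    and Y: "M ** Y ** M = M" "Y ** M ** Y = Y" "ctranspose (M ** Y) = M ** Y" "ctranspose (Y ** M) = Y ** M"
    using assms by (auto simp: penrose_def hermitian_mat_def)
  have "M ** X = (M ** Y) ** (M ** X)" using Y(1) by (simp add: matrix_mul_assoc)
  then have "M ** X = (M ** X) ** (M ** Y)" using X(3) Y(3) ctranspose_mult by metis
  then have MX: "M ** X = M ** Y" using X(1) by (simp add: matrix_mul_assoc)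
  have "X ** M = (X ** M) ** (Y ** M)" using Y(1) by (metis matrix_mul_assoc)
  then have "X ** M = (Y ** M) ** (X ** M)" using X(4) Y(4) ctranspose_mult by metis
  then have XM: "X ** M = Y ** M" using X(1) by (metis matrix_mul_assoc)
  show ?thesis using X(2) Y(2) MX XM by (metis matrix_mul_assoc)
qed

text \<open>
  For Hermitian \<open>B\<close> the Moore--Penrose inverse is \<open>B K B\<close> for any \<open>K\<close> with \<open>B\<^sup>3 K B\<^sup>3 = B\<^sup>3\<close>.
\<close>

lemma penrose_exists:
  fixes B :: "complex^'n^'n"
  assumes H: "hermitian_mat B"
  shows "\<exists>X. penrose B X"
proof -
  have cB: "ctranspose B = B" using H by (simp add: hermitian_mat_def)
  obtain K where "(B ** B ** B) ** K ** (B ** B ** B) = B ** B ** B"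
    using inner_inverse_exists[of "B ** B ** B"] by auto
  \<comment> \<open>The generalized inverse is taken of the cube so that two outer factors can be
    cancelled, leaving \<open>B K B^3 = B\<close>.\<close>
  then have "B ** (B ** (B ** (K ** (B ** (B ** B)) - mat 1))) = 0"
    by (simp add: matrix_mul_assoc matrix_mult_diff)
  then have "B ** (K ** (B ** (B ** B)) - mat 1) = 0"
    by (rule hermitian_cancel[OF H, OF hermitian_cancel[OF H]])
  then have 1: "B ** K ** B ** B ** B = B"
    by (simp add: matrix_mul_assoc matrix_mult_diff)
  define X where "X = B ** K ** B"
  have "((B ** X - mat 1) ** B) ** B = B ** (B ** K ** B ** B ** B) - B ** B"
    by (simp add: X_def matrix_mul_assoc matrix_diff_mult)
  also have "\<dots> = 0" by (simp add: 1)
  finally have "(B ** X - mat 1) ** B = 0" by (rule hermitian_cancel_right[OF H])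
  then have BXB: "B ** X ** B = B" by (simp add: matrix_diff_mult)
  have "X ** B ** X = (B ** K ** B ** B ** B) ** K ** B" by (simp add: X_def matrix_mul_assoc)
  then have XBX: "X ** B ** X = X" by (simp add: 1 X_def)
  \<comment> \<open>As \<open>X\<close> begins and ends with \<open>B\<close>, this identity and the
    next give \<open>B X = (B X) (B X)^*\<close> and \<open>X B = (X B)^* (X B)\<close>, which are
    Hermitian by their form.\<close>
  have BP: "B ** ctranspose (B ** X) = B"
    using arg_cong[OF BXB, of ctranspose] by (simp add: ctranspose_mult cB)
  have QB: "ctranspose (X ** B) ** B = B"
    using arg_cong[OF BXB, of ctranspose] by (simp add: ctranspose_mult cB matrix_mul_assoc)
  have "X ** ctranspose (B ** X) = X"
    using BP by (metis X_def matrix_mul_assoc)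
  then have "(B ** X) ** ctranspose (B ** X) = B ** X" by (metis matrix_mul_assoc)
  then have h1: "hermitian_mat (B ** X)"
    unfolding hermitian_mat_def using ctranspose_mult ctranspose_ctranspose by metis
  have "ctranspose (X ** B) ** X = X"
    using QB by (metis X_def matrix_mul_assoc)
  then have "ctranspose (X ** B) ** (X ** B) = X ** B" by (metis matrix_mul_assoc)
  then have h2: "hermitian_mat (X ** B)"
    unfolding hermitian_mat_def using ctranspose_mult ctranspose_ctranspose by metis
  show ?thesis using BXB XBX h1 h2 unfolding penrose_def by blast
qed

lemma penrose_moore_penrose:
  assumes "hermitian_mat B" shows "penrose B (moore_penrose B)"
proof -
  have "\<exists>!X. penrose B X" using penrose_exists[OF assms] penrose_unique by blast
  then have "penrose B (THE X. penrose B X)" by (rule theI')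
  then show ?thesis unfolding penrose_def moore_penrose_def .
qed

text \<open>For Hermitian \<open>B\<close> the product of the pseudoinverse with \<open>B\<close> is
  the orthogonal projection onto the range of \<open>B\<close>, so it disappears when paired with a
  vector of that range. This evaluates the quadratic expression in the definition of a generalized
  zero.\<close>

lemma moore_penrose_mult_range:
  assumes H: "hermitian_mat B"
  shows "cdot (B *v z) ((moore_penrose B ** B) *v y) = cdot (B *v z) y"
proof -
  let ?X = "moore_penrose B"
  have P: "B ** ?X ** B = B" "hermitian_mat (?X ** B)" and cB: "ctranspose B = B"
    using penrose_moore_penrose[OF H] H by (auto simp: penrose_def hermitian_mat_def)
  have "ctranspose (B ** (?X ** B)) = (?X ** B) ** B"
    using P(2) cB by (simp add: ctranspose_mult[of B] hermitian_mat_def)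
  then have "(?X ** B) ** B = B" using P(1) cB by (simp add: matrix_mul_assoc)
  then show ?thesis
    using cdot_hermitian[OF P(2), of "B *v z" y] by (simp add: matrix_vector_mul_assoc)
qed

section \<open>Vectors with the seminorm of a positive semidefinite matrix\<close>

definition vec_ips :: "complex^'n^'n \<Rightarrow> (complex^'n) ips" where
  "vec_ips M = \<lparr> hcarrier = UNIV, hzero = 0, hadd = (+), hscale = (*s),
     hinner = (\<lambda>x y. cdot y (M *v x)) \<rparr>"

lemma vec_ips_sel [simp]:
  "hcarrier (vec_ips M) = UNIV" "hzero (vec_ips M) = 0" "hadd (vec_ips M) x y = x + y"
  "hscale (vec_ips M) c x = c *s x" "hinner (vec_ips M) x y = cdot y (M *v x)"
  by (simp_all add: vec_ips_def)

lemma vec_ips_diff [simp]: "hdiff (vec_ips M) x y = x - y"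
  by (simp add: hdiff_def vec_eq_iff)

lemma semi_inner_space_vec_ips:
  assumes M: "psd_mat M" shows "semi_inner_space (vec_ips M)"
proof
  have H: "hermitian_mat M" using M by (simp add: psd_mat_def)
  show "hinner (vec_ips M) y x = cnj (hinner (vec_ips M) x y)" for x y
    using cdot_hermitian[OF H, of x y] cdot_commute[of "M *v x" y] by simp
  show "0 \<le> Re (hinner (vec_ips M) x x)" for x
    using M by (simp add: psd_mat_def less_eq_complex_def)
qed (simp_all add: cdot_add_right cdot_scale_right matrix_vector_right_distrib
    vector_scalar_commute)

text \<open>\<open>us\<close> itself may fail to converge since \<open>M\<close> may be singular.
  But the coordinates of \<open>M us\<close> are inner products with unit vectors, hence Cauchy, and
  the closed range of \<open>M\<close> contains their limit \<open>M u\<close>. Then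
  \<open>us - u\<close> is Cauchy and weakly null.\<close>

lemma complete_vec_ips:
  assumes M: "psd_mat M" and us: "hcauchy (vec_ips M) us"
  shows "\<exists>u. hconverges (vec_ips M) us u"
proof -
  interpret V: semi_inner_space "vec_ips M" by (rule semi_inner_space_vec_ips[OF M])
  have "Cauchy (\<lambda>k. (M *v us k) $ i)" for i
  proof (rule metric_CauchyI)
    fix e :: real assume e: "0 < e"
    \<comment> \<open>The summand 1 keeps \<open>b\<close> positive when the unit vector has
      seminorm zero.\<close>
    define b where "b = hnorm (vec_ips M) (axis i 1) + 1"
    have b: "0 < b" "hnorm (vec_ips M) (axis i 1) < b"
      using V.hnorm_ge_0[of "axis i 1"] by (simp_all add: b_def add_nonneg_pos)
    obtain N where N: "\<And>k m. k \<ge> N \<Longrightarrow> m \<ge> N \<Longrightarrow> hnorm (vec_ips M) (us k - us m) < e / b"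
      using V.hcauchyD[OF us, of "e / b"] e b(1) by auto
    have "dist ((M *v us k) $ i) ((M *v us m) $ i) < e" if "k \<ge> N" "m \<ge> N" for k m
    proof -
      have "dist ((M *v us k) $ i) ((M *v us m) $ i) = cmod (hinner (vec_ips M) (us k - us m) (axis i 1))"
        by (simp add: cdot_axis dist_norm matrix_vector_mult_diff_distrib)
      also have "\<dots> \<le> hnorm (vec_ips M) (us k - us m) * hnorm (vec_ips M) (axis i 1)"
        by (rule V.cauchy_schwarz) simp_all
      also have "\<dots> \<le> hnorm (vec_ips M) (us k - us m) * b"
        using b(2) by (intro mult_left_mono V.hnorm_ge_0) simp_all
      also have "\<dots> < e" using N[OF that] b(1) by (simp add: field_simps)
      finally show ?thesis .
    qed
    then show "\<exists>N. \<forall>k\<ge>N. \<forall>m\<ge>N. dist ((M *v us k) $ i) ((M *v us m) $ i) < e" by blast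
  qed
  then have "\<forall>i. \<exists>l. (\<lambda>k. (M *v us k) $ i) \<longlonglongrightarrow> l"
    using Cauchy_convergent_iff convergent_def by blast
  then obtain l where "\<And>i. (\<lambda>k. (M *v us k) $ i) \<longlonglongrightarrow> l i" by metis
  then have lim: "(\<lambda>k. M *v us k) \<longlonglongrightarrow> (\<chi> i. l i)" by (intro vec_tendstoI) simp
  have "closed (range ((*v) M))"
    by (intro closed_subspace linear_subspace_image matrix_vector_mul_linear subspace_UNIV)
  then have "(\<chi> i. l i) \<in> range ((*v) M)"
    by (rule closed_sequentially[OF _ _ lim]) auto
  then obtain u where u: "(\<lambda>k. M *v us k) \<longlonglongrightarrow> M *v u" using lim by auto
  have "hcauchy (vec_ips M) (\<lambda>k. hdiff (vec_ips M) (us k) u)"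
    by (rule V.hcauchy_diff[OF us]) (simp add: hcauchy_def hnorm_def)
  then have "(\<lambda>k. hnorm (vec_ips M) (hdiff (vec_ips M) (us k) u)) \<longlonglongrightarrow> 0"
  proof (rule V.hcauchy_weakly_null)
    fix m
    have "(\<lambda>k. cdot (us m - u) (M *v us k)) \<longlonglongrightarrow> cdot (us m - u) (M *v u)"
      unfolding cdot_def by (intro tendsto_intros u)
    then have "(\<lambda>k. cdot (us m - u) (M *v us k) - cdot (us m - u) (M *v u)) \<longlonglongrightarrow> 0"
      by (simp add: LIM_zero_iff)
    then show "(\<lambda>k. hinner (vec_ips M) (hdiff (vec_ips M) (us k) u) (hdiff (vec_ips M) (us m) u)) \<longlonglongrightarrow> 0"
      by (simp add: matrix_vector_mult_diff_distrib cdot_diff_right)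
  qed
  then show ?thesis by (auto simp: hconverges_def)
qed

section \<open>The weighted sequence space\<close>

text \<open>Series are handled here, before the quotient, because an operation on classes only
  returns something built from arbitrary representatives.\<close>

definition seq_ips :: "'n::finite coeff \<Rightarrow> 'n cseq ips" where
  "seq_ips W = \<lparr> hcarrier = l2W W, hzero = (\<lambda>t. (0, 0)),
     hadd = (\<lambda>y z t. y t + z t), hscale = (\<lambda>c y t. (c *s upart y t, c *s vpart y t)),
     hinner = innerW W \<rparr>"

lemma seq_ips_sel [simp]:
  "hcarrier (seq_ips W) = l2W W" "hzero (seq_ips W) = (\<lambda>t. (0, 0))"
  "hadd (seq_ips W) y z = (\<lambda>t. y t + z t)"
  "hscale (seq_ips W) c y = (\<lambda>t. (c *s upart y t, c *s vpart y t))"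
  "hinner (seq_ips W) = innerW W"
  by (simp_all add: seq_ips_def)

lemma seq_ips_diff [simp]: "hdiff (seq_ips W) y z = (\<lambda>t. y t - z t)"
  by (simp add: hdiff_def fun_eq_iff prod_eq_iff vec_eq_iff)

locale weight =
  fixes W :: "'n::finite coeff"
  assumes W_psd: "psd_mat (W t)"
begin

lemma W_hermitian: "hermitian_mat (W t)"
  using W_psd by (simp add: psd_mat_def)

sublocale V: semi_inner_space "vec_ips (W t)" for t
  by (rule semi_inner_space_vec_ips[OF W_psd])

abbreviation seminorm :: "nat \<Rightarrow> complex^'n \<Rightarrow> real" where
  "seminorm t x \<equiv> hnorm (vec_ips (W t)) x"

lemma seminorm_ge_0: "0 \<le> seminorm t x"
  by (rule V.hnorm_ge_0) simp

lemma cdot_W_self: "cdot x (W t *v x) = complex_of_real ((seminorm t x)\<^sup>2)"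
  using V.inner_self[of x t] by simp

lemma l2W_iff: "y \<in> l2W W \<longleftrightarrow> summable (\<lambda>t. (seminorm t (upart y (t + 1)))\<^sup>2)"
proof -
  have "summable (\<lambda>t. complex_of_real (f t)) \<longleftrightarrow> summable f" for f
    using summable_of_real[of f, where 'a = complex] summable_Re[of "\<lambda>t. complex_of_real (f t)"] by auto
  then show ?thesis by (simp only: l2W_def mem_Collect_eq cdot_W_self)
qed

lemma summable_cross:
  assumes "y \<in> l2W W" "z \<in> l2W W"
  shows "summable (\<lambda>t. cdot (upart z (t + 1)) (W t *v upart y (t + 1)))"
proof (rule summable_comparison_test')
  show "summable (\<lambda>t. (seminorm t (upart y (t + 1)))\<^sup>2 + (seminorm t (upart z (t + 1)))\<^sup>2)"
    using assms unfolding l2W_iff by (rule summable_add)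
  fix t :: nat
  have "cmod (cdot (upart z (t + 1)) (W t *v upart y (t + 1))) \<le>
      seminorm t (upart y (t + 1)) * seminorm t (upart z (t + 1))"
    using V.cauchy_schwarz[of "upart y (t + 1)" t "upart z (t + 1)"] by simp
  also have "\<dots> \<le> (seminorm t (upart y (t + 1)))\<^sup>2 + (seminorm t (upart z (t + 1)))\<^sup>2"
    using sum_squares_bound[of "seminorm t (upart y (t + 1))" "seminorm t (upart z (t + 1))"]
      mult_nonneg_nonneg[OF seminorm_ge_0[of t "upart y (t + 1)"] seminorm_ge_0[of t "upart z (t + 1)"]]
    by linarith
  finally show "norm (cdot (upart z (t + 1)) (W t *v upart y (t + 1))) \<le>
      (seminorm t (upart y (t + 1)))\<^sup>2 + (seminorm t (upart z (t + 1)))\<^sup>2" .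
qed

lemma l2W_add:
  assumes "y \<in> l2W W" "z \<in> l2W W" shows "(\<lambda>t. y t + z t) \<in> l2W W"
proof -
  have "summable (\<lambda>t. (cdot (upart y (t + 1)) (W t *v upart y (t + 1)) + cdot (upart z (t + 1)) (W t *v upart y (t + 1))) +
      (cdot (upart y (t + 1)) (W t *v upart z (t + 1)) + cdot (upart z (t + 1)) (W t *v upart z (t + 1))))"
    by (intro summable_add summable_cross assms)
  then show ?thesis
    by (simp add: l2W_def cdot_add_left cdot_add_right matrix_vector_right_distrib algebra_simps)
qed

lemma l2W_scale:
  assumes "y \<in> l2W W" shows "(\<lambda>t. (c *s upart y t, c *s vpart y t)) \<in> l2W W"
proof -
  have "summable (\<lambda>t. (cnj c * c) * cdot (upart y (t + 1)) (W t *v upart y (t + 1)))"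
    by (rule summable_mult[OF summable_cross[OF assms assms]])
  then show ?thesis
    by (simp add: l2W_def cdot_scale_left cdot_scale_right vector_scalar_commute mult.assoc)
qed

sublocale sq: semi_inner_space "seq_ips W"
proof
  show "hzero (seq_ips W) \<in> hcarrier (seq_ips W)" by (simp add: l2W_def)
  show "hadd (seq_ips W) y z \<in> hcarrier (seq_ips W)"
    if "y \<in> hcarrier (seq_ips W)" "z \<in> hcarrier (seq_ips W)" for y z
    using that l2W_add by simp
  show "hscale (seq_ips W) c y \<in> hcarrier (seq_ips W)" if "y \<in> hcarrier (seq_ips W)" for y c
    using that l2W_scale by simp
  show "hinner (seq_ips W) (hzero (seq_ips W)) y = 0" for y
    by (simp add: innerW_def)
  show "hinner (seq_ips W) (hadd (seq_ips W) x y) z = hinner (seq_ips W) x z + hinner (seq_ips W) y z"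
    if "x \<in> hcarrier (seq_ips W)" "y \<in> hcarrier (seq_ips W)" "z \<in> hcarrier (seq_ips W)" for x y z
    using suminf_add[OF summable_cross[of x z] summable_cross[of y z]] that
    by (simp add: innerW_def matrix_vector_right_distrib cdot_add_right)
  show "hinner (seq_ips W) (hscale (seq_ips W) c x) z = c * hinner (seq_ips W) x z"
    if "x \<in> hcarrier (seq_ips W)" "z \<in> hcarrier (seq_ips W)" for x z c
    using suminf_mult[OF summable_cross[of x z]] that
    by (simp add: innerW_def vector_scalar_commute cdot_scale_right)
  show "hinner (seq_ips W) y x = cnj (hinner (seq_ips W) x y)"
    if "x \<in> hcarrier (seq_ips W)" "y \<in> hcarrier (seq_ips W)" for x y
  proof -
    have "(\<lambda>t. cdot (upart y (t + 1)) (W t *v upart x (t + 1))) sums innerW W x y"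
      unfolding innerW_def using summable_cross that by (simp add: summable_sums)
    then have "(\<lambda>t. cnj (cdot (upart y (t + 1)) (W t *v upart x (t + 1)))) sums cnj (innerW W x y)"
      by (simp only: sums_cnj)
    moreover have "cnj (cdot (upart y (t + 1)) (W t *v upart x (t + 1))) =
        cdot (upart x (t + 1)) (W t *v upart y (t + 1))" for t
      using cdot_hermitian[OF W_hermitian] cdot_commute by metis
    ultimately show ?thesis by (simp add: innerW_def sums_iff)
  qed
  show "0 \<le> Re (hinner (seq_ips W) x x)" if "x \<in> hcarrier (seq_ips W)" for x
  proof -
    have s: "summable (\<lambda>t. (seminorm t (upart x (t + 1)))\<^sup>2)" using that l2W_iff by simp
    have "innerW W x x = (\<Sum>t. complex_of_real ((seminorm t (upart x (t + 1)))\<^sup>2))"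
      by (simp only: innerW_def cdot_W_self)
    also have "\<dots> = complex_of_real (\<Sum>t. (seminorm t (upart x (t + 1)))\<^sup>2)"
      using suminf_of_real[OF s, where 'a = complex] by simp
    finally show ?thesis using suminf_nonneg[OF s] by simp
  qed
qed

lemma hnorm_seq:
  assumes "y \<in> l2W W"
  shows "(hnorm (seq_ips W) y)\<^sup>2 = (\<Sum>t. (seminorm t (upart y (t + 1)))\<^sup>2)"
proof -
  have s: "summable (\<lambda>t. (seminorm t (upart y (t + 1)))\<^sup>2)" using assms l2W_iff by simp
  have "innerW W y y = (\<Sum>t. complex_of_real ((seminorm t (upart y (t + 1)))\<^sup>2))"
    by (simp only: innerW_def cdot_W_self)
  also have "\<dots> = complex_of_real (\<Sum>t. (seminorm t (upart y (t + 1)))\<^sup>2)"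
    using suminf_of_real[OF s, where 'a = complex] by simp
  finally show ?thesis using sq.hnorm_power2[of y] assms by simp
qed

lemma sum_seminorm_le:
  assumes "y \<in> l2W W"
  shows "(\<Sum>t<T. (seminorm t (upart y (t + 1)))\<^sup>2) \<le> (hnorm (seq_ips W) y)\<^sup>2"
  unfolding hnorm_seq[OF assms] using assms by (intro sum_le_suminf) (auto simp: l2W_iff)

lemma seminorm_le:
  assumes "y \<in> l2W W"
  shows "seminorm t (upart y (t + 1)) \<le> hnorm (seq_ips W) y"
proof (rule power2_le_imp_le)
  have "(seminorm t (upart y (t + 1)))\<^sup>2 \<le> (\<Sum>t<Suc t. (seminorm t (upart y (t + 1)))\<^sup>2)"
    by (simp add: sum_nonneg)
  then show "(seminorm t (upart y (t + 1)))\<^sup>2 \<le> (hnorm (seq_ips W) y)\<^sup>2"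
    using sum_seminorm_le[OF assms, of "Suc t"] by linarith
  show "0 \<le> hnorm (seq_ips W) y" using sq.hnorm_ge_0 assms by simp
qed

lemma seq_complete:
  assumes ys: "hcauchy (seq_ips W) ys"
  shows "\<exists>y. hconverges (seq_ips W) ys y"
proof -
  have ysl [simp]: "ys k \<in> l2W W" for k using sq.hcauchy_closed[OF ys, of k] by simp
  have d [simp]: "(\<lambda>t. ys k t - ys m t) \<in> l2W W" for k m
    using sq.diff_closed[of "ys k" "ys m"] by simp
  have "\<exists>u. hconverges (vec_ips (W t)) (\<lambda>k. upart (ys k) (t + 1)) u" for t
  proof (rule complete_vec_ips[OF W_psd], rule hcauchy_dominated[OF ys])
    show "upart (ys k) (t + 1) \<in> hcarrier (vec_ips (W t))" for k by simp
    show "hnorm (vec_ips (W t)) (hdiff (vec_ips (W t)) (upart (ys k) (t + 1)) (upart (ys m) (t + 1))) \<le>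
        hnorm (seq_ips W) (hdiff (seq_ips W) (ys k) (ys m))" for k m
      using seminorm_le[OF d[of k m], of t] by simp
  qed
  then obtain u where u: "\<And>t. hconverges (vec_ips (W t)) (\<lambda>k. upart (ys k) (t + 1)) (u t)" by metis
  \<comment> \<open>The weight \<open>W t\<close> acts on index \<open>t + 1\<close>, hence the
    shift. The second components and the first component at index 0 are invisible to the seminorm;
    they receive default values.\<close>
  define y :: "'n cseq" where "y t = (u (t - 1), 0)" for t
  \<comment> \<open>Finite partial sums pass to the limit in \<open>m\<close>. A bound independent
    of \<open>T\<close> then gives both membership in \<open>l2W\<close> and the estimate of the
    distance.\<close>
  have bound: "(\<Sum>t<T. (seminorm t (upart (ys k) (t + 1) - u t))\<^sup>2) \<le> e\<^sup>2"
    if N: "\<forall>m\<ge>N. hnorm (seq_ips W) (\<lambda>t. ys k t - ys m t) < e" for k N e T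
  proof (rule LIMSEQ_le_const2)
    show "(\<lambda>m. \<Sum>t<T. (seminorm t (upart (ys k) (t + 1) - upart (ys m) (t + 1)))\<^sup>2)
        \<longlonglongrightarrow> (\<Sum>t<T. (seminorm t (upart (ys k) (t + 1) - u t))\<^sup>2)"
    proof (intro tendsto_sum tendsto_power)
      fix t
      have lim: "(\<lambda>m. seminorm t (upart (ys m) (t + 1) - u t)) \<longlonglongrightarrow> 0"
        using u[of t] by (simp add: hconverges_def)
      have "norm (seminorm t (upart (ys k) (t + 1) - upart (ys m) (t + 1)) - seminorm t (upart (ys k) (t + 1) - u t))
          \<le> seminorm t (upart (ys m) (t + 1) - u t)" for m
        using V.hnorm_diff_triangle[of "upart (ys k) (t + 1)" t "upart (ys m) (t + 1)" "u t"]
          V.hnorm_diff_triangle[of "upart (ys k) (t + 1)" t "u t" "upart (ys m) (t + 1)"]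
          V.hnorm_diff_commute[of "u t" t "upart (ys m) (t + 1)"]
        by (simp add: abs_le_iff)
      then have "(\<lambda>m. seminorm t (upart (ys k) (t + 1) - upart (ys m) (t + 1)) - seminorm t (upart (ys k) (t + 1) - u t)) \<longlonglongrightarrow> 0"
        by (rule tendsto_0_dominated[OF _ lim])
      then show "(\<lambda>m. seminorm t (upart (ys k) (t + 1) - upart (ys m) (t + 1))) \<longlonglongrightarrow> seminorm t (upart (ys k) (t + 1) - u t)"
        by (simp add: LIM_zero_iff)
    qed
    have "(\<Sum>t<T. (seminorm t (upart (ys k) (t + 1) - upart (ys m) (t + 1)))\<^sup>2) \<le> e\<^sup>2" if "m \<ge> N" for m
    proof -
      have "(hnorm (seq_ips W) (\<lambda>t. ys k t - ys m t))\<^sup>2 \<le> e\<^sup>2"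
        using N that sq.hnorm_ge_0[of "\<lambda>t. ys k t - ys m t"] by (intro power_mono) auto
      then show ?thesis using sum_seminorm_le[OF d[of k m], of T] by simp
    qed
    then show "\<exists>M. \<forall>m\<ge>M. (\<Sum>t<T. (seminorm t (upart (ys k) (t + 1) - upart (ys m) (t + 1)))\<^sup>2) \<le> e\<^sup>2" by blast
  qed
  have diff: "(\<lambda>t. ys k t - y t) \<in> l2W W \<and> (hnorm (seq_ips W) (\<lambda>t. ys k t - y t))\<^sup>2 \<le> e\<^sup>2"
    if N: "\<forall>m\<ge>N. hnorm (seq_ips W) (\<lambda>t. ys k t - ys m t) < e" for k N e
  proof -
    have s: "summable (\<lambda>t. (seminorm t (upart (ys k) (t + 1) - u t))\<^sup>2)"
      by (rule summableI_nonneg_bounded[OF _ bound[OF N]]) simp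
    then have l: "(\<lambda>t. ys k t - y t) \<in> l2W W" by (simp add: l2W_iff y_def)
    moreover have "(\<Sum>t. (seminorm t (upart (ys k) (t + 1) - u t))\<^sup>2) \<le> e\<^sup>2"
      by (rule suminf_le_const[OF s bound[OF N]])
    ultimately show ?thesis using hnorm_seq[OF l] by (simp add: y_def)
  qed
  have cau: "\<exists>N. \<forall>k\<ge>N. \<forall>m\<ge>N. hnorm (seq_ips W) (\<lambda>t. ys k t - ys m t) < e" if "0 < e" for e
    using sq.hcauchyD[OF ys that] by simp
  obtain N where N: "\<forall>m\<ge>N. hnorm (seq_ips W) (\<lambda>t. ys N t - ys m t) < 1"
    using cau[OF zero_less_one] by blast
  have "(\<lambda>t. ys N t - (ys N t - y t)) \<in> l2W W"
    using sq.diff_closed[of "ys N" "\<lambda>t. ys N t - y t"] diff[OF N] by simp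
  then have y [simp]: "y \<in> l2W W" by simp
  have "(\<lambda>k. hnorm (seq_ips W) (\<lambda>t. ys k t - y t)) \<longlonglongrightarrow> 0"
  proof (rule LIMSEQ_I)
    fix e :: real assume e: "0 < e"
    then obtain N where N: "\<forall>k\<ge>N. \<forall>m\<ge>N. hnorm (seq_ips W) (\<lambda>t. ys k t - ys m t) < e / 2"
      using cau[of "e / 2"] by auto
    have "norm (hnorm (seq_ips W) (\<lambda>t. ys k t - y t) - 0) < e" if "k \<ge> N" for k
    proof -
      have "\<forall>m\<ge>N. hnorm (seq_ips W) (\<lambda>t. ys k t - ys m t) < e / 2" using N that by blast
      then have l: "(\<lambda>t. ys k t - y t) \<in> l2W W"
        and sq: "(hnorm (seq_ips W) (\<lambda>t. ys k t - y t))\<^sup>2 \<le> (e / 2)\<^sup>2"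
        using diff by blast+
      have "hnorm (seq_ips W) (\<lambda>t. ys k t - y t) \<le> e / 2"
        by (rule power2_le_imp_le[OF sq]) (use e in simp)
      then show ?thesis
        using e sq.hnorm_ge_0[of "\<lambda>t. ys k t - y t"] l by simp
    qed
    then show "\<exists>no. \<forall>k\<ge>no. norm (hnorm (seq_ips W) (\<lambda>t. ys k t - y t) - 0) < e" by blast
  qed
  then have "hconverges (seq_ips W) ys y" by (auto simp: hconverges_def)
  then show ?thesis by blast
qed

lemma l2W_diff: "\<lbrakk>y \<in> l2W W; z \<in> l2W W\<rbrakk> \<Longrightarrow> (\<lambda>t. y t - z t) \<in> l2W W"
  using sq.diff_closed[of y z] by simp

section \<open>Passage to equivalence classes\<close>

lemma equiv_iff: "(y, z) \<in> l2W_equiv W \<longleftrightarrow> y \<in> l2W W \<and> z \<in> l2W W \<and> hnorm (seq_ips W) (\<lambda>t. y t - z t) = 0"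
proof -
  have "innerW W (\<lambda>t. y t - z t) (\<lambda>t. y t - z t) = 0 \<longleftrightarrow> hnorm (seq_ips W) (\<lambda>t. y t - z t) = 0"
    if "y \<in> l2W W" "z \<in> l2W W"
    using sq.inner_self[of "\<lambda>t. y t - z t"] l2W_diff[OF that] by simp
  then show ?thesis by (auto simp: l2W_equiv_def)
qed

lemma equiv_l2W: "equiv (l2W W) (l2W_equiv W)"
proof (rule equivI)
  show "l2W_equiv W \<subseteq> l2W W \<times> l2W W" by (auto simp: l2W_equiv_def)
  show "refl_on (l2W W) (l2W_equiv W)"
    by (rule refl_onI) (auto simp: l2W_equiv_def innerW_def)
  show "sym (l2W_equiv W)"
  proof (rule symI)
    fix y z assume "(y, z) \<in> l2W_equiv W"
    then show "(z, y) \<in> l2W_equiv W"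
      using sq.hnorm_diff_commute[of y z] by (simp add: equiv_iff)
  qed
  show "trans (l2W_equiv W)"
  proof (rule transI)
    fix x y z assume a: "(x, y) \<in> l2W_equiv W" "(y, z) \<in> l2W_equiv W"
    then have "hnorm (seq_ips W) (\<lambda>t. x t - z t) \<le> 0"
      using sq.hnorm_diff_triangle[of x y z] by (simp add: equiv_iff)
    then show "(x, z) \<in> l2W_equiv W"
      using a sq.hnorm_ge_0[of "\<lambda>t. x t - z t"] l2W_diff[of x z] by (simp add: equiv_iff antisym)
  qed
qed

lemma L2W_sel [simp]:
  "hcarrier (L2W W) = l2W W // l2W_equiv W" "hzero (L2W W) = clsW W (\<lambda>t. (0, 0))"
  "hadd (L2W W) Y Z = clsW W (\<lambda>t. repr Y t + repr Z t)"
  "hscale (L2W W) c Y = clsW W (\<lambda>t. (c *s upart (repr Y) t, c *s vpart (repr Y) t))"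
  "hinner (L2W W) Y Z = innerW W (repr Y) (repr Z)"
  by (simp_all add: L2W_def)

lemma clsW_closed [simp]: "y \<in> l2W W \<Longrightarrow> clsW W y \<in> l2W W // l2W_equiv W"
  unfolding clsW_def by (rule quotientI)

lemma repr_closed [simp]: "Y \<in> l2W W // l2W_equiv W \<Longrightarrow> repr Y \<in> l2W W"
  and clsW_repr: "Y \<in> l2W W // l2W_equiv W \<Longrightarrow> clsW W (repr Y) = Y"
proof -
  assume Y: "Y \<in> l2W W // l2W_equiv W"
  then obtain y where y: "y \<in> l2W W" "Y = l2W_equiv W `` {y}" by (auto elim: quotientE)
  then have "y \<in> Y" using equiv_class_self[OF equiv_l2W] by simp
  then have r: "repr Y \<in> Y" unfolding repr_def by (rule someI[of "\<lambda>y. y \<in> Y"])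
  then show "repr Y \<in> l2W W" using y(2) by (simp add: equiv_iff)
  show "clsW W (repr Y) = Y"
    using r y(2) equiv_class_eq[OF equiv_l2W, of y "repr Y"] by (simp add: clsW_def)
qed

lemma repr_clsW: "y \<in> l2W W \<Longrightarrow> (y, repr (clsW W y)) \<in> l2W_equiv W"
  using clsW_repr[OF clsW_closed, of y] equiv_l2W unfolding clsW_def
  by (metis eq_equiv_class repr_closed clsW_closed clsW_def)

lemma innerW_repr_left [simp]:
  assumes "y \<in> l2W W" "z \<in> l2W W"
  shows "innerW W (repr (clsW W y)) z = innerW W y z"
proof -
  have r: "repr (clsW W y) \<in> l2W W" "hnorm (seq_ips W) (\<lambda>t. y t - repr (clsW W y) t) = 0"
    using repr_clsW[OF assms(1)] by (simp_all add: equiv_iff)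
  then have "cmod (innerW W y z - innerW W (repr (clsW W y)) z) \<le> 0"
    using sq.cauchy_schwarz[of "\<lambda>t. y t - repr (clsW W y) t" z] l2W_diff assms
      sq.inner_diff_left[of y "repr (clsW W y)" z] by simp
  then show ?thesis by simp
qed

lemma innerW_repr_right [simp]:
  assumes "y \<in> l2W W" "z \<in> l2W W"
  shows "innerW W z (repr (clsW W y)) = innerW W z y"
  using innerW_repr_left[OF assms] sq.inner_commute[of z y] sq.inner_commute[of "repr (clsW W y)" z]
    assms repr_closed[OF clsW_closed[OF assms(1)]] by simp

sublocale L: semi_inner_space "L2W W"
proof
  note add = l2W_add and scale = l2W_scale
  have zero: "(\<lambda>t. (0, 0)) \<in> l2W W" using sq.zero_closed by simp
  show "hzero (L2W W) \<in> hcarrier (L2W W)" using zero by simp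
  show "hadd (L2W W) Y Z \<in> hcarrier (L2W W)" if "Y \<in> hcarrier (L2W W)" "Z \<in> hcarrier (L2W W)" for Y Z
    using that add by simp
  show "hscale (L2W W) c Y \<in> hcarrier (L2W W)" if "Y \<in> hcarrier (L2W W)" for Y c
    using that scale by simp
  show "hinner (L2W W) (hzero (L2W W)) Y = 0" if "Y \<in> hcarrier (L2W W)" for Y
    using that zero sq.inner_zero_left[of "repr Y"] by simp
  show "hinner (L2W W) (hadd (L2W W) X Y) Z = hinner (L2W W) X Z + hinner (L2W W) Y Z"
    if "X \<in> hcarrier (L2W W)" "Y \<in> hcarrier (L2W W)" "Z \<in> hcarrier (L2W W)" for X Y Z
    using that add[of "repr X" "repr Y"] sq.inner_add_left[of "repr X" "repr Y" "repr Z"] by simp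
  show "hinner (L2W W) (hscale (L2W W) c X) Z = c * hinner (L2W W) X Z"
    if "X \<in> hcarrier (L2W W)" "Z \<in> hcarrier (L2W W)" for X Z c
    using that scale[of "repr X" c] sq.inner_scale_left[of "repr X" "repr Z" c] by simp
  show "hinner (L2W W) Y X = cnj (hinner (L2W W) X Y)"
    if "X \<in> hcarrier (L2W W)" "Y \<in> hcarrier (L2W W)" for X Y
    using that sq.inner_commute[of "repr X" "repr Y"] by simp
  show "0 \<le> Re (hinner (L2W W) X X)" if "X \<in> hcarrier (L2W W)" for X
    using that sq.inner_nonneg[of "repr X"] by simp
qed

text \<open>The representative of a difference of classes is not the difference of the
  representatives; both squared norms are expanded into the same four inner products. Completeness
  is transferred to classes through this isometry.\<close>

lemma hnorm_L2W_diff: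
  assumes "Y \<in> l2W W // l2W_equiv W" "Z \<in> l2W W // l2W_equiv W"
  shows "hnorm (L2W W) (hdiff (L2W W) Y Z) = hnorm (seq_ips W) (\<lambda>t. repr Y t - repr Z t)"
proof -
  have c: "Y \<in> hcarrier (L2W W)" "Z \<in> hcarrier (L2W W)"
    "repr Y \<in> hcarrier (seq_ips W)" "repr Z \<in> hcarrier (seq_ips W)"
    using assms by simp_all
  have "hinner (L2W W) (hdiff (L2W W) Y Z) (hdiff (L2W W) Y Z) =
      hinner (L2W W) Y Y - hinner (L2W W) Y Z - (hinner (L2W W) Z Y - hinner (L2W W) Z Z)"
    using c(1,2) by (simp del: L2W_sel)
  moreover have "hinner (seq_ips W) (hdiff (seq_ips W) (repr Y) (repr Z)) (hdiff (seq_ips W) (repr Y) (repr Z)) =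
      hinner (seq_ips W) (repr Y) (repr Y) - hinner (seq_ips W) (repr Y) (repr Z) -
      (hinner (seq_ips W) (repr Z) (repr Y) - hinner (seq_ips W) (repr Z) (repr Z))"
    using c(3,4) by (simp del: seq_ips_sel seq_ips_diff)
  ultimately have "hinner (L2W W) (hdiff (L2W W) Y Z) (hdiff (L2W W) Y Z) =
      hinner (seq_ips W) (\<lambda>t. repr Y t - repr Z t) (\<lambda>t. repr Y t - repr Z t)"
    by simp
  then show ?thesis by (simp add: hnorm_def)
qed

sublocale L: hilbert_space "L2W W"
proof
  fix Y Z assume a: "Y \<in> hcarrier (L2W W)" "Z \<in> hcarrier (L2W W)"
    and "hnorm (L2W W) (hdiff (L2W W) Y Z) = 0"
  then have "(repr Y, repr Z) \<in> l2W_equiv W" by (simp add: equiv_iff hnorm_L2W_diff)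
  then have "clsW W (repr Y) = clsW W (repr Z)"
    unfolding clsW_def by (rule equiv_class_eq[OF equiv_l2W])
  then show "Y = Z" using a clsW_repr by simp
next
  fix Ys assume Ys: "hcauchy (L2W W) Ys"
  have c [simp]: "Ys k \<in> l2W W // l2W_equiv W" for k using L.hcauchy_closed[OF Ys, of k] by simp
  have "hcauchy (seq_ips W) (\<lambda>k. repr (Ys k))"
    by (rule hcauchy_dominated[OF Ys]) (simp_all add: hnorm_L2W_diff)
  then obtain y where y: "hconverges (seq_ips W) (\<lambda>k. repr (Ys k)) y" using seq_complete by blast
  have yl [simp]: "y \<in> l2W W" using sq.hconverges_closed(2)[OF y] by simp
  have "hnorm (L2W W) (hdiff (L2W W) (Ys k) (clsW W y)) = hnorm (seq_ips W) (\<lambda>t. repr (Ys k) t - y t)" for k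
  proof -
    have "hnorm (seq_ips W) (\<lambda>t. y t - repr (clsW W y) t) = 0" using repr_clsW[of y] by (simp add: equiv_iff)
    then have "hnorm (seq_ips W) (\<lambda>t. repr (Ys k) t - repr (clsW W y) t) = hnorm (seq_ips W) (\<lambda>t. repr (Ys k) t - y t)"
      using sq.hnorm_diff_triangle[of "repr (Ys k)" y "repr (clsW W y)"]
        sq.hnorm_diff_triangle[of "repr (Ys k)" "repr (clsW W y)" y]
        sq.hnorm_diff_commute[of y "repr (clsW W y)"] by simp
    then show ?thesis by (simp add: hnorm_L2W_diff)
  qed
  then have "hconverges (L2W W) Ys (clsW W y)" using y by (auto simp: hconverges_def)
  then show "\<exists>Y. hconverges (L2W W) Ys Y" ..
qed

lemma hadd_clsW:
  assumes "y \<in> l2W W" "z \<in> l2W W"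
  shows "hadd (L2W W) (clsW W y) (clsW W z) = clsW W (\<lambda>t. y t + z t)"
proof (rule L.eqI)
  note [simp] = assms l2W_add[OF assms] l2W_add
  show "hadd (L2W W) (clsW W y) (clsW W z) \<in> hcarrier (L2W W)" by simp
  show "clsW W (\<lambda>t. y t + z t) \<in> hcarrier (L2W W)" by simp
  show "hinner (L2W W) (hadd (L2W W) (clsW W y) (clsW W z)) V = hinner (L2W W) (clsW W (\<lambda>t. y t + z t)) V"
    if "V \<in> hcarrier (L2W W)" for V
    using that sq.inner_add_left[of y z "repr V"] sq.inner_add_left[of "repr (clsW W y)" "repr (clsW W z)" "repr V"]
    by simp
qed

lemma hscale_clsW:
  assumes "y \<in> l2W W"
  shows "hscale (L2W W) c (clsW W y) = clsW W (\<lambda>t. (c *s upart y t, c *s vpart y t))"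
proof (rule L.eqI)
  note [simp] = assms l2W_scale
  show "hscale (L2W W) c (clsW W y) \<in> hcarrier (L2W W)" by simp
  show "clsW W (\<lambda>t. (c *s upart y t, c *s vpart y t)) \<in> hcarrier (L2W W)" by simp
  show "hinner (L2W W) (hscale (L2W W) c (clsW W y)) V = hinner (L2W W) (clsW W (\<lambda>t. (c *s upart y t, c *s vpart y t))) V"
    if "V \<in> hcarrier (L2W W)" for V
    using that sq.inner_scale_left[of y "repr V" c] sq.inner_scale_left[of "repr (clsW W y)" "repr V" c]
    by simp
qed

end

section \<open>Positivity of disconjugate systems\<close>

locale hamiltonian_system =
  fixes A B C W :: "'n::finite coeff"
  assumes coeffs: "hamiltonian_coeffs A B C W"
begin

lemma B_hermitian: "hermitian_mat (B t)" and B_psd: "psd_mat (B t)"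
  and C_hermitian: "hermitian_mat (C t)"
  using coeffs by (simp_all add: hamiltonian_coeffs_def psd_mat_def)

sublocale weight W
  by standard (use coeffs in \<open>simp add: hamiltonian_coeffs_def\<close>)

lemma A_tilde_inverse: "(mat 1 - A t) ** A_tilde A t = mat 1" "A_tilde A t ** (mat 1 - A t) = mat 1"
proof -
  have "\<exists>X. (mat 1 - A t) ** X = mat 1 \<and> X ** (mat 1 - A t) = mat 1"
    using coeffs by (simp add: hamiltonian_coeffs_def invertible_def)
  then have "(mat 1 - A t) ** matrix_inv (mat 1 - A t) = mat 1 \<and> matrix_inv (mat 1 - A t) ** (mat 1 - A t) = mat 1"
    unfolding matrix_inv_def by (rule someI_ex)
  then show "(mat 1 - A t) ** A_tilde A t = mat 1" "A_tilde A t ** (mat 1 - A t) = mat 1"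
    by (simp_all add: A_tilde_def)
qed

text \<open>Invertibility of \<open>1 - A t\<close> turns the implicit first equation into a forward
  recursion.\<close>

lemma step_iff: "x - y = A t *v x + b \<longleftrightarrow> x = A_tilde A t *v (y + b)"
proof
  assume "x - y = A t *v x + b"
  then have "(mat 1 - A t) *v x = y + b"
    by (simp add: matrix_vector_mult_diff_rdistrib algebra_simps)
  then show "x = A_tilde A t *v (y + b)"
    using A_tilde_inverse(2)[of t] by (metis matrix_vector_mul_assoc matrix_vector_mul_lid)
next
  assume "x = A_tilde A t *v (y + b)"
  then have "(mat 1 - A t) *v x = y + b"
    using A_tilde_inverse(1)[of t] by (simp add: matrix_vector_mul_assoc)
  then show "x - y = A t *v x + b"
    by (simp add: matrix_vector_mult_diff_rdistrib algebra_simps)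
qed

text \<open>Only the first equation is imposed: \<open>k\<close> acts as a free control, as in a
  discrete variational problem.\<close>

definition admissible :: "nat \<Rightarrow> (nat \<Rightarrow> complex^'n) \<Rightarrow> (nat \<Rightarrow> complex^'n) \<Rightarrow> bool" where
  "admissible N h k \<longleftrightarrow> (\<forall>t<N. h (Suc t) - h t = A t *v h (Suc t) + B t *v k t)"

text \<open>\<open>g\<close> stays abstract because it is used twice: with
  \<open>(C - lam0 W) u\<close> for solutions, and with \<open>C u - W u'\<close> for elements of
  the pre-minimal relation.\<close>

lemma summation_by_parts:
  assumes "admissible N h k" and "\<And>t. t < N \<Longrightarrow> v (Suc t) - v t = g t - ctranspose (A t) *v v t"
  shows "(\<Sum>t<N. cdot (h (Suc t)) (g t) + cdot (k t) (B t *v v t)) = cdot (h N) (v N) - cdot (h 0) (v 0)"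
  using assms
proof (induction N)
  case (Suc N)
  have h: "h (Suc N) - h N = A N *v h (Suc N) + B N *v k N"
    and v: "v (Suc N) - v N = g N - ctranspose (A N) *v v N"
    using Suc.prems by (simp_all add: admissible_def)
  have "cdot (h (Suc N)) (v (Suc N)) - cdot (h N) (v N) =
      cdot (h (Suc N)) (v (Suc N) - v N) + cdot (h (Suc N) - h N) (v N)"
    by (simp add: cdot_linear)
  also have "\<dots> = cdot (h (Suc N)) (g N) + cdot (k N) (B N *v v N)"
    unfolding h v using cdot_ctranspose[of "h (Suc N)" "ctranspose (A N)" "v N"]
      cdot_hermitian[OF B_hermitian, of "k N" N "v N"]
    by (simp add: cdot_linear)
  finally have "cdot (h (Suc N)) (g N) + cdot (k N) (B N *v v N) =
      cdot (h (Suc N)) (v (Suc N)) - cdot (h N) (v N)" by simp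
  then show ?case using Suc by (simp add: admissible_def)
qed simp

end

section \<open>The quadratic functional and the solutions at \<open>lam0\<close>\<close>

locale hamiltonian_lambda = hamiltonian_system +
  fixes lam0 :: real
begin

definition CW :: "nat \<Rightarrow> complex^'a \<Rightarrow> complex^'a" where
  "CW t u = C t *v u - complex_of_real lam0 *s (W t *v u)"

lemma CW_add: "CW t (x + y) = CW t x + CW t y"
  by (simp add: CW_def matrix_vector_right_distrib vec_eq_iff algebra_simps)

lemma CW_diff: "CW t (x - y) = CW t x - CW t y"
  by (simp add: CW_def matrix_vector_mult_diff_distrib vec_eq_iff algebra_simps)

lemma CW_zero [simp]: "CW t 0 = 0"
  by (simp add: CW_def vec_eq_iff)

lemma mult_scaleR: "(M :: complex^'a^'a) *v (r *\<^sub>R x) = r *\<^sub>R (M *v x)"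
  by (rule linear_scale[OF matrix_vector_mul_linear])

lemma CW_scaleR: "CW t (r *\<^sub>R x) = r *\<^sub>R CW t x"
  by (simp add: CW_def mult_scaleR vec_eq_iff algebra_simps)

lemma cdot_CW: "cdot x (CW t y) = cdot x (C t *v y) - complex_of_real lam0 * cdot x (W t *v y)"
  by (simp add: CW_def cdot_diff_right cdot_scale_right)

lemma cdot_hermitian_commute: "hermitian_mat M \<Longrightarrow> cdot y (M *v x) = cnj (cdot x (M *v y))"
  using cdot_hermitian[of M x y] cdot_commute[of y "M *v x"] by simp

lemma cdot_CW_commute: "cdot y (CW t x) = cnj (cdot x (CW t y))"
  using cdot_hermitian_commute[OF C_hermitian[of t], of y x] cdot_hermitian_commute[OF W_hermitian[of t], of y x]
  by (simp add: cdot_CW)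

text \<open>The polarized quadratic functional of the system on \<open>0..N\<close>; its diagonal is
  the quantity whose positivity is at stake.\<close>

definition Q where
  "Q N h k u v = (\<Sum>t<N. cdot (h (Suc t)) (CW t (u (Suc t))) + cdot (k t) (B t *v v t))"

lemma Q_commute: "Q N u v h k = cnj (Q N h k u v)"
  unfolding Q_def cnj_sum
  by (rule sum.cong) (auto simp: cdot_CW_commute[of "u _"] cdot_hermitian_commute[OF B_hermitian, of "v _"])

lemma Q_real: "Im (Q N h k h k) = 0"
  using Q_commute[of N h k h k] by (simp add: complex_eq_iff)

lemma Q_diff:
  "Q N h k h k = Q N (\<lambda>t. h t - u t) (\<lambda>t. k t - v t) (\<lambda>t. h t - u t) (\<lambda>t. k t - v t) +
     Q N (\<lambda>t. h t - u t) (\<lambda>t. k t - v t) u v + cnj (Q N (\<lambda>t. h t - u t) (\<lambda>t. k t - v t) u v) + Q N u v u v"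
  unfolding Q_commute[of N u v "\<lambda>t. h t - u t" "\<lambda>t. k t - v t", symmetric]
  unfolding Q_def sum.distrib[symmetric]
  by (rule sum.cong) (auto simp: CW_diff matrix_vector_mult_diff_distrib cdot_linear)

text \<open>The solutions with \<open>u 0 = 0\<close>, parametrized by \<open>v 0\<close>. Each has
  a generalized zero at 0 by construction.\<close>

primrec sol :: "complex^'a \<Rightarrow> nat \<Rightarrow> (complex^'a) \<times> (complex^'a)" where
  "sol c 0 = (0, c)"
| "sol c (Suc t) = (let u = A_tilde A t *v (fst (sol c t) + B t *v snd (sol c t))
     in (u, snd (sol c t) + (CW t u - ctranspose (A t) *v snd (sol c t))))"

lemma sol_solution: "is_solution A B C W (complex_of_real lam0) (sol c)"
  unfolding is_solution_def step_iff by (simp add: Let_def CW_def)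

lemma solution_admissible:
  "is_solution A B C W (complex_of_real lam0) y \<Longrightarrow> admissible N (upart y) (vpart y)"
  by (simp add: is_solution_def admissible_def)

lemma solution_v:
  "is_solution A B C W (complex_of_real lam0) y \<Longrightarrow>
    vpart y (Suc t) - vpart y t = CW t (upart y (Suc t)) - ctranspose (A t) *v vpart y t"
  by (simp add: is_solution_def CW_def)

text \<open>Solutions are the stationary points of the functional, so pairing one with an admissible
  pair leaves only boundary terms.\<close>

lemma Q_solution:
  assumes "is_solution A B C W (complex_of_real lam0) y" "admissible N h k"
  shows "Q N h k (upart y) (vpart y) = cdot (h N) (vpart y N) - cdot (h 0) (vpart y 0)"
  unfolding Q_def by (rule summation_by_parts[OF assms(2)]) (rule solution_v[OF assms(1)])

text \<open>Real linearity is the form in which injectivity implies surjectivity for maps of a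
  finite-dimensional Euclidean space into itself.\<close>

lemma sol_linear: "linear (\<lambda>c. fst (sol c N))"
proof -
  have "sol (c + d) N = sol c N + sol d N" for c d
    by (induction N) (simp_all add: Let_def matrix_vector_right_distrib CW_add algebra_simps)
  moreover have "sol (r *\<^sub>R c) N = r *\<^sub>R sol c N" for r c
    by (induction N) (simp_all add: Let_def mult_scaleR CW_scaleR scaleR_add_right[symmetric] scaleR_diff_right[symmetric])
  ultimately show ?thesis by (intro linearI) simp_all
qed

end

section \<open>From disconjugacy to positivity\<close>

locale disconjugate_system = hamiltonian_lambda +
  assumes disc: "disconjugate A B C W (complex_of_real lam0)"
    and normal: "identically_normal A B"
begin

text \<open>Strictness concerns \<open>h\<close> alone: \<open>k t\<close> enters only modulo the
  kernel of \<open>B t\<close>, so it cannot be forced to vanish.\<close>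

definition positive :: "nat \<Rightarrow> bool" where
  "positive N \<longleftrightarrow> (\<forall>h k. admissible N h k \<and> h 0 = 0 \<and> h N = 0 \<longrightarrow>
     0 \<le> Re (Q N h k h k) \<and> (Re (Q N h k h k) = 0 \<longrightarrow> (\<forall>t\<le>N. h t = 0)))"

lemma positiveD:
  assumes "positive N" "admissible N h k" "h 0 = 0" "h N = 0"
  shows "0 \<le> Re (Q N h k h k)" "\<lbrakk>Re (Q N h k h k) = 0; t \<le> N\<rbrakk> \<Longrightarrow> h t = 0"
  using assms unfolding positive_def by blast+

text \<open>If \<open>u\<close> vanishes at both ends, the functional of the solution is zero, so
  strictness kills \<open>u\<close> and normality kills \<open>v\<close>. The latter is applied on
  \<open>0..N - 1\<close>, and \<open>2 \<le> N\<close> gives this interval two points.\<close>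

lemma sol_surj:
  assumes pos: "positive N" and N: "2 \<le> N"
  shows "\<exists>c. fst (sol c N) = x"
proof -
  have "c = 0" if c: "fst (sol c N) = 0" for c
  proof -
    note s = sol_solution[of c]
    have adm: "admissible N (upart (sol c)) (vpart (sol c))" by (rule solution_admissible[OF s])
    have "Q N (upart (sol c)) (vpart (sol c)) (upart (sol c)) (vpart (sol c)) = 0"
      using Q_solution[OF s adm] c by simp
    then have u: "upart (sol c) t = 0" if "t \<le> N" for t
      using positiveD(2)[OF pos adm _ c _ that] by simp
    have v: "vpart (sol c) (t + 1) - vpart (sol c) t = - (ctranspose (A t) *v vpart (sol c) t) \<and> B t *v vpart (sol c) t = 0"
      if "t \<in> {0..N - 1}" for t
    proof -
      have t: "t < N" using that N by auto
      then have u0: "upart (sol c) t = 0" "upart (sol c) (Suc t) = 0" using u by (simp_all del: sol.simps)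
      have "upart (sol c) (Suc t) - upart (sol c) t = A t *v upart (sol c) (Suc t) + B t *v vpart (sol c) t"
        using adm t unfolding admissible_def by blast
      then show ?thesis
        using solution_v[OF s, of t] by (simp add: u0 del: sol.simps)
    qed
    have "vpart (sol c) 0 = 0"
      by (rule normal[unfolded identically_normal_def, rule_format, of 0 "N - 1" "vpart (sol c)"])
         (use N in simp, erule v, simp)
    then show ?thesis by simp
  qed
  then have "inj (\<lambda>c. fst (sol c N))" using linear_injective_0[OF sol_linear] by blast
  then have "surj (\<lambda>c. fst (sol c N))" using linear_injective_imp_surjective[OF sol_linear] by blast
  then obtain c where "x = fst (sol c N)" by (rule surjE)
  then show ?thesis by (intro exI[of _ c]) (rule sym)
qed

text \<open>
  Given \<open>(h, k)\<close> vanishing at both ends, subtract the solution that agrees with \<open>h\<close> at \<open>0\<close> and at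
  the last interior point \<open>N\<close>.  The cross terms vanish, and the form of what is left at the last
  step is nonpositive only if that solution has a second generalized zero at \<open>N + 1\<close>.
\<close>

lemma positive_all: "positive N"
proof (induction N)
  case 0
  then show ?case by (simp add: positive_def Q_def)
next
  case (Suc N)
  show ?case unfolding positive_def
  proof (intro allI impI)
    fix h k assume a: "admissible (Suc N) h k \<and> h 0 = 0 \<and> h (Suc N) = 0"
    then have admN: "admissible N h k" and h0: "h 0 = 0" and hN: "h (Suc N) = 0"
      by (simp_all add: admissible_def)
    have step: "h (Suc N) - h N = A N *v h (Suc N) + B N *v k N"
      using a unfolding admissible_def by blast
    have "- h N = B N *v k N" using step hN by simp
    then have x: "h N = - (B N *v k N)" by (metis minus_minus)
    have QS: "Q (Suc N) h k h k = Q N h k h k + cdot (k N) (B N *v k N)" using hN by (simp add: Q_def)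
    show "0 \<le> Re (Q (Suc N) h k h k) \<and> (Re (Q (Suc N) h k h k) = 0 \<longrightarrow> (\<forall>t\<le>Suc N. h t = 0))"
    proof (cases "h N = 0")
      case True
      then have "Q (Suc N) h k h k = Q N h k h k" using QS x by simp
      moreover have "h t = 0" if "Re (Q N h k h k) = 0" "t \<le> Suc N" for t
        using positiveD(2)[OF Suc admN h0 True that(1), of t] that(2) hN by (cases "t = Suc N") simp_all
      ultimately show ?thesis using positiveD(1)[OF Suc admN h0 True] by simp
    next
      case False
      have "\<exists>c. fst (sol c N) = h N"
      proof (cases "2 \<le> N")
        case True
        then show ?thesis using sol_surj[OF Suc] by blast
      next
        case F: False
        \<comment> \<open>The remaining length: \<open>N = 0\<close> contradicts
          \<open>h 0 = 0\<close>, and for \<open>N = 1\<close> a single step of the recursion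
          started with \<open>v 0 = k 0\<close> reaches \<open>h 1\<close>.\<close>
        then have N: "N = Suc 0" using False h0 by (cases N) auto
        then have "h N - h 0 = A 0 *v h N + B 0 *v k 0" using admN by (simp add: admissible_def)
        then have "h N = A_tilde A 0 *v (h 0 + B 0 *v k 0)" by (simp only: step_iff)
        then show ?thesis using N h0 by (intro exI[of _ "k 0"]) (simp add: Let_def)
      qed
      then obtain c where c: "fst (sol c N) = h N" ..
      define u v where "u = upart (sol c)" and "v = vpart (sol c)"
      note s = sol_solution[of c]
      have u0: "u 0 = 0" "u N = h N" using c by (simp_all add: u_def)
      have admu: "admissible N u v" unfolding u_def v_def by (rule solution_admissible[OF s])
      have admd: "admissible N (\<lambda>t. h t - u t) (\<lambda>t. k t - v t)"
        unfolding admissible_def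
      proof (intro allI impI)
        fix t assume "t < N"
        then have "h (Suc t) - h t = A t *v h (Suc t) + B t *v k t" "u (Suc t) - u t = A t *v u (Suc t) + B t *v v t"
          using admN admu by (simp_all add: admissible_def)
        then have "(h (Suc t) - h t) - (u (Suc t) - u t) = (A t *v h (Suc t) + B t *v k t) - (A t *v u (Suc t) + B t *v v t)"
          by simp
        then show "h (Suc t) - u (Suc t) - (h t - u t) = A t *v (h (Suc t) - u (Suc t)) + B t *v (k t - v t)"
          by (simp add: matrix_vector_mult_diff_distrib algebra_simps)
      qed
      have cross: "Q N (\<lambda>t. h t - u t) (\<lambda>t. k t - v t) u v = 0"
        using Q_solution[OF s admd] u0 h0 by (simp add: u_def v_def)
      have Quv: "Q N u v u v = cdot (h N) (v N)"
        using Q_solution[OF s, of N u v] admu u0 by (simp add: u_def v_def)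
      have dpos: "0 \<le> Re (Q N (\<lambda>t. h t - u t) (\<lambda>t. k t - v t) (\<lambda>t. h t - u t) (\<lambda>t. k t - v t))"
        by (rule positiveD(1)[OF Suc admd]) (simp_all add: u0 h0)
      have kBk: "cdot (k N) (B N *v k N) = - cdot (h N) (k N)"
        using cdot_hermitian[OF B_hermitian, of "k N" N "k N"] by (simp add: x cdot_minus_left)
      \<comment> \<open>The solution contributes \<open><h N, v N>\<close> and the last step
        contributes \<open>-<h N, k N>\<close>, because \<open>h (N + 1) = 0\<close> forces
        \<open>h N = - B k N\<close>.\<close>
      have Qeq: "Re (Q (Suc N) h k h k) = Re (Q N (\<lambda>t. h t - u t) (\<lambda>t. k t - v t) (\<lambda>t. h t - u t) (\<lambda>t. k t - v t)) +
          Re (cdot (h N) (v N - k N))"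
        unfolding QS Q_diff[of N h k u v] cross Quv kBk by (simp add: cdot_diff_right)
      have "0 < Re (cdot (h N) (v N - k N))"
      proof (rule ccontr)
        assume "\<not> 0 < Re (cdot (h N) (v N - k N))"
        \<comment> \<open>A generalized zero asks for a real nonpositive number, so the imaginary
          parts have to be excluded as well: the first term is a value of the real functional, the
          second is minus \<open><k N, B k N>\<close>.\<close>
        moreover have "Im (cdot (h N) (v N)) = 0" using Q_real[of N u v] Quv by simp
        moreover have "Im (cdot (h N) (k N)) = 0"
        proof -
          have "0 \<le> cdot (k N) (B N *v k N)" using B_psd[of N] unfolding psd_mat_def by blast
          then have "Im (cdot (k N) (B N *v k N)) = 0" by (simp add: less_eq_complex_def)
          then show ?thesis using kBk by simp
        qed
        ultimately have le: "cdot (h N) (v N - k N) \<le> 0"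
          by (simp add: less_eq_complex_def cdot_diff_right)
        have "u (Suc N) = A_tilde A N *v (u N + B N *v v N)" by (simp add: u_def v_def Let_def)
        \<comment> \<open>Substituting \<open>u N = h N = - B k N\<close> puts the next value into
          the required range and exposes \<open>v N - k N\<close>, the vector of the boundary
          term.\<close>
        also have "u N + B N *v v N = B N *v (v N - k N)"
          by (simp add: u0 x matrix_vector_mult_diff_distrib)
        finally have uS: "u (Suc N) = A_tilde A N *v (B N *v (v N - k N))" .
        then have "(mat 1 - A N) *v u (Suc N) = B N *v (v N - k N)"
          using A_tilde_inverse(1)[of N] by (simp add: matrix_vector_mul_assoc matrix_mul_assoc)
        then have "(moore_penrose (B N) ** (mat 1 - A N)) *v u (Suc N) = (moore_penrose (B N) ** B N) *v (v N - k N)"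
          by (simp add: matrix_vector_mul_assoc[symmetric])
        moreover have "cdot (h N) ((moore_penrose (B N) ** B N) *v (v N - k N)) = cdot (h N) (v N - k N)"
          using moore_penrose_mult_range[OF B_hermitian, of N "k N" "v N - k N"] by (simp add: x cdot_minus_left)
        moreover have "u (Suc N) \<in> range (\<lambda>x. (A_tilde A N ** B N) *v x)"
          using uS by (auto simp: matrix_vector_mul_assoc)
        ultimately have "generalized_zero A B (sol c) (Suc N)"
          using le u0 False by (simp add: u_def del: sol.simps)
        moreover have "generalized_zero A B (sol c) 0" by simp
        ultimately show False using disc s unfolding disconjugate_def by (metis nat.distinct(1))
      qed
      \<comment> \<open>The functional is strictly positive here, so the equality clause is
        vacuous.\<close>
      then show ?thesis using Qeq dpos by simp
    qed
  qed
qed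

section \<open>The pre-minimal relation is linear and semibounded\<close>

lemma Q_nonneg:
  assumes "admissible N h k" "h 0 = 0" "h N = 0"
  shows "0 \<le> Q N h k h k"
  using positiveD(1)[OF positive_all assms] Q_real[of N h k] by (simp add: less_eq_complex_def)

lemma preminimal_form_bound:
  assumes y: "y \<in> l2W0 W" and y': "y' \<in> l2W W" and sys: "inhom_system A B C W y y'"
  shows "complex_of_real lam0 * innerW W y y \<le> innerW W y' y"
proof -
  obtain s where s: "\<And>t. s \<le> t \<Longrightarrow> y t = (0, 0)" and y0: "y 0 = (0, 0)"
    using y by (auto simp: l2W0_def)
  \<comment> \<open>All terms with \<open>t \<ge> s\<close> contain \<open>y (t + 1) = 0\<close>.
    The same \<open>s\<close> makes \<open>(y, v)\<close> vanish at the right end, so summation by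
    parts leaves no boundary term.\<close>
  have fin: "innerW W z y = (\<Sum>t<s. cdot (upart y (Suc t)) (W t *v upart z (Suc t)))" for z
    unfolding innerW_def by (simp, rule suminf_finite) (auto simp: s)
  have adm: "admissible s (upart y) (vpart y)"
    using sys by (simp add: admissible_def inhom_system_def)
  have "(\<Sum>t<s. cdot (upart y (Suc t)) (C t *v upart y (Suc t) - W t *v upart y' (Suc t)) +
      cdot (vpart y t) (B t *v vpart y t)) = cdot (upart y s) (vpart y s) - cdot (upart y 0) (vpart y 0)"
    by (rule summation_by_parts[OF adm]) (use sys in \<open>simp add: inhom_system_def algebra_simps\<close>)
  then have "(\<Sum>t<s. cdot (upart y (Suc t)) (C t *v upart y (Suc t)) + cdot (vpart y t) (B t *v vpart y t)) - innerW W y' y = 0"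
    using s[of s] y0 by (simp add: fin cdot_diff_right sum.distrib sum_subtractf algebra_simps)
  then have "(\<Sum>t<s. cdot (upart y (Suc t)) (C t *v upart y (Suc t)) + cdot (vpart y t) (B t *v vpart y t)) = innerW W y' y"
    by simp
  then have "Q s (upart y) (vpart y) (upart y) (vpart y) = innerW W y' y - complex_of_real lam0 * innerW W y y"
    by (simp add: Q_def cdot_CW fin sum.distrib sum_subtractf sum_distrib_left algebra_simps)
  then show ?thesis using Q_nonneg[OF adm] y0 s[of s] by simp
qed

lemma l2W0_subset: "y \<in> l2W0 W \<Longrightarrow> y \<in> l2W W"
  by (simp add: l2W0_def)

lemma linear_preminimal: "linear_relation (L2W W) (preminimal_relation A B C W)"
  unfolding linear_relation_def
proof (intro conjI allI ballI)
  show "preminimal_relation A B C W \<subseteq> hcarrier (L2W W) \<times> hcarrier (L2W W)"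
    by (auto simp: preminimal_relation_def l2W0_subset)
  have "(\<lambda>t. (0, 0)) \<in> l2W0 W" "inhom_system A B C W (\<lambda>t. (0, 0)) (\<lambda>t. (0, 0))"
    using sq.zero_closed by (simp_all add: l2W0_def inhom_system_def)
  then show "(hzero (L2W W), hzero (L2W W)) \<in> preminimal_relation A B C W"
    unfolding preminimal_relation_def L2W_sel using sq.zero_closed by auto
  fix p assume "p \<in> preminimal_relation A B C W"
  then obtain y y' where p [simp]: "p = (clsW W y, clsW W y')"
    and y: "y \<in> l2W0 W" "y' \<in> l2W W" and sy: "inhom_system A B C W y y'"
    by (auto simp: preminimal_relation_def)
  note [simp] = l2W0_subset[OF y(1)] y(2)
  show "case p of (Y, Y') \<Rightarrow> \<forall>(Z, Z')\<in>preminimal_relation A B C W.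
      (hadd (L2W W) Y Z, hadd (L2W W) Y' Z') \<in> preminimal_relation A B C W"
  proof (simp only: p split_conv, intro ballI)
    fix q assume "q \<in> preminimal_relation A B C W"
    then obtain z z' where q [simp]: "q = (clsW W z, clsW W z')"
      and z: "z \<in> l2W0 W" "z' \<in> l2W W" and sz: "inhom_system A B C W z z'"
      by (auto simp: preminimal_relation_def)
    note [simp] = l2W0_subset[OF z(1)] z(2)
    obtain s1 s2 where s: "\<And>t. s1 \<le> t \<Longrightarrow> y t = (0, 0)" "\<And>t. s2 \<le> t \<Longrightarrow> z t = (0, 0)"
      using y(1) z(1) unfolding l2W0_def by blast
    have "\<forall>t\<ge>max s1 s2. y t + z t = (0, 0)" using s by simp
    then have "\<exists>s. \<forall>t\<ge>s. y t + z t = (0, 0)" by blast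
    moreover have "y 0 + z 0 = (0, 0)" using y(1) z(1) by (simp add: l2W0_def)
    ultimately have "(\<lambda>t. y t + z t) \<in> l2W0 W"
      using l2W_add[of y z] unfolding l2W0_def by auto
    moreover have "inhom_system A B C W (\<lambda>t. y t + z t) (\<lambda>t. y' t + z' t)"
      unfolding inhom_system_def
    proof (intro allI conjI)
      fix t
      have "fst (y (t + 1) + z (t + 1)) - fst (y t + z t) =
          (upart y (t + 1) - upart y t) + (upart z (t + 1) - upart z t)" by simp
      also have "\<dots> = (A t *v upart y (t + 1) + B t *v vpart y t) + (A t *v upart z (t + 1) + B t *v vpart z t)"
        using sy sz by (simp only: inhom_system_def)
      also have "\<dots> = A t *v fst (y (t + 1) + z (t + 1)) + B t *v snd (y t + z t)"
        by (simp add: matrix_vector_right_distrib)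
      finally show "fst (y (t + 1) + z (t + 1)) - fst (y t + z t) =
          A t *v fst (y (t + 1) + z (t + 1)) + B t *v snd (y t + z t)" .
      have "snd (y (t + 1) + z (t + 1)) - snd (y t + z t) =
          (vpart y (t + 1) - vpart y t) + (vpart z (t + 1) - vpart z t)" by simp
      also have "\<dots> = (C t *v upart y (t + 1) - ctranspose (A t) *v vpart y t - W t *v upart y' (t + 1)) +
          (C t *v upart z (t + 1) - ctranspose (A t) *v vpart z t - W t *v upart z' (t + 1))"
        using sy sz by (simp only: inhom_system_def)
      also have "\<dots> = C t *v fst (y (t + 1) + z (t + 1)) - ctranspose (A t) *v snd (y t + z t) - W t *v fst (y' (t + 1) + z' (t + 1))"
        by (simp add: matrix_vector_right_distrib)
      finally show "snd (y (t + 1) + z (t + 1)) - snd (y t + z t) =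
          C t *v fst (y (t + 1) + z (t + 1)) - ctranspose (A t) *v snd (y t + z t) - W t *v fst (y' (t + 1) + z' (t + 1))" .
    qed
    ultimately have "(clsW W (\<lambda>t. y t + z t), clsW W (\<lambda>t. y' t + z' t)) \<in> preminimal_relation A B C W"
      unfolding preminimal_relation_def using l2W_add[of y' z'] by auto
    then show "case q of (Z, Z') \<Rightarrow>
        (hadd (L2W W) (clsW W y) Z, hadd (L2W W) (clsW W y') Z') \<in> preminimal_relation A B C W"
      by (simp add: hadd_clsW del: L2W_sel)
  qed
  fix c
  obtain s1 where s: "\<And>t. s1 \<le> t \<Longrightarrow> y t = (0, 0)" using y(1) unfolding l2W0_def by blast
  let ?y = "\<lambda>t. (c *s upart y t, c *s vpart y t)" and ?y' = "\<lambda>t. (c *s upart y' t, c *s vpart y' t)"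
  have "\<forall>t\<ge>s1. ?y t = (0, 0)" using s by simp
  moreover have "?y 0 = (0, 0)" using y(1) by (simp add: l2W0_def)
  ultimately have "?y \<in> l2W0 W"
    using l2W_scale[of y c] unfolding l2W0_def by auto
  moreover have "inhom_system A B C W ?y ?y'"
    unfolding inhom_system_def
  proof (intro allI conjI)
    fix t
    have "fst (?y (t + 1)) - fst (?y t) = c *s (upart y (t + 1) - upart y t)"
      by (simp add: vector_ssub_ldistrib)
    also have "upart y (t + 1) - upart y t = A t *v upart y (t + 1) + B t *v vpart y t"
      using sy by (simp only: inhom_system_def)
    also have "c *s (A t *v upart y (t + 1) + B t *v vpart y t) = A t *v fst (?y (t + 1)) + B t *v snd (?y t)"
      by (simp add: vector_add_ldistrib vector_scalar_commute)
    finally show "fst (?y (t + 1)) - fst (?y t) = A t *v fst (?y (t + 1)) + B t *v snd (?y t)" .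
    have "snd (?y (t + 1)) - snd (?y t) = c *s (vpart y (t + 1) - vpart y t)"
      by (simp add: vector_ssub_ldistrib)
    also have "vpart y (t + 1) - vpart y t =
        C t *v upart y (t + 1) - ctranspose (A t) *v vpart y t - W t *v upart y' (t + 1)"
      using sy by (simp only: inhom_system_def)
    also have "c *s (C t *v upart y (t + 1) - ctranspose (A t) *v vpart y t - W t *v upart y' (t + 1)) =
        C t *v fst (?y (t + 1)) - ctranspose (A t) *v snd (?y t) - W t *v fst (?y' (t + 1))"
      by (simp add: vector_ssub_ldistrib vector_scalar_commute)
    finally show "snd (?y (t + 1)) - snd (?y t) =
        C t *v fst (?y (t + 1)) - ctranspose (A t) *v snd (?y t) - W t *v fst (?y' (t + 1))" .
  qed
  ultimately have "(clsW W ?y, clsW W ?y') \<in> preminimal_relation A B C W"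
    unfolding preminimal_relation_def using l2W_scale[of y' c] by auto
  then show "case p of (Y, Y') \<Rightarrow> (hscale (L2W W) c Y, hscale (L2W W) c Y') \<in> preminimal_relation A B C W"
    by (simp add: hscale_clsW del: L2W_sel)
qed

lemma bounded_below_preminimal:
  "bounded_below_by (L2W W) (rel_shift (L2W W) (preminimal_relation A B C W) (complex_of_real lam)) (lam0 - lam)"
  unfolding bounded_below_by_def
proof (intro ballI)
  fix p assume "p \<in> rel_shift (L2W W) (preminimal_relation A B C W) (complex_of_real lam)"
  then obtain y y' where p: "p = (clsW W y, hdiff (L2W W) (clsW W y') (hscale (L2W W) (complex_of_real lam) (clsW W y)))"
    and y0: "y \<in> l2W0 W" and y' [simp]: "y' \<in> l2W W" and sys: "inhom_system A B C W y y'"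
    by (auto simp: preminimal_relation_def rel_shift_def)
  have y [simp]: "y \<in> l2W W" using y0 by (rule l2W0_subset)
  have c: "clsW W y \<in> hcarrier (L2W W)" "clsW W y' \<in> hcarrier (L2W W)" by simp_all
  have inn: "hinner (L2W W) (clsW W y) (clsW W y) = innerW W y y" "hinner (L2W W) (clsW W y') (clsW W y) = innerW W y' y"
    by simp_all
  have n: "complex_of_real ((hnorm (L2W W) (clsW W y))\<^sup>2) = innerW W y y"
    using L.inner_self[OF c(1)] inn(1) by simp
  have "hinner (L2W W) (hdiff (L2W W) (clsW W y') (hscale (L2W W) (complex_of_real lam) (clsW W y))) (clsW W y) =
      innerW W y' y - complex_of_real lam * innerW W y y"
    using c inn by (simp del: L2W_sel)
  moreover have "complex_of_real ((lam0 - lam) * (hnorm (L2W W) (clsW W y))\<^sup>2) \<le> innerW W y' y - complex_of_real lam * innerW W y y"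
  proof -
    have "complex_of_real ((lam0 - lam) * (hnorm (L2W W) (clsW W y))\<^sup>2) = complex_of_real lam0 * innerW W y y - complex_of_real lam * innerW W y y"
      unfolding of_real_mult n by (simp add: algebra_simps)
    also have "\<dots> \<le> innerW W y' y - complex_of_real lam * innerW W y y"
      using preminimal_form_bound[OF y0 y' sys] by (rule diff_right_mono)
    finally show ?thesis .
  qed
  ultimately show "case p of (x, x') \<Rightarrow> complex_of_real ((lam0 - lam) * (hnorm (L2W W) x)\<^sup>2) \<le> hinner (L2W W) x' x"
    by (simp add: p)
qed

end

theorem theorem3p9:
  fixes A B C W :: "nat \<Rightarrow> complex^'n^'n" and lam0 lam :: real
  assumes "hamiltonian_coeffs A B C W"
    and "disconjugate A B C W (complex_of_real lam0)"
    and "identically_normal A B"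
    and "definiteness_condition A B C W"
    and "lam < lam0"
  shows "let X = L2W W;
             H00 = preminimal_relation A B C W;
             H0 = minimal_relation A B C W;
             \<gamma> = lower_bound X (rel_shift X H0 (complex_of_real lam))
         in bounded_from_below X (rel_shift X H0 (complex_of_real lam)) \<and> 0 < \<gamma> \<and>
            deficiency_plus X H0 = deficiency_minus X H0 \<and>
            (\<exists>F. self_adjoint X F \<and> H0 \<subseteq> F \<and> lower_bound X F = \<gamma> + ereal lam \<and>
                 friedrichs_extension X H00 lam F \<and>
                 (\<forall>G. self_adjoint X G \<and> H0 \<subseteq> G \<and>
                      Domain G \<subseteq> fst (form_closure X (relation_form X H00 lam)) \<longrightarrow> G = F))"
proof -
  interpret D: disconjugate_system A B C W lam0
    by standard (use assms in simp_all)
  \<comment> \<open>The bound \<open>lam0 - lam\<close> is positive because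
    \<open>lam < lam0\<close>; the actual \<gamma>, a supremum of bounds, may be larger.\<close>
  interpret S: semibounded_relation "L2W W" "preminimal_relation A B C W" lam "lam0 - lam"
    by standard (use assms(5) D.linear_preminimal D.bounded_below_preminimal in simp_all)
  show ?thesis
    unfolding Let_def minimal_relation_def
    using S.friedrichs_extension_of_closure by blast
qed

end
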